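(* Let $X$ be a smooth manifold and consider a cohomology-valued power series in $t$ of the form $$\alpha(t)=\sum_{m=0}^\infty\alpha_{rm}t^{rm+\beta},$$ where $\alpha_{rm},\beta\in H^*(X)$ and $r\in\mathbb{N}_{>0}$. Assume $\alpha(t)$ is $(T,\theta,A)$-scaled asymptotically Mittag-Leffler for some $T\in\mathbb{R}_{>0}$, $\theta\in\mathbb{R}$ and $A\in H^*(X)$. Let $\phi\in\mathbb{R}$. Then, as $t\to e^{\mathtt{i}\phi}\cdot\infty$, $$\alpha(t)=\begin{cases}\frac1r\,e^{\mathtt{i}(\theta+\phi)\beta}\,e^{T|t|}\cdot(A+o(1)) & \text{when }\theta+\phi\in\frac{2\pi}{r}\mathbb{Z},\\ e^{T|t|}\cdot o(1)&\text{otherwise.}\end{cases}$$ Moreover, if the coefficients admit the asymptotic series, as $m\to\infty$, $$\alpha_{rm}=\frac{T^{rm+\beta}e^{\mathtt{i}\theta(rm+\beta)}}{\Gamma(1+rm+\beta)}\cdot\left(\sum_{\ell=0}^LA_\ell m^{-\ell}+o(m^{-L})\right)$$ for some $L\in\mathbb{N}$ and $A_0(=A),A_1,\dots,A_L\in H^*(X)$, then, as $t\to e^{\mathtt{i}\phi}\cdot\infty$, $$\alpha(t)=\begin{cases}e^{T|t|}\cdot\left(\sum_{\ell=0}^L\frac1r\,e^{\mathtt{i}(\theta+\phi)\beta}\,B_\ell\,(T|t|)^{-\ell}+o(|t|^{-L})\right)&\text{when }\theta+\phi\in\frac{2\pi}{r}\mathbb{Z},\\ e^{T|t|}\cdot o(|t|^{-L})&\text{otherwise,}\end{cases}$$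 for some $B_0(=A),B_1,\dots,B_L\in H^*(X)$.
   Context: Cohomology is with complex coefficients, $H^*(X)=H^*(X,\mathbb{C})$, and $\mathbb{N}$ contains $0$. $X$ is connected with finite-dimensional cohomology, $H^0(X)=\mathbb{C}$; the exponent class $\beta$ is a class of even degree (a sum of even-degree components), written $\beta=\beta_0+\beta_{\ge2}$ with $\beta_0\in\mathbb{C}$ and $\beta_{\ge2}$ nilpotent. Functions of such classes are defined by Taylor expansion in the nilpotent part: $f(\beta)=\sum_{k\ge0}\frac1{k!}f^{(k)}(\beta_0)\beta_{\ge2}^k$; this applies to $\Gamma$, $1/\Gamma$ and to exponentials. In particular $T^{rm+\beta}=\exp((rm+\beta)\log T)$. $(T,\theta,A)$-scaled asymptotically Mittag-Leffler means that, as $m\to\infty$, $$\alpha_{rm}=\frac{T^{rm+\beta}e^{\mathtt{i}\theta(rm+\beta)}}{\Gamma(1+rm+\beta)}\cdot(A+o(1)).$$ "$t\to e^{\mathtt{i}\phi}\cdot\infty$" means $t=|t|e^{\mathtt{i}\phi}$ with fixed argument $\phi$ (regarded on the universal cover of $\mathbb{C}^\times$) and $|t|\to+\infty$, with $t^{rm+\beta}=|t|^{rm+\beta}e^{\mathtt{i}\phi(rm+\beta)}$. The $o(\cdot)$ terms are cohomology-valued, measured in any norm on $H^*(X)$. *)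

theory Defs
  imports
    "HOL-Homology.Homology"
    "HOL-Complex_Analysis.Complex_Analysis"
    "HOL-Library.Landau_Symbols"
begin

section \<open>Smooth manifolds\<close>

text \<open>
  The model space is \<^term>\<open>Euclidean_space n\<close>, whose points are the sequences vanishing from
  index \<open>n\<close> on; this keeps the dimension a number and includes dimension \<open>0\<close>.  The space
  carrying the manifold structure is a type, which the sorts \<^class>\<open>t2_space\<close> and
  \<^class>\<open>second_countable_topology\<close> make Hausdorff and second countable.
\<close>

type_synonym 'x chart = "'x set \<times> ('x \<Rightarrow> nat \<Rightarrow> real)"

primrec C_k_on :: "nat \<Rightarrow> nat \<Rightarrow> (nat \<Rightarrow> real) set \<Rightarrow> ((nat \<Rightarrow> real) \<Rightarrow> real) \<Rightarrow> bool" where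
  "C_k_on 0 n U f \<longleftrightarrow>
     continuous_map (subtopology (Euclidean_space n) U) euclideanreal f"
| "C_k_on (Suc k) n U f \<longleftrightarrow>
     continuous_map (subtopology (Euclidean_space n) U) euclideanreal f \<and>
     (\<forall>i<n. \<exists>g. C_k_on k n U g \<and>
        (\<forall>x\<in>U. ((\<lambda>s. f (x(i := s))) has_real_derivative g x) (at (x i))))"

definition smooth_map_on ::
    "nat \<Rightarrow> (nat \<Rightarrow> real) set \<Rightarrow> ((nat \<Rightarrow> real) \<Rightarrow> nat \<Rightarrow> real) \<Rightarrow> bool" where
  "smooth_map_on n U F \<longleftrightarrow> (\<forall>j<n. \<forall>k. C_k_on k n U (\<lambda>x. F x j))"

definition smooth_atlas :: "nat \<Rightarrow> 'x::topological_space chart set \<Rightarrow> bool" where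
  "smooth_atlas n \<A> \<longleftrightarrow>
     (\<Union>(U, \<phi>)\<in>\<A>. U) = UNIV \<and>
     (\<forall>(U, \<phi>)\<in>\<A>. open U \<and>
        (\<exists>V. openin (Euclidean_space n) V \<and>
             homeomorphic_map (top_of_set U) (subtopology (Euclidean_space n) V) \<phi>)) \<and>
     (\<forall>(U, \<phi>)\<in>\<A>. \<forall>(V, \<psi>)\<in>\<A>. smooth_map_on n (\<phi> ` (U \<inter> V)) (\<psi> \<circ> inv_into U \<phi>))"


section \<open>Singular cochains with complex coefficients\<close>

abbreviation simplex_in :: "nat \<Rightarrow> ((nat \<Rightarrow> real) \<Rightarrow> 'x::topological_space) \<Rightarrow> bool" where
  "simplex_in p \<equiv> singular_simplex p euclidean"

definition front_face :: "nat \<Rightarrow> ((nat \<Rightarrow> real) \<Rightarrow> 'x) \<Rightarrow> (nat \<Rightarrow> real) \<Rightarrow> 'x" where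
  "front_face p \<sigma> = restrict \<sigma> (standard_simplex p)"

text \<open>\<open>back_face p q \<sigma>\<close> is the face of the \<open>(p + q)\<close>-simplex \<open>\<sigma>\<close> spanned by the last
  \<open>q + 1\<close> vertices.\<close>

definition back_face :: "nat \<Rightarrow> nat \<Rightarrow> ((nat \<Rightarrow> real) \<Rightarrow> 'x) \<Rightarrow> (nat \<Rightarrow> real) \<Rightarrow> 'x" where
  "back_face p q \<sigma> = restrict (\<lambda>x. \<sigma> (\<lambda>i. if i < p then 0 else x (i - p))) (standard_simplex q)"

lemma front_vertices:
  "x \<in> standard_simplex p \<Longrightarrow> p \<le> n \<Longrightarrow> x \<in> standard_simplex n"
  using standard_simplex_mono by blast

lemma back_vertices:
  assumes "x \<in> standard_simplex q"
  shows "(\<lambda>i. if i < p then 0 else x (i - p)) \<in> standard_simplex (p + q)"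
proof -
  have "(\<Sum>i\<le>p + q. if i < p then 0 else x (i - p)) = (\<Sum>i\<in>{p..p + q}. x (i - p))"
    by (rule sum.mono_neutral_cong_right) auto
  also have "\<dots> = (\<Sum>i\<le>q. x i)"
    by (rule sum.reindex_bij_witness [of _ "\<lambda>i. i + p" "\<lambda>i. i - p"]) auto
  finally show ?thesis
    using assms by (auto simp: standard_simplex_def)
qed

lemma singular_simplex_front_face:
  assumes "singular_simplex n X \<sigma>" "p \<le> n"
  shows "singular_simplex p X (front_face p \<sigma>)"
  using assms standard_simplex_mono [of p n]
  unfolding singular_simplex_def front_face_def
  by (auto intro: continuous_map_from_subtopology_mono)

lemma singular_simplex_back_face:
  assumes "singular_simplex (p + q) X \<sigma>"
  shows "singular_simplex q X (back_face p q \<sigma>)"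
proof -
  let ?g = "\<lambda>(x::nat \<Rightarrow> real) i. if i < p then 0 else x (i - p)"
  have "continuous_map (powertop_real UNIV) (powertop_real UNIV) ?g"
    by (auto simp: continuous_map_componentwise_UNIV intro: continuous_map_product_projection)
  then have "continuous_map (subtopology (powertop_real UNIV) (standard_simplex q))
          (subtopology (powertop_real UNIV) (standard_simplex (p + q))) ?g"
    by (auto simp: continuous_map_in_subtopology continuous_map_from_subtopology back_vertices)
  then have "continuous_map (subtopology (powertop_real UNIV) (standard_simplex q)) X (\<sigma> \<circ> ?g)"
    by (rule continuous_map_compose) (use assms in \<open>simp add: singular_simplex_def\<close>)
  then show ?thesis
    by (simp add: singular_simplex_def back_face_def o_def)
qed

text \<open>Total cochains: \<open>\<phi> p\<close> is the component of degree \<open>p\<close>, a function on the singular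
  \<open>p\<close>-simplices (extended by \<open>0\<close>), and only finitely many components are nonzero.\<close>

typedef (overloaded) ('x::topological_space) cochain =
  "{\<phi> :: nat \<Rightarrow> ((nat \<Rightarrow> real) \<Rightarrow> 'x) \<Rightarrow> complex.
      (\<forall>p \<sigma>. \<not> simplex_in p \<sigma> \<longrightarrow> \<phi> p \<sigma> = 0) \<and> finite {p. \<phi> p \<noteq> (\<lambda>\<sigma>. 0)}}"
  morphisms on_simplex Abs_cochain
  by (rule exI [of _ "\<lambda>p \<sigma>. 0"]) auto

setup_lifting type_definition_cochain

lemma finite_support_sub:
  "finite B \<Longrightarrow> (\<And>p. p \<notin> B \<Longrightarrow> f p = (\<lambda>\<sigma>. 0)) \<Longrightarrow> finite {p. f p \<noteq> (\<lambda>\<sigma>. 0)}"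
  by (rule finite_subset [of _ B]) auto

lemma cochain_eqI:
  "(\<And>p \<sigma>. simplex_in p \<sigma> \<Longrightarrow> on_simplex a p \<sigma> = on_simplex b p \<sigma>) \<Longrightarrow> a = b"
  by transfer (metis ext)

lemma on_simplex_outside: "\<not> simplex_in p \<sigma> \<Longrightarrow> on_simplex a p \<sigma> = 0"
  by transfer auto

instantiation cochain :: (topological_space) ab_group_add
begin

lift_definition zero_cochain :: "'a cochain" is "\<lambda>p \<sigma>. 0"
  by simp

lift_definition plus_cochain :: "'a cochain \<Rightarrow> 'a cochain \<Rightarrow> 'a cochain"
  is "\<lambda>\<phi> \<psi> p \<sigma>. \<phi> p \<sigma> + \<psi> p \<sigma>"
  subgoal for \<phi> \<psi>
    by (auto intro: finite_support_sub [of "{p. \<phi> p \<noteq> (\<lambda>\<sigma>. 0)} \<union> {p. \<psi> p \<noteq> (\<lambda>\<sigma>. 0)}"])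
  done

lift_definition uminus_cochain :: "'a cochain \<Rightarrow> 'a cochain" is "\<lambda>\<phi> p \<sigma>. - \<phi> p \<sigma>"
  subgoal for \<phi>
    by (auto intro: finite_support_sub [of "{p. \<phi> p \<noteq> (\<lambda>\<sigma>. 0)}"])
  done

lift_definition minus_cochain :: "'a cochain \<Rightarrow> 'a cochain \<Rightarrow> 'a cochain"
  is "\<lambda>\<phi> \<psi> p \<sigma>. \<phi> p \<sigma> - \<psi> p \<sigma>"
  subgoal for \<phi> \<psi>
    by (auto intro: finite_support_sub [of "{p. \<phi> p \<noteq> (\<lambda>\<sigma>. 0)} \<union> {p. \<psi> p \<noteq> (\<lambda>\<sigma>. 0)}"])
  done

instance
  by standard (transfer; simp add: algebra_simps)+

end

lift_definition cochain_scale :: "complex \<Rightarrow> 'x::topological_space cochain \<Rightarrow> 'x cochain"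
  is "\<lambda>c \<phi> p \<sigma>. c * \<phi> p \<sigma>"
  subgoal for c \<phi>
    by (auto intro: finite_support_sub [of "{p. \<phi> p \<noteq> (\<lambda>\<sigma>. 0)}"])
  done

lift_definition cochain_comp :: "nat \<Rightarrow> 'x::topological_space cochain \<Rightarrow> 'x cochain"
  is "\<lambda>q \<phi> p \<sigma>. if p = q then \<phi> p \<sigma> else 0"
  subgoal for q \<phi>
    by (auto intro!: finite_support_sub [of "{q}"])
  done

definition raw_cup ::
    "(nat \<Rightarrow> ((nat \<Rightarrow> real) \<Rightarrow> 'x::topological_space) \<Rightarrow> complex) \<Rightarrow>
     (nat \<Rightarrow> ((nat \<Rightarrow> real) \<Rightarrow> 'x) \<Rightarrow> complex) \<Rightarrow> nat \<Rightarrow> ((nat \<Rightarrow> real) \<Rightarrow> 'x) \<Rightarrow> complex" where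
  "raw_cup \<phi> \<psi> n \<sigma> =
     (if simplex_in n \<sigma>
      then \<Sum>p\<le>n. \<phi> p (front_face p \<sigma>) * \<psi> (n - p) (back_face p (n - p) \<sigma>) else 0)"

lemma raw_cup_finite_support:
  assumes "finite {p. \<phi> p \<noteq> (\<lambda>\<sigma>. 0)}" "finite {p. \<psi> p \<noteq> (\<lambda>\<sigma>. 0)}"
  shows "finite {p. raw_cup \<phi> \<psi> p \<noteq> (\<lambda>\<sigma>. 0)}"
proof -
  let ?B = "(\<lambda>(p, q). p + q) ` ({p. \<phi> p \<noteq> (\<lambda>\<sigma>. 0)} \<times> {p. \<psi> p \<noteq> (\<lambda>\<sigma>. 0)})"
  show ?thesis
  proof (rule finite_support_sub [of ?B])
    show "finite ?B"
      using assms by blast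
  next
    fix n assume n: "n \<notin> ?B"
    have "\<phi> p = (\<lambda>\<sigma>. 0) \<or> \<psi> (n - p) = (\<lambda>\<sigma>. 0)" if "p \<le> n" for p
    proof (rule ccontr)
      assume "\<not> ?thesis"
      then have "(p, n - p) \<in> {p. \<phi> p \<noteq> (\<lambda>\<sigma>. 0)} \<times> {p. \<psi> p \<noteq> (\<lambda>\<sigma>. 0)}"
        by simp
      from imageI [OF this, of "\<lambda>(p, q). p + q"] that n show False
        by simp
    qed
    then have "\<phi> p s * \<psi> (n - p) t = 0" if "p \<le> n" for p s t
      using that by fastforce
    then show "raw_cup \<phi> \<psi> n = (\<lambda>\<sigma>. 0)"
      by (auto simp: raw_cup_def fun_eq_iff intro!: sum.neutral)
  qed
qed

lemma front_face_front_face: "p \<le> m \<Longrightarrow> front_face p (front_face m \<sigma>) = front_face p \<sigma>"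
  by (auto simp: front_face_def fun_eq_iff restrict_def dest: front_vertices)

lemma back_face_front_face:
  "back_face p q (front_face (p + q) \<sigma>) = front_face q (back_face p (q + k) \<sigma>)"
  by (auto simp: front_face_def back_face_def fun_eq_iff restrict_def back_vertices
           dest: front_vertices [where n = "q + k"])

lemma back_face_back_face: "back_face q k (back_face p (q + k) \<sigma>) = back_face (p + q) k \<sigma>"
proof -
  have "(\<lambda>i. if i < p then 0 else if i - p < q then 0 else x (i - p - q))
        = (\<lambda>i. if i < p + q then 0 else x (i - (p + q)))" for x :: "nat \<Rightarrow> real"
    by (auto simp: fun_eq_iff)
  then show ?thesis
    by (auto simp: back_face_def fun_eq_iff restrict_def back_vertices)
qed

lemma front_face_self: "simplex_in n \<sigma> \<Longrightarrow> front_face n \<sigma> = \<sigma>"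
  by (simp add: front_face_def singular_simplex_def extensional_restrict)

lemma back_face_self: "simplex_in n \<sigma> \<Longrightarrow> back_face 0 n \<sigma> = \<sigma>"
  by (simp add: back_face_def singular_simplex_def extensional_restrict)

lemma raw_cup_assoc: "raw_cup (raw_cup \<phi> \<psi>) \<eta> = raw_cup \<phi> (raw_cup \<psi> \<eta>)"
proof (intro ext)
  fix n \<sigma>
  show "raw_cup (raw_cup \<phi> \<psi>) \<eta> n \<sigma> = raw_cup \<phi> (raw_cup \<psi> \<eta>) n \<sigma>"
  proof (cases "simplex_in n \<sigma>")
    case True
    define F where "F p q k = \<phi> p (front_face p \<sigma>) *
        \<psi> q (front_face q (back_face p (q + k) \<sigma>)) * \<eta> k (back_face (p + q) k \<sigma>)" for p q k
    have 1: "raw_cup (raw_cup \<phi> \<psi>) \<eta> n \<sigma> = (\<Sum>m\<le>n. \<Sum>p\<le>m. F p (m - p) (n - m))"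
      unfolding raw_cup_def [of "raw_cup \<phi> \<psi>"] if_P [OF True]
    proof (rule sum.cong [OF refl])
      fix m assume "m \<in> {..n}"
      then have m: "m \<le> n" by simp
      have "simplex_in m (front_face m \<sigma>)"
        using True m by (rule singular_simplex_front_face)
      moreover have "back_face p (m - p) (front_face m \<sigma>)
          = front_face (m - p) (back_face p (m - p + (n - m)) \<sigma>)" if "p \<le> m" for p
        using back_face_front_face [of p "m - p" \<sigma> "n - m"] that by simp
      ultimately show "raw_cup \<phi> \<psi> m (front_face m \<sigma>) * \<eta> (n - m) (back_face m (n - m) \<sigma>)
                 = (\<Sum>p\<le>m. F p (m - p) (n - m))"
        unfolding raw_cup_def F_def
        by (simp add: sum_distrib_right) (intro sum.cong refl, simp add: front_face_front_face)
    qed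
    have 2: "raw_cup \<phi> (raw_cup \<psi> \<eta>) n \<sigma> = (\<Sum>p\<le>n. \<Sum>q\<le>n - p. F p q (n - p - q))"
      unfolding raw_cup_def [of \<phi>] if_P [OF True]
    proof (rule sum.cong [OF refl])
      fix p assume "p \<in> {..n}"
      then have p: "p \<le> n" by simp
      have "simplex_in (n - p) (back_face p (n - p) \<sigma>)"
        using True p by (intro singular_simplex_back_face) simp
      moreover have "F p q (n - p - q) = \<phi> p (front_face p \<sigma>) *
          (\<psi> q (front_face q (back_face p (n - p) \<sigma>)) *
           \<eta> (n - p - q) (back_face q (n - p - q) (back_face p (n - p) \<sigma>)))"
        if "q \<le> n - p" for q
        using back_face_back_face [of q "n - p - q" p \<sigma>]
        unfolding F_def le_add_diff_inverse [OF that] by (simp only: mult.assoc)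
      ultimately show "\<phi> p (front_face p \<sigma>) * raw_cup \<psi> \<eta> (n - p) (back_face p (n - p) \<sigma>)
                 = (\<Sum>q\<le>n - p. F p q (n - p - q))"
        by (simp add: raw_cup_def sum_distrib_left)
    qed
    have "(\<Sum>m\<le>n. \<Sum>p\<le>m. F p (m - p) (n - m)) = (\<Sum>p\<le>n. \<Sum>q\<le>n - p. F p q (n - p - q))"
      unfolding sum.Sigma [OF finite_atMost ballI [OF finite_atMost]]
      by (rule sum.reindex_bij_witness [of _ "\<lambda>(p, q). (p + q, p)" "\<lambda>(m, p). (p, m - p)"]) auto
    with 1 2 show ?thesis by simp
  qed (simp add: raw_cup_def)
qed

instantiation cochain :: (topological_space) ring_1
begin

lift_definition one_cochain :: "'a cochain" is "\<lambda>p \<sigma>. if p = 0 \<and> simplex_in p \<sigma> then 1 else 0"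
  by (auto intro!: finite_support_sub [of "{0}"])

lift_definition times_cochain :: "'a cochain \<Rightarrow> 'a cochain \<Rightarrow> 'a cochain" is raw_cup
  by (simp add: raw_cup_finite_support) (simp add: raw_cup_def)

instance
proof
  fix a b c :: "'a cochain"
  show "a * b * c = a * (b * c)"
    by transfer (rule raw_cup_assoc)
  show "(a + b) * c = a * c + b * c"
    by transfer (auto simp: raw_cup_def fun_eq_iff algebra_simps sum.distrib)
  show "a * (b + c) = a * b + a * c"
    by transfer (auto simp: raw_cup_def fun_eq_iff algebra_simps sum.distrib)
  show "1 * a = a"
  proof transfer
    fix \<phi> :: "nat \<Rightarrow> ((nat \<Rightarrow> real) \<Rightarrow> 'a) \<Rightarrow> complex"
    assume \<phi>: "(\<forall>p \<sigma>. \<not> simplex_in p \<sigma> \<longrightarrow> \<phi> p \<sigma> = 0) \<and> finite {p. \<phi> p \<noteq> (\<lambda>\<sigma>. 0)}"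
    let ?one = "\<lambda>p \<sigma>. if p = 0 \<and> simplex_in p \<sigma> then 1 else (0::complex)"
    have "raw_cup ?one \<phi> n \<sigma> = \<phi> n \<sigma>" if "simplex_in n \<sigma>" for n \<sigma>
    proof -
      have "raw_cup ?one \<phi> n \<sigma>
          = (\<Sum>p\<le>n. if p = 0 then \<phi> n \<sigma> else 0)"
        unfolding raw_cup_def if_P [OF that]
        using that by (intro sum.cong) (auto simp: back_face_self singular_simplex_front_face)
      then show ?thesis by simp
    qed
    then show "raw_cup ?one \<phi> = \<phi>"
      using \<phi> by (fastforce simp: raw_cup_def fun_eq_iff)
  qed
  show "a * 1 = a"
  proof transfer
    fix \<phi> :: "nat \<Rightarrow> ((nat \<Rightarrow> real) \<Rightarrow> 'a) \<Rightarrow> complex"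
    assume \<phi>: "(\<forall>p \<sigma>. \<not> simplex_in p \<sigma> \<longrightarrow> \<phi> p \<sigma> = 0) \<and> finite {p. \<phi> p \<noteq> (\<lambda>\<sigma>. 0)}"
    let ?one = "\<lambda>p \<sigma>. if p = 0 \<and> simplex_in p \<sigma> then 1 else (0::complex)"
    have "raw_cup \<phi> ?one n \<sigma> = \<phi> n \<sigma>" if "simplex_in n \<sigma>" for n \<sigma>
    proof -
      have "simplex_in 0 (back_face n 0 \<sigma>)"
        using that by (intro singular_simplex_back_face) simp
      then have "raw_cup \<phi> ?one n \<sigma>
          = (\<Sum>p\<le>n. if p = n then \<phi> n \<sigma> else 0)"
        unfolding raw_cup_def if_P [OF that]
        using that by (intro sum.cong) (auto simp: front_face_self)
      then show ?thesis by simp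
    qed
    then show "raw_cup \<phi> ?one = \<phi>"
      using \<phi> by (fastforce simp: raw_cup_def fun_eq_iff)
  qed
  have "on_simplex (1 :: 'a cochain) 0 (restrict (\<lambda>x. undefined) (standard_simplex 0)) = 1"
    by (simp add: one_cochain.rep_eq singular_simplex_def)
  then show "(0::'a cochain) \<noteq> 1"
    by (metis zero_cochain.rep_eq zero_neq_one)
qed

end


section \<open>The coboundary\<close>

definition raw_coboundary ::
    "(nat \<Rightarrow> ((nat \<Rightarrow> real) \<Rightarrow> 'x::topological_space) \<Rightarrow> complex) \<Rightarrow>
     nat \<Rightarrow> ((nat \<Rightarrow> real) \<Rightarrow> 'x) \<Rightarrow> complex" where
  "raw_coboundary \<phi> p \<sigma> =
     (if p > 0 \<and> simplex_in p \<sigma>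
      then \<Sum>k\<le>p. (- 1) ^ k * \<phi> (p - 1) (singular_face p k \<sigma>) else 0)"

lemma raw_coboundary_finite_support:
  assumes "finite {p. \<phi> p \<noteq> (\<lambda>\<sigma>. 0)}"
  shows "finite {p. raw_coboundary \<phi> p \<noteq> (\<lambda>\<sigma>. 0)}"
proof (rule finite_support_sub)
  show "finite (Suc ` {p. \<phi> p \<noteq> (\<lambda>\<sigma>. 0)})"
    using assms by blast
next
  fix p assume "p \<notin> Suc ` {p. \<phi> p \<noteq> (\<lambda>\<sigma>. 0)}"
  then have "p = 0 \<or> \<phi> (p - 1) = (\<lambda>\<sigma>. 0)"
    by (cases p) auto
  then show "raw_coboundary \<phi> p = (\<lambda>\<sigma>. 0)"
    by (auto simp: raw_coboundary_def fun_eq_iff)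
qed

lift_definition coboundary :: "'x::topological_space cochain \<Rightarrow> 'x cochain" is raw_coboundary
  by (simp add: raw_coboundary_finite_support) (simp add: raw_coboundary_def)

lemma coboundary_add: "coboundary (a + b) = coboundary a + coboundary b"
  by transfer (simp add: raw_coboundary_def fun_eq_iff algebra_simps sum.distrib)

lemma coboundary_minus: "coboundary (- a) = - coboundary a"
  by transfer (simp add: raw_coboundary_def fun_eq_iff sum_negf)

lemma coboundary_diff: "coboundary (a - b) = coboundary a - coboundary b"
  using coboundary_add [of a "- b"] by (simp add: coboundary_minus)

lemma coboundary_0 [simp]: "coboundary 0 = 0"
  using coboundary_diff [of 0 0] by simp

lemma coboundary_scale: "coboundary (cochain_scale c a) = cochain_scale c (coboundary a)"
  by transfer (simp add: raw_coboundary_def fun_eq_iff sum_distrib_left mult_ac)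

lemma coboundary_comp: "coboundary (cochain_comp p a) = cochain_comp (Suc p) (coboundary a)"
  by transfer (auto simp: raw_coboundary_def fun_eq_iff intro!: sum.neutral)

lemma cochain_comp_0_coboundary: "cochain_comp 0 (coboundary a) = 0"
  by transfer (auto simp: raw_coboundary_def fun_eq_iff)

lemma coboundary_one: "coboundary 1 = 0"
proof (rule cochain_eqI)
  fix p and \<sigma> :: "(nat \<Rightarrow> real) \<Rightarrow> 'a"
  assume \<sigma>: "simplex_in p \<sigma>"
  show "on_simplex (coboundary 1) p \<sigma> = on_simplex 0 p \<sigma>"
  proof (cases "p = 1")
    case True
    then have "simplex_in 0 (singular_face (Suc 0) k \<sigma>)" if "k \<le> 1" for k
      using singular_simplex_singular_face [of p euclidean \<sigma> k] \<sigma> that by simp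
    with True show ?thesis
      by (simp add: coboundary.rep_eq raw_coboundary_def one_cochain.rep_eq zero_cochain.rep_eq)
  next
    case False
    then show ?thesis
      by (auto simp: coboundary.rep_eq raw_coboundary_def one_cochain.rep_eq zero_cochain.rep_eq)
  qed
qed

definition chain_pairing :: "(((nat \<Rightarrow> real) \<Rightarrow> 'x) \<Rightarrow> complex) \<Rightarrow> 'x chain \<Rightarrow> complex" where
  "chain_pairing f c = (\<Sum>\<sigma>\<in>Poly_Mapping.keys c. of_int (Poly_Mapping.lookup c \<sigma>) * f \<sigma>)"

lemma chain_pairing_superset:
  "finite S \<Longrightarrow> Poly_Mapping.keys c \<subseteq> S \<Longrightarrow>
   chain_pairing f c = (\<Sum>\<sigma>\<in>S. of_int (Poly_Mapping.lookup c \<sigma>) * f \<sigma>)"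
  unfolding chain_pairing_def
  by (rule sum.mono_neutral_left) (auto simp: in_keys_iff)

lemma chain_pairing_diff: "chain_pairing f (a - b) = chain_pairing f a - chain_pairing f b"
  using chain_pairing_superset [of "Poly_Mapping.keys a \<union> Poly_Mapping.keys b" a f]
    chain_pairing_superset [of "Poly_Mapping.keys a \<union> Poly_Mapping.keys b" b f]
    chain_pairing_superset [of "Poly_Mapping.keys a \<union> Poly_Mapping.keys b" "a - b" f]
  by (simp add: keys_diff lookup_minus algebra_simps sum_subtractf)

lemma chain_pairing_0 [simp]: "chain_pairing f 0 = 0"
  by (simp add: chain_pairing_def)

lemma chain_pairing_add: "chain_pairing f (a + b) = chain_pairing f a + chain_pairing f b"
  using chain_pairing_diff [of f "a + b" b] by simp

lemma chain_pairing_sum: "chain_pairing f (\<Sum>i\<in>I. g i) = (\<Sum>i\<in>I. chain_pairing f (g i))"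
  by (induction I rule: infinite_finite_induct) (simp_all add: chain_pairing_add)

lemma chain_pairing_cmul: "chain_pairing f (frag_cmul k c) = of_int k * chain_pairing f c"
  using chain_pairing_superset [of "Poly_Mapping.keys c" "frag_cmul k c" f]
  by (simp add: chain_pairing_def keys_cmul sum_distrib_left mult.assoc)

lemma chain_pairing_of [simp]: "chain_pairing f (frag_of \<sigma>) = f \<sigma>"
  by (simp add: chain_pairing_def)

lemma raw_coboundary_pairing:
  assumes "simplex_in (Suc p) \<sigma>"
  shows "raw_coboundary \<phi> (Suc p) \<sigma> = chain_pairing (\<phi> p) (chain_boundary (Suc p) (frag_of \<sigma>))"
  using assms
  by (simp add: raw_coboundary_def chain_boundary_of chain_pairing_sum chain_pairing_cmul
      del: sum.atMost_Suc)

lemma chain_pairing_coboundary: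
  assumes "singular_chain (Suc p) euclidean c"
  shows "chain_pairing (raw_coboundary \<phi> (Suc p)) c = chain_pairing (\<phi> p) (chain_boundary (Suc p) c)"
  using assms unfolding singular_chain_def
  by (induction rule: frag_induction)
     (simp_all add: raw_coboundary_pairing chain_pairing_diff chain_boundary_diff)

lemma coboundary_coboundary [simp]: "coboundary (coboundary a) = 0"
proof (rule cochain_eqI)
  fix p and \<sigma> :: "(nat \<Rightarrow> real) \<Rightarrow> 'a"
  assume \<sigma>: "simplex_in p \<sigma>"
  let ?\<phi> = "on_simplex a"
  have "raw_coboundary (raw_coboundary ?\<phi>) p \<sigma> = 0"
  proof (cases "p \<ge> 2")
    case True
    then obtain q where p: "p = Suc (Suc q)"
      by (metis add_2_eq_Suc le_Suc_ex)
    have c: "singular_chain p euclidean (frag_of \<sigma>)"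
      using \<sigma> by (simp add: singular_chain_of)
    have "raw_coboundary (raw_coboundary ?\<phi>) p \<sigma>
        = chain_pairing (raw_coboundary ?\<phi> (Suc q)) (chain_boundary p (frag_of \<sigma>))"
      using \<sigma> by (simp add: p raw_coboundary_pairing)
    also have "\<dots> = chain_pairing (?\<phi> q) (chain_boundary (Suc q) (chain_boundary p (frag_of \<sigma>)))"
      using singular_chain_boundary [OF c] by (intro chain_pairing_coboundary) (simp add: p)
    also have "\<dots> = 0"
      using chain_boundary_boundary [OF c] by (simp add: p)
    finally show ?thesis .
  next
    case False
    then have "p = 0 \<or> p = 1" by auto
    then show ?thesis
      by (auto simp: raw_coboundary_def)
  qed
  then show "on_simplex (coboundary (coboundary a)) p \<sigma> = on_simplex 0 p \<sigma>"
    by (simp add: coboundary.rep_eq zero_cochain.rep_eq)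
qed

text \<open>The Leibniz rule \<open>\<delta>(a \<smile> b) = \<delta>a \<smile> b + (-1)\<^sup>p a \<smile> \<delta>b\<close> for \<open>a\<close> of degree \<open>p\<close>, with the
  sign packaged as an involution of the total complex.\<close>

lift_definition cochain_sign :: "'x::topological_space cochain \<Rightarrow> 'x cochain"
  is "\<lambda>\<phi> p \<sigma>. (- 1) ^ p * \<phi> p \<sigma>"
  subgoal for \<phi>
    by (auto intro: finite_support_sub [of "{p. \<phi> p \<noteq> (\<lambda>\<sigma>. 0)}"])
  done

lemma cochain_sign_sign [simp]: "cochain_sign (cochain_sign a) = a"
  by transfer (simp add: fun_eq_iff flip: mult.assoc power_add mult_2)

lemma cochain_sign_0: "cochain_sign 0 = 0"
  by transfer simp

lemma coboundary_sign: "coboundary (cochain_sign a) = - cochain_sign (coboundary a)"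
proof (rule cochain_eqI)
  fix p and \<sigma> :: "(nat \<Rightarrow> real) \<Rightarrow> 'a"
  show "on_simplex (coboundary (cochain_sign a)) p \<sigma> = on_simplex (- cochain_sign (coboundary a)) p \<sigma>"
    by (cases p)
       (simp_all add: coboundary.rep_eq raw_coboundary_def uminus_cochain.rep_eq
          cochain_sign.rep_eq sum_distrib_left sum_negf mult_ac del: sum.atMost_Suc)
qed

lemma simplical_face_vertices:
  assumes "x \<in> standard_simplex p" "k \<le> Suc p"
  shows "simplical_face k x \<in> standard_simplex (Suc p)"
  using simplical_face_in_standard_simplex [of "Suc p" k x] assms by simp

lemma front_face_singular_face_low:
  assumes "k \<le> Suc p"
  shows "front_face p (singular_face (Suc (p + q)) k \<sigma>)
       = singular_face (Suc p) k (front_face (Suc p) \<sigma>)"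
  using assms
  by (auto simp: front_face_def singular_face_def fun_eq_iff restrict_def
           simplical_face_vertices dest: front_vertices [where n = "p + q"])

lemma singular_face_front_face_last:
  "singular_face (Suc p) (Suc p) (front_face (Suc p) \<sigma>) = front_face p \<sigma>"
proof -
  have "simplical_face (Suc p) x = x" if "x \<in> standard_simplex p" for x :: "nat \<Rightarrow> real"
    using that by (auto simp: simplical_face_def standard_simplex_def fun_eq_iff)
  note eq = this
  show ?thesis
    by (auto simp: eq front_face_def singular_face_def restrict_def simplical_face_vertices
             front_vertices [of _ p "Suc p"] intro!: ext)
qed

lemma front_face_singular_face_high:
  assumes "0 < j"
  shows "front_face p (singular_face (Suc (p + q)) (p + j) \<sigma>) = front_face p \<sigma>"
proof -
  have "simplical_face (p + j) x = x" if "x \<in> standard_simplex p" for x :: "nat \<Rightarrow> real"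
    using that assms by (auto simp: simplical_face_def standard_simplex_def fun_eq_iff)
  note eq = this
  show ?thesis
    by (auto simp: eq front_face_def singular_face_def restrict_def
             front_vertices [of _ p "p + q"] intro!: ext)
qed

lemma back_face_singular_face_low:
  assumes "k \<le> p"
  shows "back_face p q (singular_face (Suc (p + q)) k \<sigma>) = back_face (Suc p) q \<sigma>"
proof -
  have "simplical_face k (\<lambda>i. if i < p then 0 else x (i - p))
      = (\<lambda>i. if i < Suc p then 0 else x (i - Suc p))" for x :: "nat \<Rightarrow> real"
    using assms by (auto simp: simplical_face_def fun_eq_iff)
  note eq = this
  show ?thesis
    by (auto simp: eq back_face_def singular_face_def restrict_def back_vertices intro!: ext)
qed

lemma back_face_singular_face_high:
  assumes "j \<le> Suc q"
  shows "back_face p q (singular_face (Suc (p + q)) (p + j) \<sigma>)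
       = singular_face (Suc q) j (back_face p (Suc q) \<sigma>)"
proof -
  have "simplical_face (p + j) (\<lambda>i. if i < p then 0 else x (i - p))
      = (\<lambda>i. if i < p then 0 else simplical_face j x (i - p))" for x :: "nat \<Rightarrow> real"
    by (auto simp: simplical_face_def fun_eq_iff)
  note eq = this
  show ?thesis
    using assms
    by (auto simp: eq back_face_def singular_face_def restrict_def back_vertices
             simplical_face_vertices intro!: ext)
qed

lemma singular_face_back_face_first:
  "singular_face (Suc q) 0 (back_face p (Suc q) \<sigma>) = back_face (Suc p) q \<sigma>"
  using back_face_singular_face_high [of 0 q p \<sigma>] back_face_singular_face_low [of p p q \<sigma>]
  by simp

lemma coboundary_mult:
  "coboundary (a * b) = coboundary a * b + cochain_sign a * coboundary b"
proof (rule cochain_eqI)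
  fix n' and \<sigma> :: "(nat \<Rightarrow> real) \<Rightarrow> 'a"
  assume \<sigma>: "simplex_in n' \<sigma>"
  let ?\<phi> = "on_simplex a" and ?\<psi> = "on_simplex b"
  define s where "s p \<tau> = (- 1) ^ p * ?\<phi> p \<tau>" for p \<tau>
  have "raw_coboundary (raw_cup ?\<phi> ?\<psi>) n' \<sigma>
      = raw_cup (raw_coboundary ?\<phi>) ?\<psi> n' \<sigma> + raw_cup s (raw_coboundary ?\<psi>) n' \<sigma>"
  proof (cases n')
    case 0
    then show ?thesis
      by (simp add: raw_coboundary_def raw_cup_def)
  next
    case (Suc n)
    have S: "simplex_in (Suc n) \<sigma>"
      using \<sigma> Suc by simp
    define P where "P p k = (- 1) ^ k * ?\<phi> p (singular_face (Suc p) k (front_face (Suc p) \<sigma>)) *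
        ?\<psi> (n - p) (back_face (Suc p) (n - p) \<sigma>)" for p k
    define Q where "Q p j = (- 1) ^ (p + j) * ?\<phi> p (front_face p \<sigma>) *
        ?\<psi> (n - p) (singular_face (Suc (n - p)) j (back_face p (Suc (n - p)) \<sigma>))" for p j
    have face: "simplex_in n (singular_face (Suc n) k \<sigma>)" if "k \<le> Suc n" for k
      using singular_simplex_singular_face [OF S _ that] by simp
    have "raw_coboundary (raw_cup ?\<phi> ?\<psi>) (Suc n) \<sigma>
        = (\<Sum>k\<le>Suc n. \<Sum>p\<le>n. (- 1) ^ k *
             (?\<phi> p (front_face p (singular_face (Suc n) k \<sigma>)) *
              ?\<psi> (n - p) (back_face p (n - p) (singular_face (Suc n) k \<sigma>))))"
      using S by (simp add: raw_coboundary_def raw_cup_def face sum_distrib_left del: sum.atMost_Suc)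
    also have "\<dots> = (\<Sum>p\<le>n. \<Sum>k\<le>Suc n. (- 1) ^ k *
             (?\<phi> p (front_face p (singular_face (Suc n) k \<sigma>)) *
              ?\<psi> (n - p) (back_face p (n - p) (singular_face (Suc n) k \<sigma>))))"
      by (rule sum.swap)
    also have "\<dots> = (\<Sum>p\<le>n. (\<Sum>k\<le>p. P p k) + (\<Sum>j\<in>{1..Suc (n - p)}. Q p j))"
    proof (rule sum.cong [OF refl])
      fix p assume "p \<in> {..n}"
      then obtain q where n: "n = p + q"
        using le_Suc_ex by auto
      define G where "G k = (- 1) ^ k *
             (?\<phi> p (front_face p (singular_face (Suc n) k \<sigma>)) *
              ?\<psi> (n - p) (back_face p (n - p) (singular_face (Suc n) k \<sigma>)))" for k
      have "{..Suc n} = {..p} \<union> {p + 1..p + Suc q}"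
        by (auto simp: n)
      then have "(\<Sum>k\<le>Suc n. G k) = (\<Sum>k\<le>p. G k) + (\<Sum>k\<in>{p + 1..p + Suc q}. G k)"
        by (simp add: sum.union_disjoint del: sum.atMost_Suc)
      moreover have "(\<Sum>k\<le>p. G k) = (\<Sum>k\<le>p. P p k)"
      proof (rule sum.cong [OF refl])
        fix k assume "k \<in> {..p}"
        then have k: "k \<le> p" "k \<le> Suc p" by auto
        show "G k = P p k"
          unfolding G_def P_def n front_face_singular_face_low [OF k(2)] diff_add_inverse
            back_face_singular_face_low [OF k(1)] mult.assoc ..
      qed
      moreover have "(\<Sum>k\<in>{p + 1..p + Suc q}. G k) = (\<Sum>j\<in>{1..Suc q}. Q p j)"
      proof (rule sum.reindex_bij_witness [of _ "\<lambda>j. p + j" "\<lambda>k. k - p"])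
        fix k assume "k \<in> {p + 1..p + Suc q}"
        then have k: "0 < k - p" "k - p \<le> Suc q" "k = p + (k - p)" by auto
        have "G (p + (k - p)) = Q p (k - p)"
          unfolding G_def Q_def n front_face_singular_face_high [OF k(1)] diff_add_inverse
            back_face_singular_face_high [OF k(2)] mult.assoc ..
        with k(3) show "Q p (k - p) = G k"
          by simp
      qed auto
      ultimately show "(\<Sum>k\<le>Suc n. (- 1) ^ k *
             (?\<phi> p (front_face p (singular_face (Suc n) k \<sigma>)) *
              ?\<psi> (n - p) (back_face p (n - p) (singular_face (Suc n) k \<sigma>))))
           = (\<Sum>k\<le>p. P p k) + (\<Sum>j\<in>{1..Suc (n - p)}. Q p j)"
        by (simp add: G_def n del: sum.atMost_Suc)
    qed
    also have "\<dots> = (\<Sum>p\<le>n. (\<Sum>k\<le>Suc p. P p k) + (\<Sum>j\<le>Suc (n - p). Q p j))"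
    proof (rule sum.cong [OF refl])
      fix p
      have "{..Suc (n - p)} = insert 0 {1..Suc (n - p)}"
        by auto
      then have "(\<Sum>j\<le>Suc (n - p). Q p j) = Q p 0 + (\<Sum>j\<in>{1..Suc (n - p)}. Q p j)"
        by simp
      moreover have "P p (Suc p) + Q p 0 = 0"
        by (simp add: P_def Q_def singular_face_front_face_last singular_face_back_face_first)
      ultimately show "(\<Sum>k\<le>p. P p k) + (\<Sum>j\<in>{1..Suc (n - p)}. Q p j)
          = (\<Sum>k\<le>Suc p. P p k) + (\<Sum>j\<le>Suc (n - p). Q p j)"
        by (simp add: algebra_simps del: sum.cl_ivl_Suc)
    qed
    also have "\<dots> = (\<Sum>p\<le>n. \<Sum>k\<le>Suc p. P p k) + (\<Sum>p\<le>n. \<Sum>j\<le>Suc (n - p). Q p j)"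
      by (rule sum.distrib)
    also have "(\<Sum>p\<le>n. \<Sum>k\<le>Suc p. P p k) = raw_cup (raw_coboundary ?\<phi>) ?\<psi> (Suc n) \<sigma>"
    proof -
      have "raw_cup (raw_coboundary ?\<phi>) ?\<psi> (Suc n) \<sigma>
          = (\<Sum>p\<le>n. raw_coboundary ?\<phi> (Suc p) (front_face (Suc p) \<sigma>) *
               ?\<psi> (n - p) (back_face (Suc p) (n - p) \<sigma>))"
        unfolding raw_cup_def if_P [OF S] sum.atMost_Suc_shift
        by (simp add: raw_coboundary_def)
      also have "\<dots> = (\<Sum>p\<le>n. \<Sum>k\<le>Suc p. P p k)"
        using singular_simplex_front_face [OF S]
        by (intro sum.cong refl)
           (simp add: raw_coboundary_def P_def sum_distrib_right del: sum.atMost_Suc)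
      finally show ?thesis by simp
    qed
    also have "(\<Sum>p\<le>n. \<Sum>j\<le>Suc (n - p). Q p j) = raw_cup s (raw_coboundary ?\<psi>) (Suc n) \<sigma>"
    proof -
      have "raw_cup s (raw_coboundary ?\<psi>) (Suc n) \<sigma>
          = (\<Sum>p\<le>n. s p (front_face p \<sigma>) *
               raw_coboundary ?\<psi> (Suc n - p) (back_face p (Suc n - p) \<sigma>))"
        unfolding raw_cup_def if_P [OF S]
        by (simp add: raw_coboundary_def)
      also have "\<dots> = (\<Sum>p\<le>n. \<Sum>j\<le>Suc (n - p). Q p j)"
      proof (rule sum.cong [OF refl])
        fix p assume "p \<in> {..n}"
        then have p: "Suc n - p = Suc (n - p)" "p + Suc (n - p) = Suc n" by auto
        have "simplex_in (Suc (n - p)) (back_face p (Suc (n - p)) \<sigma>)"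
          using S p by (intro singular_simplex_back_face) simp
        then show "s p (front_face p \<sigma>) *
               raw_coboundary ?\<psi> (Suc n - p) (back_face p (Suc n - p) \<sigma>) = (\<Sum>j\<le>Suc (n - p). Q p j)"
          unfolding p
          by (simp add: raw_coboundary_def Q_def s_def sum_distrib_left power_add mult_ac
                del: sum.atMost_Suc)
      qed
      finally show ?thesis by simp
    qed
    finally show ?thesis
      by (simp add: Suc)
  qed
  moreover have "on_simplex (cochain_sign a) = s"
    by (simp add: cochain_sign.rep_eq s_def fun_eq_iff)
  ultimately show "on_simplex (coboundary (a * b)) n' \<sigma>
      = on_simplex (coboundary a * b + cochain_sign a * coboundary b) n' \<sigma>"
    by (simp add: coboundary.rep_eq times_cochain.rep_eq plus_cochain.rep_eq)
qed


section \<open>The cohomology ring\<close>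

definition cohomologous :: "'x::topological_space cochain \<Rightarrow> 'x cochain \<Rightarrow> bool" where
  "cohomologous a b \<longleftrightarrow> coboundary a = 0 \<and> coboundary b = 0 \<and> (\<exists>c. a - b = coboundary c)"

lemma cohomologousI:
  "coboundary a = 0 \<Longrightarrow> coboundary b = 0 \<Longrightarrow> a - b = coboundary c \<Longrightarrow> cohomologous a b"
  unfolding cohomologous_def by blast

lemma cohomologous_refl: "coboundary a = 0 \<Longrightarrow> cohomologous a a"
  by (rule cohomologousI [where c = 0]) simp_all

lemma cohomologous_mult:
  assumes "cohomologous a a'" "cohomologous b b'"
  shows "cohomologous (a * b) (a' * b')"
proof -
  obtain c e where z: "coboundary a = 0" "coboundary b = 0" "coboundary a' = 0" "coboundary b' = 0"
    and c: "a - a' = coboundary c" and e: "b - b' = coboundary e"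
    using assms unfolding cohomologous_def by blast
  have "a * b - a' * b' = (a - a') * b + a' * (b - b')"
    by (simp add: algebra_simps)
  also have "\<dots> = coboundary (c * b + cochain_sign a' * e)"
    by (simp add: c e coboundary_add coboundary_mult coboundary_sign z cochain_sign_0)
  finally show ?thesis
    by (rule cohomologousI [rotated 2]) (simp_all add: z coboundary_mult)
qed

lemma cohomologous_add:
  assumes "cohomologous a a'" "cohomologous b b'"
  shows "cohomologous (a + b) (a' + b')"
proof -
  obtain c e where z: "coboundary a = 0" "coboundary b = 0" "coboundary a' = 0" "coboundary b' = 0"
    and c: "a - a' = coboundary c" and e: "b - b' = coboundary e"
    using assms unfolding cohomologous_def by blast
  have "a + b - (a' + b') = (a - a') + (b - b')"
    by simp
  also have "\<dots> = coboundary (c + e)"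
    by (simp only: c e coboundary_add)
  finally show ?thesis
    by (rule cohomologousI [rotated 2]) (simp_all add: z coboundary_add)
qed

lemma cohomologous_minus:
  assumes "cohomologous a a'"
  shows "cohomologous (- a) (- a')"
proof -
  obtain c where z: "coboundary a = 0" "coboundary a' = 0" and c: "a - a' = coboundary c"
    using assms unfolding cohomologous_def by blast
  have "- a - - a' = - (a - a')"
    by simp
  also have "\<dots> = coboundary (- c)"
    by (simp only: c coboundary_minus)
  finally show ?thesis
    by (rule cohomologousI [rotated 2]) (simp_all add: z coboundary_minus)
qed

lemma cohomologous_cocycle: "cohomologous a b \<Longrightarrow> coboundary a = 0"
  by (simp add: cohomologous_def)

lemma cohomologous_eqI: "a = b \<Longrightarrow> coboundary a = 0 \<Longrightarrow> cohomologous a b"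
  by (simp add: cohomologous_refl)

lemmas coboundary_ring =
  coboundary_add coboundary_minus coboundary_diff coboundary_mult coboundary_one

text \<open>\<open>'x cohomology\<close> is the total singular cohomology \<open>H\<^sup>*(X, \<complex>)\<close>, the direct sum of all
  \<open>H\<^sup>p(X, \<complex>)\<close>, of the topological space \<open>X\<close> given by the type \<open>'x\<close>.\<close>

quotient_type (overloaded) 'x cohomology =
  "('x::topological_space) cochain" / partial: cohomologous
proof (rule part_equivpI)
  show "\<exists>a::'x cochain. cohomologous a a"
    using cohomologous_refl [of 0] by auto
  show "symp (cohomologous :: 'x cochain \<Rightarrow> _)"
  proof (rule sympI)
    fix a b :: "'x cochain"
    assume "cohomologous a b"
    then obtain c where "coboundary a = 0" "coboundary b = 0" "a - b = coboundary c"
      unfolding cohomologous_def by blast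
    then show "cohomologous b a"
      by (intro cohomologousI [where c = "- c"]) (auto simp: coboundary_minus algebra_simps)
  qed
  show "transp (cohomologous :: 'x cochain \<Rightarrow> _)"
  proof (rule transpI)
    fix a b e :: "'x cochain"
    assume "cohomologous a b" "cohomologous b e"
    then have z: "coboundary a = 0" "coboundary e = 0"
      and "\<exists>c. a - b = coboundary c" "\<exists>c. b - e = coboundary c"
      unfolding cohomologous_def by simp_all
    then obtain c c' where c: "a - b = coboundary c" and c': "b - e = coboundary c'"
      by blast
    have "a - e = (a - b) + (b - e)"
      by simp
    also have "\<dots> = coboundary (c + c')"
      by (simp only: c c' coboundary_add)
    finally show "cohomologous a e"
      by (rule cohomologousI [OF z])
  qed
qed

instantiation cohomology :: (topological_space) ring_1
begin

lift_definition zero_cohomology :: "'a cohomology" is 0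
  by (simp add: cohomologous_refl)

lift_definition one_cohomology :: "'a cohomology" is 1
  by (simp add: cohomologous_refl coboundary_one)

lift_definition plus_cohomology :: "'a cohomology \<Rightarrow> 'a cohomology \<Rightarrow> 'a cohomology" is "(+)"
  by (rule cohomologous_add)

lift_definition uminus_cohomology :: "'a cohomology \<Rightarrow> 'a cohomology" is uminus
  by (rule cohomologous_minus)

lift_definition minus_cohomology :: "'a cohomology \<Rightarrow> 'a cohomology \<Rightarrow> 'a cohomology" is "(-)"
  using cohomologous_add [OF _ cohomologous_minus] by simp

lift_definition times_cohomology :: "'a cohomology \<Rightarrow> 'a cohomology \<Rightarrow> 'a cohomology" is "(*)"
  by (rule cohomologous_mult)

instance
proof
  fix a b c :: "'a cohomology"
  show "a + b + c = a + (b + c)"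
    by transfer
       (rule cohomologous_eqI, simp_all add: algebra_simps coboundary_ring cohomologous_cocycle)
  show "a + b = b + a"
    by transfer
       (rule cohomologous_eqI, simp_all add: algebra_simps coboundary_ring cohomologous_cocycle)
  show "0 + a = a"
    by transfer
       (rule cohomologous_eqI, simp_all add: algebra_simps coboundary_ring cohomologous_cocycle)
  show "- a + a = 0"
    by transfer
       (rule cohomologous_eqI, simp_all add: algebra_simps coboundary_ring cohomologous_cocycle)
  show "a - b = a + - b"
    by transfer
       (rule cohomologous_eqI, simp_all add: algebra_simps coboundary_ring cohomologous_cocycle)
  show "a * b * c = a * (b * c)"
    by transfer
       (rule cohomologous_eqI, simp_all add: algebra_simps coboundary_ring cohomologous_cocycle)
  show "1 * a = a"
    by transfer
       (rule cohomologous_eqI, simp_all add: algebra_simps coboundary_ring cohomologous_cocycle)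
  show "a * 1 = a"
    by transfer
       (rule cohomologous_eqI, simp_all add: algebra_simps coboundary_ring cohomologous_cocycle)
  show "(a + b) * c = a * c + b * c"
    by transfer
       (rule cohomologous_eqI, simp_all add: algebra_simps coboundary_ring cohomologous_cocycle)
  show "a * (b + c) = a * b + a * c"
    by transfer
       (rule cohomologous_eqI, simp_all add: algebra_simps coboundary_ring cohomologous_cocycle)
  show "(0::'a cohomology) \<noteq> 1"
  proof transfer
    show "\<not> cohomologous (0::'a cochain) 1"
    proof
      assume "cohomologous (0::'a cochain) 1"
      then obtain c :: "'a cochain" where "0 - 1 = coboundary c"
        unfolding cohomologous_def by blast
      then have "cochain_comp 0 (- 1 :: 'a cochain) = 0"
        by (simp add: cochain_comp_0_coboundary)
      moreover have "cochain_comp 0 (- 1 :: 'a cochain) = - 1"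
        by transfer (auto simp: fun_eq_iff)
      ultimately show False
        by simp
    qed
  qed
qed

end

lift_definition coh_scale ::
    "complex \<Rightarrow> 'x::topological_space cohomology \<Rightarrow> 'x cohomology"  (infixr "*\<^sub>C" 75)
  is cochain_scale
proof -
  fix k :: complex and a b :: "'x cochain"
  assume "cohomologous a b"
  then obtain c where c: "coboundary a = 0" "coboundary b = 0" "a - b = coboundary c"
    unfolding cohomologous_def by blast
  have "cochain_scale k a - cochain_scale k b = cochain_scale k (a - b)"
    by transfer (simp add: fun_eq_iff algebra_simps)
  moreover have "cochain_scale k (0 :: 'x cochain) = 0"
    by transfer simp
  ultimately show "cohomologous (cochain_scale k a) (cochain_scale k b)"
    using c by (intro cohomologousI [where c = "cochain_scale k c"]) (auto simp: coboundary_scale)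
qed

text \<open>\<open>coh_comp p\<close> is the projection of \<open>H\<^sup>*(X)\<close> onto its summand \<open>H\<^sup>p(X)\<close>.\<close>

lift_definition coh_comp :: "nat \<Rightarrow> 'x::topological_space cohomology \<Rightarrow> 'x cohomology"
  is cochain_comp
proof -
  fix p and a b :: "'x cochain"
  assume "cohomologous a b"
  then obtain c where c: "coboundary a = 0" "coboundary b = 0" "a - b = coboundary c"
    unfolding cohomologous_def by blast
  have diff: "cochain_comp p a - cochain_comp p b = cochain_comp p (a - b)"
    by transfer (simp add: fun_eq_iff)
  have zero: "cochain_comp q (0 :: 'x cochain) = 0" for q
    by transfer (simp add: fun_eq_iff)
  have "\<exists>e. cochain_comp p (coboundary c) = coboundary e"
  proof (cases p)
    case 0
    then show ?thesis
      by (metis coboundary_0 cochain_comp_0_coboundary)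
  next
    case (Suc q)
    then show ?thesis
      by (metis coboundary_comp)
  qed
  then show "cohomologous (cochain_comp p a) (cochain_comp p b)"
    using c by (auto simp: cohomologous_def coboundary_comp zero diff)
qed

interpretation coh: vector_space "coh_scale :: complex \<Rightarrow> 'x::topological_space cohomology \<Rightarrow> _"
proof
  fix k l :: complex and a b :: "'x cohomology"
  have [simp]: "cochain_scale k (u + v) = cochain_scale k u + cochain_scale k v"
    "cochain_scale (k + l) u = cochain_scale k u + cochain_scale l u"
    "cochain_scale k (cochain_scale l u) = cochain_scale (k * l) u"
    "cochain_scale 1 u = u"
    "cochain_scale k (0 :: 'x cochain) = 0"
    "cochain_scale l (0 :: 'x cochain) = 0" for k l and u v :: "'x cochain"
    by (transfer, simp add: algebra_simps)+
  show "k *\<^sub>C (a + b) = k *\<^sub>C a + k *\<^sub>C b"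
    by transfer
       (rule cohomologous_eqI,
        simp_all add: coboundary_add coboundary_scale cohomologous_cocycle)
  show "(k + l) *\<^sub>C a = k *\<^sub>C a + l *\<^sub>C a"
    by transfer
       (rule cohomologous_eqI,
        simp_all add: coboundary_add coboundary_scale cohomologous_cocycle)
  show "k *\<^sub>C l *\<^sub>C a = (k * l) *\<^sub>C a"
    by transfer
       (rule cohomologous_eqI,
        simp_all add: coboundary_add coboundary_scale cohomologous_cocycle)
  show "1 *\<^sub>C a = a"
    by transfer simp
qed


section \<open>Functions of even classes\<close>

definition even_class :: "'x::topological_space cohomology \<Rightarrow> bool" where
  "even_class b \<longleftrightarrow> (\<forall>p. odd p \<longrightarrow> coh_comp p b = 0)"

text \<open>The decomposition \<open>b = b\<^sub>0 + b\<^bsub>\<ge>2\<^esub>\<close> of an even class.  The scalar part is meaningful when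
  \<open>H\<^sup>0(X) = \<complex> \<cdot> 1\<close>, that is, for (path) connected \<open>X\<close>.\<close>

definition scalar_part :: "'x::topological_space cohomology \<Rightarrow> complex" where
  "scalar_part b = (THE c. coh_comp 0 b = c *\<^sub>C 1)"

definition nilpotent_part :: "'x::topological_space cohomology \<Rightarrow> 'x cohomology" where
  "nilpotent_part b = b - coh_comp 0 b"

text \<open>The Taylor series is summed over the powers of the nilpotent part that do not vanish.\<close>

definition coh_fun ::
    "(complex \<Rightarrow> complex) \<Rightarrow> 'x::topological_space cohomology \<Rightarrow> 'x cohomology" where
  "coh_fun f b =
     (\<Sum>k | nilpotent_part b ^ k \<noteq> 0.
        ((deriv ^^ k) f (scalar_part b) / fact k) *\<^sub>C nilpotent_part b ^ k)"

abbreviation coh_exp :: "'x::topological_space cohomology \<Rightarrow> 'x cohomology" where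
  "coh_exp \<equiv> coh_fun exp"

definition coh_powr :: "real \<Rightarrow> 'x::topological_space cohomology \<Rightarrow> 'x cohomology" where
  "coh_powr R b = coh_exp (of_real (ln R) *\<^sub>C b)"

text \<open>The power \<open>t\<^sup>b\<close> at the point \<open>t = R e\<^bsup>i\<phi>\<^esup>\<close> of the universal cover of the punctured plane.\<close>

definition polar_powr :: "real \<Rightarrow> real \<Rightarrow> 'x::topological_space cohomology \<Rightarrow> 'x cohomology" where
  "polar_powr R \<phi> b = coh_powr R b * coh_exp ((\<i> * of_real \<phi>) *\<^sub>C b)"


section \<open>Cohomology-valued series and asymptotics\<close>

definition coh_norm :: "('x::topological_space cohomology \<Rightarrow> real) \<Rightarrow> bool" where
  "coh_norm N \<longleftrightarrow>
     (\<forall>x. N x = 0 \<longleftrightarrow> x = 0) \<and>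
     (\<forall>x y. N (x + y) \<le> N x + N y) \<and>
     (\<forall>c x. N (c *\<^sub>C x) = cmod c * N x)"

definition coh_sums ::
    "('x::topological_space cohomology \<Rightarrow> real) \<Rightarrow> (nat \<Rightarrow> 'x cohomology) \<Rightarrow> 'x cohomology \<Rightarrow> bool"
  where "coh_sums N f s \<longleftrightarrow> (\<lambda>n. N ((\<Sum>m<n. f m) - s)) \<longlonglongrightarrow> 0"

definition coh_series_term ::
    "nat \<Rightarrow> (nat \<Rightarrow> 'x::topological_space cohomology) \<Rightarrow> 'x cohomology \<Rightarrow> real \<Rightarrow> real \<Rightarrow>
     nat \<Rightarrow> 'x cohomology" where
  "coh_series_term r \<alpha> \<beta> R \<phi> m = \<alpha> (r * m) * polar_powr R \<phi> (of_nat (r * m) + \<beta>)"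

text \<open>The value \<open>\<alpha>(t)\<close> at \<open>t = R e\<^bsup>i\<phi>\<^esup>\<close>; only the coefficients with index divisible by \<open>r\<close> occur.\<close>

definition coh_series ::
    "('x::topological_space cohomology \<Rightarrow> real) \<Rightarrow> nat \<Rightarrow> (nat \<Rightarrow> 'x cohomology) \<Rightarrow> 'x cohomology \<Rightarrow>
     real \<Rightarrow> real \<Rightarrow> 'x cohomology" where
  "coh_series N r \<alpha> \<beta> R \<phi> = (THE s. coh_sums N (coh_series_term r \<alpha> \<beta> R \<phi>) s)"

text \<open>\<open>T\<^sup>b e\<^bsup>i\<theta>b\<^esup> / \<Gamma>(1 + b)\<close>, where \<^const>\<open>rGamma\<close> is \<open>1 / \<Gamma>\<close>.\<close>

definition Mittag_Leffler_coeff ::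
    "real \<Rightarrow> real \<Rightarrow> 'x::topological_space cohomology \<Rightarrow> 'x cohomology" where
  "Mittag_Leffler_coeff T \<theta> b =
     coh_powr T b * coh_exp ((\<i> * of_real \<theta>) *\<^sub>C b) * coh_fun rGamma (1 + b)"

definition asymp_Mittag_Leffler ::
    "('x::topological_space cohomology \<Rightarrow> real) \<Rightarrow> nat \<Rightarrow> (nat \<Rightarrow> 'x cohomology) \<Rightarrow> 'x cohomology \<Rightarrow>
     real \<Rightarrow> real \<Rightarrow> 'x cohomology \<Rightarrow> bool" where
  "asymp_Mittag_Leffler N r \<alpha> \<beta> T \<theta> A \<longleftrightarrow>
     (\<exists>\<epsilon>. (\<lambda>m. N (\<epsilon> m)) \<in> o(\<lambda>m. 1) \<and>
        (\<forall>\<^sub>F m in sequentially.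
           \<alpha> (r * m) = Mittag_Leffler_coeff T \<theta> (of_nat (r * m) + \<beta>) * (A + \<epsilon> m)))"

end

theory Submission
  imports Defs "HOL-Real_Asymp.Real_Asymp"
begin

text \<open>
Write \<open>\<beta> = z\<^sub>0 + \<nu>\<close> with \<open>z\<^sub>0\<close> a number and \<open>\<nu>\<close> nilpotent.  A function of an even class is then a
Taylor polynomial in \<open>\<nu>\<close>, and the map \<open>f \<mapsto> \<Sum>k. f\<^sup>(\<^sup>k\<^sup>)(z\<^sub>0) \<nu>\<^sup>k / k!\<close> from entire functions to cohomology
is multiplicative (lemma \<open>jet_mult\<close>).  With \<open>x = T|t|\<close> and \<open>\<omega> = \<theta> + \<phi>\<close>, the \<open>m\<close>-th term of the series
becomes \<open>e\<^bsup>i\<omega>\<beta>\<^esup>\<close> times the image of \<open>w \<mapsto> e\<^bsup>i\<omega>rm\<^esup> x\<^bsup>rm + w\<^esup> / \<Gamma>(1 + rm + w)\<close>, times a bounded class.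
This step moves \<open>|t|\<^bsup>\<beta>\<^esup>\<close> past the class \<open>A + o(1)\<close>; it holds because a class of
even degree commutes with every class, for which Steenrod's cup-one product is an explicit homotopy
(\<open>coboundary_cup_one\<close>).  That \<open>z\<^sub>0\<close> exists means \<open>H\<^sup>0(X) = \<complex>\<close>, and it uses that a connected
manifold is path connected (\<open>coh_comp_0_scalar\<close>).

What remains is a statement on scalar series, uniform for \<open>w\<close> near \<open>z\<^sub>0\<close>.  For \<open>|\<zeta>| = 1\<close> the function
\<open>F(x) = \<Sum>s. \<zeta>\<^sup>s x\<^bsup>s + w\<^esup> / \<Gamma>(1 + s + w)\<close> solves \<open>F' = \<zeta>F + x\<^bsup>w - 1\<^esup> / \<Gamma>(w)\<close>, so \<open>e\<^bsup>-\<zeta>x\<^esup> F\<close> is an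
incomplete Gamma integral.  Hence \<open>F\<close> differs from \<open>e\<^sup>x\<close> (if \<open>\<zeta> = 1\<close>) or from \<open>0\<close> (if \<open>\<zeta> \<noteq> 1\<close>) by
\<open>O(e\<^bsup>cx\<^esup>)\<close> with \<open>c < 1\<close> (\<open>shifted_exp_asymp\<close>).  A filter by roots of unity restricts the sum to the
multiples of \<open>r\<close> and produces the factor \<open>1/r\<close> and the resonance condition on \<open>\<omega>\<close>
(\<open>sparse_exp_asymp\<close>).  Negative powers of \<open>m\<close> are rewritten in inverse factorials
\<open>\<Gamma>(1 + rm + w) / \<Gamma>(1 + rm + w + j)\<close> (\<open>inv_fact_expansion_inverse_power\<close>), each of which only replaces
\<open>w\<close> by \<open>w + j\<close> and so contributes a factor \<open>x\<^bsup>-j\<^esup>\<close>; an error \<open>o(m\<^bsup>-L\<^esup>)\<close> contributes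
\<open>o(e\<^sup>x x\<^bsup>-L\<^esup>)\<close> (\<open>remainder_uniform_limit\<close>).

The coefficients of \<open>\<nu>\<^sup>k\<close> are derivatives in \<open>w\<close>.  Differentiating the terms would bring in powers of
\<open>log x\<close>, but the estimates above are uniform on a disc around \<open>z\<^sub>0\<close>, and uniform limits of holomorphic
functions may be differentiated, so no logarithm survives (\<open>exp_series_derivative_asymp\<close>).
Coordinates in a finite basis, which any norm controls (\<open>coh_norm_coordinates\<close>), carry the scalar
result over to cohomology (\<open>coh_series_asymptotics\<close>).  The leading asymptotics is the case \<open>L = 0\<close>.
\<close>

section \<open>Faces given by a choice of vertices\<close>

definition push_vertices :: "nat \<Rightarrow> (nat \<Rightarrow> nat) \<Rightarrow> (nat \<Rightarrow> real) \<Rightarrow> nat \<Rightarrow> real" where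
  "push_vertices p \<mu> x = (\<lambda>j. \<Sum>i\<le>p. if \<mu> i = j then x i else 0)"

text \<open>The face of \<open>\<sigma>\<close> with vertices \<open>\<mu> 0, \<dots>, \<mu> p\<close>.  Front, back and codimension-one faces are all of this
  form, and faces of faces correspond to composed vertex maps, so that identities between faces reduce
  to identities between maps of natural numbers.\<close>

definition vertex_face :: "nat \<Rightarrow> (nat \<Rightarrow> nat) \<Rightarrow> ((nat \<Rightarrow> real) \<Rightarrow> 'x) \<Rightarrow> (nat \<Rightarrow> real) \<Rightarrow> 'x" where
  "vertex_face p \<mu> \<sigma> = restrict (\<lambda>x. \<sigma> (push_vertices p \<mu> x)) (standard_simplex p)"

text \<open>The vertex map of the \<open>k\<close>-th codimension-one face.\<close>

definition skip :: "nat \<Rightarrow> nat \<Rightarrow> nat" where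
  "skip k i = (if i < k then i else Suc i)"

lemma push_vertices_compose:
  assumes "\<nu> ` {..p} \<subseteq> {..n}"
  shows "push_vertices n \<mu> (push_vertices p \<nu> x) = push_vertices p (\<mu> \<circ> \<nu>) x"
proof
  fix j
  have "(\<Sum>i\<le>n. if \<mu> i = j then \<Sum>t\<le>p. if \<nu> t = i then x t else 0 else 0)
      = (\<Sum>i\<le>n. \<Sum>t\<le>p. if \<nu> t = i \<and> \<mu> i = j then x t else 0)"
    by (intro sum.cong) (auto simp: if_distrib cong: if_cong)
  also have "\<dots> = (\<Sum>t\<le>p. \<Sum>i\<le>n. if \<nu> t = i \<and> \<mu> i = j then x t else 0)"
    by (rule sum.swap)
  also have "\<dots> = (\<Sum>t\<le>p. \<Sum>i\<le>n. if i = \<nu> t then (if \<mu> (\<nu> t) = j then x t else 0) else 0)"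
    by (intro sum.cong) auto
  also have "\<dots> = (\<Sum>t\<le>p. if \<mu> (\<nu> t) = j then x t else 0)"
    using assms by (intro sum.cong) (auto simp: sum.delta image_subset_iff)
  finally show "push_vertices n \<mu> (push_vertices p \<nu> x) j = push_vertices p (\<mu> \<circ> \<nu>) x j"
    by (simp add: push_vertices_def)
qed

lemma push_vertices_simplex:
  assumes "x \<in> standard_simplex p" "\<mu> ` {..p} \<subseteq> {..n}"
  shows "push_vertices p \<mu> x \<in> standard_simplex n"
proof -
  have x: "\<And>i. 0 \<le> x i" "\<And>i. x i \<le> 1" "\<And>i. i > p \<Longrightarrow> x i = 0" "(\<Sum>i\<le>p. x i) = 1"
    using assms(1) by (auto simp: standard_simplex_def)
  have "(\<Sum>j\<le>n. push_vertices p \<mu> x j) = (\<Sum>i\<le>p. \<Sum>j\<le>n. if \<mu> i = j then x i else 0)"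
    unfolding push_vertices_def by (rule sum.swap)
  also have "\<dots> = (\<Sum>i\<le>p. x i)"
    using assms(2) by (intro sum.cong) (auto simp: sum.delta' image_subset_iff)
  finally have s: "(\<Sum>j\<le>n. push_vertices p \<mu> x j) = 1" using x by simp
  have nn: "push_vertices p \<mu> x j \<ge> 0" for j
    unfolding push_vertices_def by (intro sum_nonneg) (auto simp: x)
  have z: "push_vertices p \<mu> x j = 0" if "j > n" for j
    unfolding push_vertices_def using assms(2) that
    by (intro sum.neutral) (fastforce simp: image_subset_iff)
  have "push_vertices p \<mu> x j \<le> 1" for j
  proof -
    have "push_vertices p \<mu> x j \<le> (\<Sum>i\<le>p. x i)"
      unfolding push_vertices_def by (intro sum_mono) (auto simp: x)
    with x show ?thesis by simp
  qed
  with s nn z show ?thesis by (auto simp: standard_simplex_def)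
qed

lemma vertex_face_compose:
  assumes "\<nu> ` {..p} \<subseteq> {..n}"
  shows "vertex_face p \<nu> (vertex_face n \<mu> \<sigma>) = vertex_face p (\<mu> \<circ> \<nu>) \<sigma>"
  using assms by (auto simp: vertex_face_def fun_eq_iff restrict_def push_vertices_simplex push_vertices_compose)

lemma vertex_face_cong:
  assumes "\<And>i. i \<le> p \<Longrightarrow> \<mu> i = \<nu> i"
  shows "vertex_face p \<mu> \<sigma> = vertex_face p \<nu> \<sigma>"
proof -
  have "push_vertices p \<mu> x = push_vertices p \<nu> x" for x
    using assms by (auto simp: push_vertices_def intro!: ext sum.cong)
  then show ?thesis by (simp add: vertex_face_def)
qed

lemma singular_simplex_vertex_face:
  assumes "singular_simplex n X \<sigma>" "\<mu> ` {..p} \<subseteq> {..n}"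
  shows "singular_simplex p X (vertex_face p \<mu> \<sigma>)"
proof -
  have "continuous_map (powertop_real UNIV) (powertop_real UNIV) (push_vertices p \<mu>)"
    unfolding push_vertices_def
    by (auto simp: continuous_map_componentwise_UNIV if_distrib
        intro!: continuous_map_sum continuous_map_product_projection cong: if_cong)
  then have "continuous_map (subtopology (powertop_real UNIV) (standard_simplex p))
          (subtopology (powertop_real UNIV) (standard_simplex n)) (push_vertices p \<mu>)"
    using assms(2) by (auto simp: continuous_map_in_subtopology continuous_map_from_subtopology push_vertices_simplex)
  then have "continuous_map (subtopology (powertop_real UNIV) (standard_simplex p)) X (\<sigma> \<circ> push_vertices p \<mu>)"
    by (rule continuous_map_compose) (use assms in \<open>simp add: singular_simplex_def\<close>)
  then show ?thesis
    by (simp add: singular_simplex_def vertex_face_def o_def)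
qed

lemma standard_simplex_above: "x \<in> standard_simplex p \<Longrightarrow> i > p \<Longrightarrow> x i = 0"
  by (auto simp: standard_simplex_def)

lemma push_vertices_skip:
  assumes "x \<in> standard_simplex p" "k \<le> Suc p"
  shows "push_vertices p (skip k) x = simplical_face k x"
proof
  fix j
  have *: "skip k i = j \<longleftrightarrow> j \<noteq> k \<and> i = (if j < k then j else j - 1)" for i j
    by (auto simp: skip_def)
  show "push_vertices p (skip k) x j = simplical_face k x j"
    using standard_simplex_above [OF assms(1)] assms(2)
    by (cases "j = k"; cases "j < k") (auto simp: push_vertices_def simplical_face_def * sum.delta')
qed

lemma singular_face_eq_vertex_face:
  assumes "k \<le> Suc p"
  shows "singular_face (Suc p) k \<sigma> = vertex_face p (skip k) \<sigma>"
  using assms by (auto simp: singular_face_def vertex_face_def fun_eq_iff restrict_def push_vertices_skip)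

lemma push_vertices_add:
  assumes "x \<in> standard_simplex q"
  shows "push_vertices q (\<lambda>i. p + i) x = (\<lambda>i. if i < p then 0 else x (i - p))"
proof
  fix j
  have *: "p + i = j \<longleftrightarrow> p \<le> j \<and> i = j - p" for i by auto
  show "push_vertices q (\<lambda>i. p + i) x j = (if j < p then 0 else x (j - p))"
    using standard_simplex_above [OF assms]
    by (cases "p \<le> j") (auto simp: push_vertices_def * sum.delta')
qed

lemma front_face_eq_vertex_face: "front_face p \<sigma> = vertex_face p (\<lambda>i. i) \<sigma>"
proof -
  have "push_vertices p (\<lambda>i. i) x = x" if "x \<in> standard_simplex p" for x
    using push_vertices_add [OF that, of 0] by simp
  then show ?thesis
    unfolding front_face_def vertex_face_def by (intro restrict_ext) simp
qed

lemma back_face_eq_vertex_face: "back_face p q \<sigma> = vertex_face q (\<lambda>i. p + i) \<sigma>"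
  by (auto simp: back_face_def vertex_face_def fun_eq_iff restrict_def push_vertices_add)

lemma raw_coboundary_vertex_face:
  assumes "simplex_in (Suc p) \<sigma>"
  shows "raw_coboundary a (Suc p) \<sigma> = (\<Sum>k\<le>Suc p. (- 1) ^ k * a p (vertex_face p (skip k) \<sigma>))"
  using assms by (simp add: raw_coboundary_def singular_face_eq_vertex_face del: sum.atMost_Suc)

lemma skip_image: "skip k ` {..p} \<subseteq> {..Suc p}"
  by (auto simp: skip_def)

lemma cocycle_vertex_face:
  assumes "coboundary a = 0" "simplex_in n \<sigma>" "\<mu> ` {..Suc p} \<subseteq> {..n}"
  shows "(\<Sum>k\<le>Suc p. (- 1) ^ k * on_simplex a p (vertex_face p (\<mu> \<circ> skip k) \<sigma>)) = 0"
proof -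
  have "simplex_in (Suc p) (vertex_face (Suc p) \<mu> \<sigma>)"
    using assms by (intro singular_simplex_vertex_face)
  from raw_coboundary_vertex_face [OF this, of "on_simplex a"]
  have "(\<Sum>k\<le>Suc p. (- 1) ^ k * on_simplex a p (vertex_face p (skip k) (vertex_face (Suc p) \<mu> \<sigma>)))
      = on_simplex (coboundary a) (Suc p) (vertex_face (Suc p) \<mu> \<sigma>)"
    by (simp add: coboundary.rep_eq)
  with assms(1) show ?thesis
    by (simp add: vertex_face_compose [OF skip_image] zero_cochain.rep_eq del: sum.atMost_Suc)
qed

section \<open>Even classes commute with all classes\<close>

text \<open>Up to sign, Steenrod's cup-one product of the component of \<open>a\<close> in degree \<open>p\<close> and the component of \<open>b\<close>
  in degree \<open>Suc q\<close>: the cochain \<open>b\<close> is evaluated on a block of consecutive vertices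
  \<open>i, \<dots>, i + Suc q\<close>, and \<open>a\<close> on the two ends of the block together with all vertices outside it.
  When \<open>Suc q\<close> is even, \<open>(-1)\<^sup>i\<close> is the only sign that occurs.\<close>

lift_definition cup_one :: "nat \<Rightarrow> nat \<Rightarrow> 'x::topological_space cochain \<Rightarrow> 'x cochain \<Rightarrow> 'x cochain"
  is "\<lambda>p q a b n \<sigma>. if n = p + q \<and> simplex_in n \<sigma>
        then \<Sum>i<p. (- 1) ^ i * a p (vertex_face p (\<lambda>t. if t \<le> i then t else t + q) \<sigma>)
                             * b (Suc q) (vertex_face (Suc q) (\<lambda>t. i + t) \<sigma>)
        else 0"
  subgoal for p q a b
    by (auto intro!: finite_support_sub [of "{p + q}"])
  done

text \<open>The combinatorial core of the homotopy formula.  Here \<open>B i\<close> stands for the value of \<open>b\<close> on the block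
  \<open>i, \<dots>, i + Suc q\<close>, the number \<open>x i t\<close> for the value of \<open>a\<close> on the two ends of this block and the
  vertices outside it, with the \<open>t\<close>-th vertex of this list deleted, and \<open>y i t\<close> for the value of \<open>b\<close> on
  \<open>i, \<dots>, i + Suc (Suc q)\<close> with the \<open>t\<close>-th vertex deleted.  The vanishing alternating sums are the
  cocycle conditions; they turn the sum over \<open>i\<close> into a telescoping one.\<close>

lemma cup_one_telescope:
  fixes x y :: "nat \<Rightarrow> nat \<Rightarrow> complex" and B :: "nat \<Rightarrow> complex"
  assumes x: "\<And>i. i \<le> p \<Longrightarrow> (\<Sum>t\<le>Suc p. (- 1) ^ t * x i t) = 0"
    and y: "\<And>i. i < p \<Longrightarrow> (\<Sum>t\<le>Suc (Suc q). (- 1) ^ t * y i t) = 0"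
    and y0: "\<And>i. i < p \<Longrightarrow> y i 0 = B (Suc i)"
    and y1: "\<And>i. i < p \<Longrightarrow> y i (Suc (Suc q)) = B i"
    and xs: "\<And>i. i < p \<Longrightarrow> x (Suc i) (Suc i) = x i (Suc i)"
    and q: "odd q"
  shows "(\<Sum>i<p. (- 1) ^ i * ((\<Sum>k\<le>i. (- 1) ^ k * x (Suc i) k * B (Suc i))
            + (\<Sum>k\<in>{Suc i..i + Suc q}. (- 1) ^ k * x i (Suc i) * y i (k - i))
            + (\<Sum>k\<in>{i + Suc (Suc q)..Suc (p + q)}. (- 1) ^ k * x i (k - q) * B i)))
       = x 0 0 * B 0 - x p (Suc p) * B p"
proof -
  let ?S1 = "\<lambda>i. \<Sum>k\<le>i. (- 1) ^ k * x (Suc i) k * B (Suc i)"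
  let ?S2 = "\<lambda>i. \<Sum>k\<in>{Suc i..i + Suc q}. (- 1) ^ k * x i (Suc i) * y i (k - i)"
  let ?S3 = "\<lambda>i. \<Sum>k\<in>{i + Suc (Suc q)..Suc (p + q)}. (- 1) ^ k * x i (k - q) * B i"
  \<comment> \<open>\<open>U i\<close> collects the deletions before the block, and \<open>V i\<close> the deletion of its first vertex.\<close>
  define U where "U i = (- 1) ^ i * (\<Sum>k<i. (- 1) ^ k * x i k) * B i" for i
  define V where "V i = x i i * B i" for i
  have "(- 1) ^ i * (?S1 i + ?S2 i + ?S3 i)
        = (U i + V i) - (U (Suc i) + V (Suc i))" if i: "i < p" for i
  proof -
    have 1: "(- 1) ^ i * ?S1 i = - U (Suc i)"
      by (simp add: U_def lessThan_Suc_atMost sum_distrib_right mult.assoc)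
    have "?S2 i
        = (\<Sum>t\<in>{1..Suc q}. (- 1) ^ (i + t) * x i (Suc i) * y i t)"
      by (rule sum.reindex_bij_witness [of _ "\<lambda>t. i + t" "\<lambda>k. k - i"]) auto
    also have "\<dots> = (- 1) ^ i * x i (Suc i) * (\<Sum>t\<in>{1..Suc q}. (- 1) ^ t * y i t)"
      by (simp add: sum_distrib_left power_add mult_ac del: sum.cl_ivl_Suc)
    also have "(\<Sum>t\<in>{1..Suc q}. (- 1) ^ t * y i t) = B i - B (Suc i)"
    proof -
      have "{..Suc (Suc q)} = insert 0 (insert (Suc (Suc q)) {1..Suc q})" by auto
      then have "(\<Sum>t\<le>Suc (Suc q). (- 1) ^ t * y i t)
          = y i 0 + ((- 1) ^ Suc (Suc q) * y i (Suc (Suc q)) + (\<Sum>t\<in>{1..Suc q}. (- 1) ^ t * y i t))"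
        by (simp del: sum.cl_ivl_Suc sum.atMost_Suc)
      then show ?thesis
        using y [OF i] y0 [OF i] y1 [OF i] q
        by (simp add: algebra_simps del: sum.cl_ivl_Suc sum.atMost_Suc)
    qed
    finally have 2: "(- 1) ^ i * ?S2 i
        = x i (Suc i) * (B i - B (Suc i))"
      by (simp del: sum.cl_ivl_Suc flip: power_add mult.assoc)
    have "?S3 i
        = (\<Sum>t\<in>{Suc (Suc i)..Suc p}. (- 1) ^ (t + q) * x i t * B i)"
      by (intro sum.reindex_bij_witness [of _ "\<lambda>t. t + q" "\<lambda>k. k - q"]) auto
    also have "\<dots> = - (\<Sum>t\<in>{Suc (Suc i)..Suc p}. (- 1) ^ t * x i t) * B i"
      using q by (simp add: power_add sum_negf sum_distrib_right del: sum.cl_ivl_Suc)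
    also have "- (\<Sum>t\<in>{Suc (Suc i)..Suc p}. (- 1) ^ t * x i t) = (\<Sum>t\<le>Suc i. (- 1) ^ t * x i t)"
    proof -
      have "{..Suc p} = {..Suc i} \<union> {Suc (Suc i)..Suc p}" using i by auto
      then have "(\<Sum>t\<le>Suc p. (- 1) ^ t * x i t)
          = (\<Sum>t\<le>Suc i. (- 1) ^ t * x i t) + (\<Sum>t\<in>{Suc (Suc i)..Suc p}. (- 1) ^ t * x i t)"
        by (simp add: sum.union_disjoint del: sum.cl_ivl_Suc sum.atMost_Suc)
      then show ?thesis using x [of i] i by (metis add.commute less_imp_le minus_unique)
    qed
    also have "(\<Sum>t\<le>Suc i. (- 1) ^ t * x i t)
        = (\<Sum>t<i. (- 1) ^ t * x i t) + (- 1) ^ i * x i i - (- 1) ^ i * x i (Suc i)"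
      by (simp add: lessThan_Suc_atMost [symmetric])
    finally have sum3: "?S3 i
        = ((\<Sum>t<i. (- 1) ^ t * x i t) + (- 1) ^ i * x i i - (- 1) ^ i * x i (Suc i)) * B i" .
    have "e * ((S + e * v - e * w) * z) = e * S * z + (e * e) * (v * z) - (e * e) * (w * z)"
      for e S v w z :: complex
      by (simp add: algebra_simps)
    then have 3: "(- 1) ^ i * ?S3 i
        = U i + x i i * B i - x i (Suc i) * B i"
      unfolding sum3 U_def by (simp flip: power_mult_distrib)
    show ?thesis
      unfolding distrib_left 1 2 3 using xs [OF i] by (simp add: V_def algebra_simps)
  qed
  then have "(\<Sum>i<p. (- 1) ^ i * (?S1 i + ?S2 i + ?S3 i))
       = (\<Sum>i<p. (U i + V i) - (U (Suc i) + V (Suc i)))"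
    by (intro sum.cong refl) (simp only: lessThan_iff)
  also have "\<dots> = (U 0 + V 0) - (U p + V p)"
    by (rule sum_lessThan_telescope')
  finally have sum: "(\<Sum>i<p. (- 1) ^ i * (?S1 i + ?S2 i + ?S3 i))
       = (U 0 + V 0) - (U p + V p)" .
  have "U p + V p = x p (Suc p) * B p"
  proof -
    have "(\<Sum>k<p. (- 1) ^ k * x p k) + (- 1) ^ p * x p p - (- 1) ^ p * x p (Suc p) = 0"
      using x [of p] by (simp add: lessThan_Suc_atMost [symmetric])
    then have "(\<Sum>k<p. (- 1) ^ k * x p k) = (- 1) ^ p * (x p (Suc p) - x p p)"
      by (simp add: algebra_simps eq_neg_iff_add_eq_0)
    then have "U p = ((- 1) ^ p * (- 1) ^ p) * ((x p (Suc p) - x p p) * B p)"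
      by (simp only: U_def mult.assoc)
    then show ?thesis
      by (simp add: V_def left_diff_distrib flip: power_mult_distrib)
  qed
  then show ?thesis unfolding sum by (simp add: U_def V_def)
qed

lemma on_simplex_mult_comp:
  assumes "simplex_in n \<sigma>"
  shows "on_simplex (cochain_comp p a * cochain_comp q b) n \<sigma>
    = (if n = p + q then on_simplex a p (vertex_face p (\<lambda>t. t) \<sigma>)
        * on_simplex b q (vertex_face q (\<lambda>t. p + t) \<sigma>) else 0)"
proof -
  have "on_simplex (cochain_comp p a * cochain_comp q b) n \<sigma>
      = (\<Sum>i\<le>n. if i = p then (if n = p + q
          then on_simplex a p (front_face p \<sigma>) * on_simplex b q (back_face p q \<sigma>) else 0) else 0)"
    using assms unfolding times_cochain.rep_eq raw_cup_def cochain_comp.rep_eq if_P [OF assms]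
    by (intro sum.cong) auto
  then show ?thesis
    by (simp add: sum.delta front_face_eq_vertex_face back_face_eq_vertex_face)
qed

text \<open>The cup-one product is a homotopy between the two orders of multiplication.  The vertex deleted by the
  coboundary lies before the block, inside it or after it, which gives the three sums of
  \<open>cup_one_telescope\<close>.\<close>

lemma coboundary_cup_one:
  fixes a b :: "'x::topological_space cochain"
  assumes a: "coboundary a = 0" and b: "coboundary b = 0" and q: "odd q"
  shows "coboundary (cup_one p q a b)
       = cochain_comp (Suc q) b * cochain_comp p a - cochain_comp p a * cochain_comp (Suc q) b"
proof (rule cochain_eqI)
  fix n and \<sigma> :: "(nat \<Rightarrow> real) \<Rightarrow> 'x"
  assume \<sigma>: "simplex_in n \<sigma>"
  show "on_simplex (coboundary (cup_one p q a b)) n \<sigma>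
      = on_simplex (cochain_comp (Suc q) b * cochain_comp p a
          - cochain_comp p a * cochain_comp (Suc q) b) n \<sigma>"
  proof (cases "n = Suc (p + q)")
    case False
    then have "on_simplex (coboundary (cup_one p q a b)) n \<sigma> = 0"
      by (cases n) (auto simp: coboundary.rep_eq raw_coboundary_def cup_one.rep_eq
          intro!: sum.neutral)
    with False show ?thesis
      by (simp add: minus_cochain.rep_eq on_simplex_mult_comp [OF \<sigma>])
  next
    case n: True
    define a' where "a' \<mu> = on_simplex a p (vertex_face p \<mu> \<sigma>)" for \<mu>
    define b' where "b' \<mu> = on_simplex b (Suc q) (vertex_face (Suc q) \<mu> \<sigma>)" for \<mu>
    have a'_cong: "a' \<mu> = a' \<nu>" if "\<And>t. t \<le> p \<Longrightarrow> \<mu> t = \<nu> t" for \<mu> \<nu>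
      unfolding a'_def by (intro arg_cong [where f = "on_simplex a p"] vertex_face_cong that)
    have b'_cong: "b' \<mu> = b' \<nu>" if "\<And>t. t \<le> Suc q \<Longrightarrow> \<mu> t = \<nu> t" for \<mu> \<nu>
      unfolding b'_def by (intro arg_cong [where f = "on_simplex b (Suc q)"] vertex_face_cong that)
    \<comment> \<open>The two ends of the block at \<open>i\<close> and the vertices outside it; with one vertex more, the same
      formula lists the vertices before a deletion.\<close>
    define X where "X i t = (if t \<le> i then t else t + q)" for i t :: nat
    define x where "x i t = a' (X i \<circ> skip t)" for i t
    define y where "y i t = b' ((\<lambda>s. i + s) \<circ> skip t)" for i t
    define B where "B i = b' (\<lambda>s. i + s)" for i
    let ?S1 = "\<lambda>i. \<Sum>k\<le>i. (- 1) ^ k * x (Suc i) k * B (Suc i)"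
    let ?S2 = "\<lambda>i. \<Sum>k\<in>{Suc i..i + Suc q}. (- 1) ^ k * x i (Suc i) * y i (k - i)"
    let ?S3 = "\<lambda>i. \<Sum>k\<in>{i + Suc (Suc q)..Suc (p + q)}. (- 1) ^ k * x i (k - q) * B i"
    have face: "vertex_face m \<mu> (singular_face n k \<sigma>) = vertex_face m (skip k \<circ> \<mu>) \<sigma>"
      if "k \<le> n" "\<mu> ` {..m} \<subseteq> {..p + q}" for m \<mu> k
      using that by (simp add: n singular_face_eq_vertex_face vertex_face_compose)
    have "on_simplex (coboundary (cup_one p q a b)) n \<sigma>
       = (\<Sum>k\<le>n. (- 1) ^ k * on_simplex (cup_one p q a b) (p + q) (singular_face n k \<sigma>))"
      using \<sigma> by (simp add: n coboundary.rep_eq raw_coboundary_def del: sum.atMost_Suc)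
    also have "\<dots> = (\<Sum>k\<le>n. \<Sum>i<p. (- 1) ^ k
        * ((- 1) ^ i * a' (skip k \<circ> X i) * b' (skip k \<circ> (\<lambda>t. i + t))))"
    proof (intro sum.cong refl)
      fix k assume "k \<in> {..n}"
      then have k: "k \<le> n" by simp
      have s: "simplex_in (p + q) (singular_face n k \<sigma>)"
        using singular_simplex_singular_face [OF \<sigma> _ k] n by simp
      have "on_simplex (cup_one p q a b) (p + q) (singular_face n k \<sigma>)
          = (\<Sum>i<p. (- 1) ^ i * a' (skip k \<circ> X i) * b' (skip k \<circ> (\<lambda>t. i + t)))"
      proof -
        have "vertex_face p (\<lambda>t. if t \<le> i then t else t + q) (singular_face n k \<sigma>)
            = vertex_face p (skip k \<circ> X i) \<sigma>" for i
          unfolding X_def [abs_def] using k by (intro face) auto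
        moreover have "vertex_face (Suc q) (\<lambda>t. i + t) (singular_face n k \<sigma>)
            = vertex_face (Suc q) (skip k \<circ> (\<lambda>t. i + t)) \<sigma>" if "i < p" for i
          using k that by (intro face) auto
        ultimately show ?thesis
          using s unfolding cup_one.rep_eq a'_def b'_def by simp
      qed
      then show "(- 1) ^ k * on_simplex (cup_one p q a b) (p + q) (singular_face n k \<sigma>)
         = (\<Sum>i<p. (- 1) ^ k * ((- 1) ^ i * a' (skip k \<circ> X i) * b' (skip k \<circ> (\<lambda>t. i + t))))"
        by (simp add: sum_distrib_left)
    qed
    also have "\<dots> = (\<Sum>i<p. \<Sum>k\<le>n. (- 1) ^ k
        * ((- 1) ^ i * a' (skip k \<circ> X i) * b' (skip k \<circ> (\<lambda>t. i + t))))"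
      by (rule sum.swap)
    also have "\<dots> = (\<Sum>i<p. (- 1) ^ i * (?S1 i + ?S2 i + ?S3 i))"
    proof (rule sum.cong [OF refl])
      fix i assume "i \<in> {..<p}"
      then have i: "i < p" by simp
      define G where "G k = (- 1) ^ k * (a' (skip k \<circ> X i) * b' (skip k \<circ> (\<lambda>t. i + t)))" for k
      have "{..n} = {..i} \<union> ({Suc i..i + Suc q} \<union> {i + Suc (Suc q)..Suc (p + q)})"
        using i n by auto
      then have "(\<Sum>k\<le>n. G k) = (\<Sum>k\<le>i. G k) + (\<Sum>k\<in>{Suc i..i + Suc q}. G k)
          + (\<Sum>k\<in>{i + Suc (Suc q)..Suc (p + q)}. G k)"
        by (simp only:) (subst sum.union_disjoint; auto simp: sum.union_disjoint add.assoc simp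
            del: sum.cl_ivl_Suc)
      moreover have "(\<Sum>k\<le>i. G k) = ?S1 i"
      proof (rule sum.cong [OF refl])
        fix k assume that: "k \<in> {..i}"
        have "a' (skip k \<circ> X i) = x (Suc i) k"
          unfolding x_def using that by (intro a'_cong) (auto simp: X_def skip_def)
        moreover have "b' (skip k \<circ> (\<lambda>t. i + t)) = B (Suc i)"
          unfolding B_def using that by (intro b'_cong) (auto simp: skip_def)
        ultimately show "G k = (- 1) ^ k * x (Suc i) k * B (Suc i)" by (simp add: G_def)
      qed
      moreover have "(\<Sum>k\<in>{Suc i..i + Suc q}. G k) = ?S2 i"
      proof (rule sum.cong [OF refl])
        fix k assume that: "k \<in> {Suc i..i + Suc q}"
        have "a' (skip k \<circ> X i) = x i (Suc i)"
          unfolding x_def using that by (intro a'_cong) (auto simp: X_def skip_def)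
        moreover have "b' (skip k \<circ> (\<lambda>t. i + t)) = y i (k - i)"
          unfolding y_def using that by (intro b'_cong) (auto simp: skip_def)
        ultimately show "G k = (- 1) ^ k * x i (Suc i) * y i (k - i)" by (simp add: G_def)
      qed
      moreover have "(\<Sum>k\<in>{i + Suc (Suc q)..Suc (p + q)}. G k) = ?S3 i"
      proof (rule sum.cong [OF refl])
        fix k assume that: "k \<in> {i + Suc (Suc q)..Suc (p + q)}"
        have "a' (skip k \<circ> X i) = x i (k - q)"
          unfolding x_def using that by (intro a'_cong) (auto simp: X_def skip_def)
        moreover have "b' (skip k \<circ> (\<lambda>t. i + t)) = B i"
          unfolding B_def using that by (intro b'_cong) (auto simp: skip_def)
        ultimately show "G k = (- 1) ^ k * x i (k - q) * B i" by (simp add: G_def)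
      qed
      moreover have "(\<Sum>k\<le>n. (- 1) ^ k * ((- 1) ^ i * a' (skip k \<circ> X i) * b' (skip k \<circ> (\<lambda>t. i + t))))
          = (- 1) ^ i * (\<Sum>k\<le>n. G k)"
        by (simp add: G_def sum_distrib_left mult_ac)
      ultimately show "(\<Sum>k\<le>n. (- 1) ^ k
          * ((- 1) ^ i * a' (skip k \<circ> X i) * b' (skip k \<circ> (\<lambda>t. i + t))))
          = (- 1) ^ i * (?S1 i + ?S2 i + ?S3 i)"
        by (simp only:)
    qed
    also have "\<dots> = x 0 0 * B 0 - x p (Suc p) * B p"
    proof (rule cup_one_telescope [OF _ _ _ _ _ q])
      show "(\<Sum>t\<le>Suc p. (- 1) ^ t * x i t) = 0" if "i \<le> p" for i
        unfolding x_def a'_def using that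
        by (intro cocycle_vertex_face [OF a \<sigma>]) (auto simp: X_def n)
      show "(\<Sum>t\<le>Suc (Suc q). (- 1) ^ t * y i t) = 0" if "i < p" for i
        unfolding y_def b'_def using that
        by (intro cocycle_vertex_face [OF b \<sigma>]) (auto simp: n)
      show "y i 0 = B (Suc i)" for i
        unfolding y_def B_def by (intro b'_cong) (auto simp: skip_def)
      show "y i (Suc (Suc q)) = B i" for i
        unfolding y_def B_def by (intro b'_cong) (auto simp: skip_def)
      show "x (Suc i) (Suc i) = x i (Suc i)" for i
        unfolding x_def by (intro a'_cong) (auto simp: skip_def X_def)
    qed
    also have "x 0 0 = a' (\<lambda>t. Suc q + t)"
      unfolding x_def by (intro a'_cong) (auto simp: skip_def X_def)
    also have "x p (Suc p) = a' (\<lambda>t. t)"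
      unfolding x_def by (intro a'_cong) (auto simp: skip_def X_def)
    also have "a' (\<lambda>t. Suc q + t) * B 0 - a' (\<lambda>t. t) * B p
       = on_simplex (cochain_comp (Suc q) b * cochain_comp p a
           - cochain_comp p a * cochain_comp (Suc q) b) n \<sigma>"
      unfolding minus_cochain.rep_eq on_simplex_mult_comp [OF \<sigma>] a'_def b'_def B_def
      by (simp add: n plus_nat.add_0 [abs_def])
    finally show ?thesis .
  qed
qed

lemma coh_comp_commute:
  assumes "even q" "q > 0"
  shows "coh_comp p a * coh_comp q b = coh_comp q b * coh_comp p a"
proof -
  obtain q' where q': "q = Suc q'" "odd q'"
    using assms by (cases q) auto
  have *: "cohomologous (cochain_comp p a * cochain_comp q b) (cochain_comp q b * cochain_comp p a)"
    if "coboundary a = 0" "coboundary b = 0" for a b :: "'a cochain"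
  proof -
    have "coboundary (cochain_comp p a) = 0" "coboundary (cochain_comp q b) = 0"
      using that by (simp_all add: coboundary_comp) (transfer; simp add: fun_eq_iff)+
    then show ?thesis
      using that q' by (intro cohomologousI [where c = "- cup_one p q' a b"])
        (simp_all add: coboundary_mult coboundary_minus coboundary_cup_one cochain_sign_0)
  qed
  show ?thesis
    by (transfer fixing: p q) (rule *, (erule cohomologous_cocycle)+)
qed

section \<open>Degrees of cohomology classes\<close>

lemma cochain_scale_mult_left: "cochain_scale c a * b = cochain_scale c (a * b)"
  by transfer (auto simp: raw_cup_def fun_eq_iff sum_distrib_left mult_ac)

lemma cochain_scale_mult_right: "a * cochain_scale c b = cochain_scale c (a * b)"
  by transfer (auto simp: raw_cup_def fun_eq_iff sum_distrib_left mult_ac)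

lemma cochain_scale_0 [simp]: "cochain_scale c 0 = 0"
  by transfer (simp add: fun_eq_iff)

lemma coh_scale_mult_left [simp]: "(c *\<^sub>C a) * b = c *\<^sub>C (a * b)"
  by (transfer fixing: c)
     (rule cohomologous_eqI,
      simp_all add: cochain_scale_mult_left coboundary_scale coboundary_ring cohomologous_cocycle)

lemma coh_scale_mult_right [simp]: "a * (c *\<^sub>C b) = c *\<^sub>C (a * b)"
  by (transfer fixing: c)
     (rule cohomologous_eqI,
      simp_all add: cochain_scale_mult_right coboundary_scale coboundary_ring cohomologous_cocycle cochain_sign_0)

lemma cochain_comp_0 [simp]: "cochain_comp p 0 = 0"
  by transfer (simp add: fun_eq_iff)

lemma coboundary_comp_cocycle: "coboundary a = 0 \<Longrightarrow> coboundary (cochain_comp p a) = 0"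
  by (simp add: coboundary_comp)

lemma coh_comp_add: "coh_comp p (a + b) = coh_comp p a + coh_comp p b"
proof -
  have *: "cochain_comp p (u + v) = cochain_comp p u + cochain_comp p v" for u v :: "'a cochain"
    by transfer (auto simp: fun_eq_iff)
  show ?thesis
    by (transfer fixing: p)
       (rule cohomologous_eqI, simp_all add:
           * coboundary_ring coboundary_comp_cocycle cohomologous_cocycle)
qed

lemma coh_comp_scale: "coh_comp p (c *\<^sub>C a) = c *\<^sub>C coh_comp p a"
proof -
  have *: "cochain_comp p (cochain_scale c u) = cochain_scale c (cochain_comp p u)"
      for u :: "'a cochain"
    by transfer (auto simp: fun_eq_iff)
  show ?thesis
    by (transfer fixing: p c)
       (rule cohomologous_eqI, simp_all add:
           * coboundary_scale coboundary_comp_cocycle cohomologous_cocycle)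
qed

lemma coh_comp_0 [simp]: "coh_comp p 0 = 0"
  using coh_comp_scale [of p 0 0] by simp

lemma coh_comp_minus: "coh_comp p (- a) = - coh_comp p a"
  using coh_comp_add [of p a "- a"] by (simp add: eq_neg_iff_add_eq_0 add.commute)

lemma coh_comp_diff: "coh_comp p (a - b) = coh_comp p a - coh_comp p b"
  using coh_comp_add [of p a "- b"] by (simp add: coh_comp_minus)

lemma coh_comp_sum: "coh_comp p (\<Sum>i\<in>I. f i) = (\<Sum>i\<in>I. coh_comp p (f i))"
  by (induction I rule: infinite_finite_induct) (simp_all add: coh_comp_add)

lemma coh_comp_comp: "coh_comp p (coh_comp q a) = (if p = q then coh_comp p a else 0)"
proof -
  have *: "cochain_comp p (cochain_comp q u) = (if p = q then cochain_comp p u else 0)" for p q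
      and u :: "'a cochain"
    by transfer (auto simp: fun_eq_iff)
  have **: "cochain_comp p (cochain_comp p u) = cochain_comp p u" for u :: "'a cochain"
    by (simp add: *)
  have "coh_comp p (coh_comp p a) = coh_comp p a"
    by (transfer fixing: p)
       (rule cohomologous_eqI [OF **], simp_all add: coboundary_comp_cocycle cohomologous_cocycle)
  moreover have "coh_comp p (coh_comp q a) = 0" if "p \<noteq> q"
    using that
    by (transfer fixing: p q)
       (rule cohomologous_eqI, simp_all add: * coboundary_comp_cocycle cohomologous_cocycle)
  ultimately show ?thesis by (cases "p = q") auto
qed

lemma coh_comp_one: "coh_comp p 1 = (if p = 0 then 1 else 0)"
proof -
  have *: "cochain_comp p 1 = (if p = 0 then 1 else 0 :: 'a cochain)" 
    by transfer (auto simp: fun_eq_iff)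
  have "coh_comp p 1 = (0 :: 'a cohomology)" if "p \<noteq> 0"
    using that
    by (transfer fixing: p) (rule cohomologous_eqI, simp_all add:
        * coboundary_comp_cocycle coboundary_one)
  moreover have "coh_comp 0 1 = (1 :: 'a cohomology)"
  proof -
    have *: "cochain_comp 0 1 = (1 :: 'a cochain)" 
      by transfer (auto simp: fun_eq_iff)
    show ?thesis
      by transfer (rule cohomologous_eqI, simp_all add: * coboundary_comp_cocycle coboundary_one)
  qed
  ultimately show ?thesis by simp
qed

lemma coh_comp_mult_homogeneous:
  "coh_comp n (coh_comp p a * coh_comp q b)
      = (if n = p + q then coh_comp p a * coh_comp q b else 0)"
proof -
  have *: "cochain_comp n (cochain_comp p u * cochain_comp q v)
     = (if n = p + q then cochain_comp p u * cochain_comp q v else 0)" for n and u v :: "'a cochain"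
    by (rule cochain_eqI) (auto simp: cochain_comp.rep_eq on_simplex_mult_comp zero_cochain.rep_eq)
  have **: "cochain_comp (p + q) (cochain_comp p u * cochain_comp q v)
      = cochain_comp p u * cochain_comp q v"
    for u v :: "'a cochain" by (simp add: *)
  have "coh_comp (p + q) (coh_comp p a * coh_comp q b) = coh_comp p a * coh_comp q b"
    by (transfer fixing: p q)
       (rule cohomologous_eqI [OF **], simp_all add: ** coboundary_mult coboundary_comp_cocycle cohomologous_cocycle cochain_sign_0)
  moreover have "coh_comp n (coh_comp p a * coh_comp q b) = 0" if "n \<noteq> p + q"
    using that
    by (transfer fixing: n p q)
       (rule cohomologous_eqI, simp_all add:
           * coboundary_mult coboundary_comp_cocycle cohomologous_cocycle cochain_sign_0)
  ultimately show ?thesis by simp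
qed

lemma on_simplex_sum: "on_simplex (\<Sum>i\<in>I. f i) p \<sigma> = (\<Sum>i\<in>I. on_simplex (f i) p \<sigma>)"
  by (induction I rule: infinite_finite_induct) (simp_all add: zero_cochain.rep_eq plus_cochain.rep_eq)

text \<open>Cochains have finitely many nonzero components by construction; this is what makes total cohomology a
  direct sum.\<close>

lemma cochain_decomposition:
  obtains D where "\<And>p. p > D \<Longrightarrow> cochain_comp p a = 0" "a = (\<Sum>p\<le>D. cochain_comp p a)"
proof -
  have "finite {p. on_simplex a p \<noteq> (\<lambda>\<sigma>. 0)}"
    using on_simplex [of a] by simp
  then obtain D where D: "{p. on_simplex a p \<noteq> (\<lambda>\<sigma>. 0)} \<subseteq> {..D}"
    using finite_nat_iff_bounded_le by blast
  then have z: "on_simplex a p \<sigma> = 0" if "p > D" for p \<sigma>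
    using that by (metis (mono_tags, lifting) atMost_iff leD mem_Collect_eq subsetD)
  show thesis
  proof
    show "cochain_comp p a = 0" if "p > D" for p
      using that by (intro cochain_eqI) (auto simp: cochain_comp.rep_eq z zero_cochain.rep_eq)
    show "a = (\<Sum>p\<le>D. cochain_comp p a)"
      by (intro cochain_eqI) (auto simp: cochain_comp.rep_eq z on_simplex_sum sum.delta)
  qed
qed

lemma abs_cohomology_sum:
  assumes "\<And>i. i \<in> I \<Longrightarrow> coboundary (f i) = 0"
  shows "coboundary (\<Sum>i\<in>I. f i) = 0 \<and> abs_cohomology (\<Sum>i\<in>I. f i) = (\<Sum>i\<in>I. abs_cohomology (f i))"
  using assms
proof (induction I rule: infinite_finite_induct)
  case (insert i I)
  then have "coboundary (f i) = 0" "coboundary (\<Sum>i\<in>I. f i) = 0" by auto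
  then show ?case
    using insert plus_cohomology.abs_eq [of "f i" "\<Sum>i\<in>I. f i"]
    by (simp add: cohomologous_refl coboundary_add)
qed (simp_all add: zero_cohomology_def)

lemma coh_decomposition:
  obtains D where "\<And>p. p > D \<Longrightarrow> coh_comp p x = 0" "x = (\<Sum>p\<le>D. coh_comp p x)"
proof -
  obtain a where a: "coboundary a = 0" and x: "x = abs_cohomology a"
    by (induction x rule: cohomology.abs_induct) (auto dest: cohomologous_cocycle)
  obtain D where D: "\<And>p. p > D \<Longrightarrow> cochain_comp p a = 0" "a = (\<Sum>p\<le>D. cochain_comp p a)"
    using cochain_decomposition by blast
  have c: "coh_comp p x = abs_cohomology (cochain_comp p a)" for p
    unfolding x using a by (intro coh_comp.abs_eq) (rule cohomologous_refl)
  show thesis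
  proof
    show "coh_comp p x = 0" if "p > D" for p
      using D that by (simp add: c zero_cohomology_def)
    have "x = (\<Sum>p\<le>D. abs_cohomology (cochain_comp p a))"
      using abs_cohomology_sum [of "{..D}" "\<lambda>p. cochain_comp p a"] a D(2)
      by (simp add: x coboundary_comp_cocycle)
    then show "x = (\<Sum>p\<le>D. coh_comp p x)"
      unfolding c .
  qed
qed

lemma coh_eqI: "(\<And>p. coh_comp p x = coh_comp p y) \<Longrightarrow> x = y"
  by (metis coh_comp_diff coh_decomposition right_minus_eq sum.neutral)

lemma coh_degrees_bounded:
  assumes "finite (S :: 'x::topological_space cohomology set)" "coh.span S = UNIV"
  obtains D where "\<And>p (x :: 'x cohomology). p > D \<Longrightarrow> coh_comp p x = 0"
proof -
  have "\<exists>D. \<forall>s\<in>S. \<forall>p>D. coh_comp p s = 0"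
    using assms(1)
  proof (induction S)
    case (insert s S)
    then obtain D where D: "\<forall>s\<in>S. \<forall>p>D. coh_comp p s = 0" by blast
    obtain D' where "\<And>p. p > D' \<Longrightarrow> coh_comp p s = 0"
      using coh_decomposition by blast
    with D show ?case by (intro exI [of _ "max D D'"]) auto
  qed auto
  then obtain D where D: "\<forall>s\<in>S. \<forall>p>D. coh_comp p s = 0" by blast
  have "coh.span S \<subseteq> {x. \<forall>p>D. coh_comp p x = 0}"
    using D by (intro coh.span_minimal coh.subspaceI) (auto simp: coh_comp_add coh_comp_scale)
  then show thesis
    using assms(2) by (intro that [of D]) auto
qed

lemma coh_comp_nilpotent_part:
  "coh_comp p (nilpotent_part b) = (if p = 0 then 0 else coh_comp p b)"
  by (simp add: nilpotent_part_def coh_comp_diff coh_comp_comp)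

lemma coh_comp_mult_low_degree:
  assumes "\<And>p. p < i \<Longrightarrow> coh_comp p a = 0" "\<And>p. p < j \<Longrightarrow> coh_comp p b = 0" "n < i + j"
  shows "coh_comp n (a * b) = 0"
proof -
  obtain D where D: "a = (\<Sum>p\<le>D. coh_comp p a)" using coh_decomposition by blast
  obtain E where E: "b = (\<Sum>p\<le>E. coh_comp p b)" using coh_decomposition by blast
  have "coh_comp n (a * b) = (\<Sum>p\<le>D. \<Sum>q\<le>E. coh_comp n (coh_comp p a * coh_comp q b))"
    by (subst D, subst E) (simp only: sum_product coh_comp_sum)
  also have "\<dots> = 0"
  proof (intro sum.neutral ballI)
    fix p q
    show "coh_comp n (coh_comp p a * coh_comp q b) = 0"
      using assms by (cases "p < i"; cases "q < j") (auto simp: coh_comp_mult_homogeneous)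
  qed
  finally show ?thesis .
qed

text \<open>Every factor raises the lowest degree by at least one, while finite dimension bounds the degrees.\<close>

lemma nilpotent_part_power_eq_0:
  assumes "finite (S :: 'x::topological_space cohomology set)" "coh.span S = UNIV"
  obtains K where "nilpotent_part (b :: 'x cohomology) ^ K = 0"
proof -
  obtain D where D: "\<And>p (x :: 'x cohomology). p > D \<Longrightarrow> coh_comp p x = 0"
    using coh_degrees_bounded [OF assms] by blast
  have low: "coh_comp p (nilpotent_part b ^ k) = 0" if "p < k" for p k
    using that
  proof (induction k arbitrary: p)
    case (Suc k)
    have "coh_comp p (nilpotent_part b * nilpotent_part b ^ k) = 0"
      using Suc by (intro coh_comp_mult_low_degree [where i = 1 and j = k]) (auto
          simp: coh_comp_nilpotent_part)
    then show ?case by simp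
  qed auto
  have "nilpotent_part b ^ Suc D = 0"
  proof (rule coh_eqI)
    fix p
    show "coh_comp p (nilpotent_part b ^ Suc D) = coh_comp p 0"
      using low [of p "Suc D"] D [of p] by (cases "p < Suc D") (auto simp del: power_Suc)
  qed
  then show thesis by (rule that)
qed

text \<open>The component of degree \<open>0\<close> has been removed and the odd components vanish, so that
  \<open>coh_comp_commute\<close> applies to each of the others.\<close>

lemma nilpotent_part_central:
  assumes "even_class b"
  shows "nilpotent_part b * v = v * nilpotent_part b"
proof -
  obtain D where D: "nilpotent_part b = (\<Sum>p\<le>D. coh_comp p (nilpotent_part b))"
    using coh_decomposition by blast
  obtain E where E: "v = (\<Sum>p\<le>E. coh_comp p v)" using coh_decomposition by blast
  have *: "coh_comp q v * coh_comp p (nilpotent_part b)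
      = coh_comp p (nilpotent_part b) * coh_comp q v" for p q
    using assms coh_comp_commute [of p q v "nilpotent_part b"]
    by (cases "odd p"; cases "p = 0") (auto simp: coh_comp_nilpotent_part even_class_def)
  have "nilpotent_part b * v = (\<Sum>p\<le>D. \<Sum>q\<le>E. coh_comp p (nilpotent_part b) * coh_comp q v)"
    by (subst D, subst E) (simp only: sum_product)
  also have "\<dots> = (\<Sum>q\<le>E. \<Sum>p\<le>D. coh_comp q v * coh_comp p (nilpotent_part b))"
    unfolding * by (rule sum.swap)
  also have "(\<Sum>q\<le>E. \<Sum>p\<le>D. coh_comp q v * coh_comp p (nilpotent_part b)) = v * nilpotent_part b"
  proof -
    have "v * nilpotent_part b = (\<Sum>q\<le>E. \<Sum>p\<le>D. coh_comp q v * coh_comp p (nilpotent_part b))"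
      by (subst D, subst E) (simp only: sum_product)
    then show ?thesis by simp
  qed
  finally show ?thesis .
qed

section \<open>Degree zero of a connected manifold\<close>

lemma smooth_atlas_locally_path_connected:
  fixes \<A> :: "'x::topological_space chart set"
  assumes "smooth_atlas n \<A>"
  shows "locally_path_connected_space (euclidean :: 'x topology)"
  unfolding locally_path_connected_space
proof (intro allI impI, elim conjE)
  fix V and x :: 'x
  assume V: "openin euclidean V" "x \<in> V"
  have "x \<in> (\<Union>(U, \<phi>)\<in>\<A>. U)"
    using assms unfolding smooth_atlas_def by simp
  then obtain U \<phi> where U: "(U, \<phi>) \<in> \<A>" "x \<in> U"
    by auto
  have "\<forall>(U, \<phi>)\<in>\<A>. open U \<and>
        (\<exists>V. openin (Euclidean_space n) V \<and>
             homeomorphic_map (top_of_set U) (subtopology (Euclidean_space n) V) \<phi>)"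
    using assms unfolding smooth_atlas_def by (elim conjE)
  from bspec [OF this U(1)] obtain W where W: "open U" "openin (Euclidean_space n) W"
      "homeomorphic_map (top_of_set U) (subtopology (Euclidean_space n) W) \<phi>"
    by auto
  have "locally_path_connected_space (top_of_set U)"
    using homeomorphic_locally_path_connected_space
        [OF homeomorphic_map_imp_homeomorphic_space [OF W(3)]]
      locally_path_connected_space_open_subset [OF locally_path_connected_Euclidean_space W(2)]
      by simp
  moreover have "openin (top_of_set U) (V \<inter> U)"
    using V W by (simp add: openin_open_Int Int_commute)
  ultimately obtain P where P: "openin (top_of_set U) P" "path_connectedin (top_of_set U) P" "x
      \<in> P" "P \<subseteq> V \<inter> U"
    using V U unfolding locally_path_connected_space by (metis IntI)
  then show "\<exists>P. openin euclidean P \<and> path_connectedin euclidean P \<and> x \<in> P \<and> P \<subseteq> V"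
    using W(1) by (auto simp: path_connectedin_subtopology openin_open_eq)
qed

text \<open>A cocycle of degree \<open>0\<close> takes the same value at both ends of a path, and a singular \<open>0\<close>-simplex is
  determined by its image point.\<close>

lemma coh_comp_0_scalar:
  fixes b :: "'x::topological_space cohomology"
  assumes "path_connected_space (euclidean :: 'x topology)"
  obtains c where "coh_comp 0 b = c *\<^sub>C 1"
proof -
  obtain a where a: "coboundary a = 0" and b: "b = abs_cohomology a"
    by (induction b rule: cohomology.abs_induct) (auto dest: cohomologous_cocycle)
  define pt :: "'x \<Rightarrow> (nat \<Rightarrow> real) \<Rightarrow> 'x" where "pt x = restrict (\<lambda>_. x) (standard_simplex 0)" for x
  have eq: "on_simplex a 0 (pt x) = on_simplex a 0 (pt y)" for x y
  proof -
    obtain g where g: "pathin euclidean g" "g 0 = x" "g 1 = y"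
      using assms unfolding path_connected_space_def by (metis UNIV_I topspace_euclidean)
    define \<tau> where "\<tau> = restrict (\<lambda>u :: nat \<Rightarrow> real. g (u 1)) (standard_simplex 1)"
    have "continuous_map (subtopology (powertop_real UNIV) (standard_simplex 1)) (top_of_set {0..1}) (\<lambda>u. u 1)"
      by (auto simp: continuous_map_in_subtopology standard_simplex_def
          intro: continuous_map_product_projection continuous_map_from_subtopology)
    then have "continuous_map (subtopology (powertop_real UNIV) (standard_simplex 1)) euclidean (g \<circ> (\<lambda>u. u 1))"
      using g(1) unfolding pathin_def by (rule continuous_map_compose)
    then have s: "simplex_in (Suc 0) \<tau>"
      by (simp add: singular_simplex_def \<tau>_def o_def)
    have f: "singular_face (Suc 0) 0 \<tau> = pt y" "singular_face (Suc 0) (Suc 0) \<tau> = pt x"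
      using g by (auto simp: singular_face_def \<tau>_def pt_def fun_eq_iff restrict_def simplical_face_def
          standard_simplex_def)
    have "raw_coboundary (on_simplex a) (Suc 0) \<tau> = 0"
      using a by (metis coboundary.rep_eq zero_cochain.rep_eq)
    then show ?thesis
      using s by (simp add: raw_coboundary_def f)
  qed
  define c where "c = on_simplex a 0 (pt undefined)"
  have "cochain_comp 0 a = cochain_scale c 1"
  proof (rule cochain_eqI)
    fix p and \<sigma> :: "(nat \<Rightarrow> real) \<Rightarrow> 'x"
    assume \<sigma>: "simplex_in p \<sigma>"
    show "on_simplex (cochain_comp 0 a) p \<sigma> = on_simplex (cochain_scale c 1) p \<sigma>"
    proof (cases "p = 0")
      case True
      have "\<sigma> = pt (\<sigma> (\<lambda>j. if j = 0 then 1 else 0))"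
      proof
        fix x :: "nat \<Rightarrow> real"
        show "\<sigma> x = pt (\<sigma> (\<lambda>j. if j = 0 then 1 else 0)) x"
          using \<sigma> True unfolding singular_simplex_def pt_def standard_simplex_0
          by (cases "x = (\<lambda>j. if j = 0 then 1
              else 0)") (simp_all add: standard_simplex_0 extensional_def)
      qed
      then have "on_simplex a 0 \<sigma> = c"
        unfolding c_def by (metis eq)
      then show ?thesis
        using True \<sigma> by (simp add: cochain_comp.rep_eq cochain_scale.rep_eq one_cochain.rep_eq)
    qed (simp add: cochain_comp.rep_eq cochain_scale.rep_eq one_cochain.rep_eq)
  qed
  then have "coh_comp 0 b = c *\<^sub>C 1"
    unfolding b one_cohomology_def
    using coh_comp.abs_eq [of a 0] coh_scale.abs_eq [of "1 :: 'x cochain" c] a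
    by (simp add: cohomologous_refl coboundary_one)
  then show thesis by (rule that)
qed

section \<open>Norms on finite-dimensional cohomology\<close>

context
  fixes N :: "'x::topological_space cohomology \<Rightarrow> real"
  assumes N: "coh_norm N"
begin

lemma coh_norm_eq_0: "N x = 0 \<longleftrightarrow> x = 0"
  and coh_norm_triangle: "N (x + y) \<le> N x + N y"
  and coh_norm_scale: "N (c *\<^sub>C x) = cmod c * N x"
  using N unfolding coh_norm_def by blast+

lemma coh_norm_minus: "N (- x) = N x"
  using coh_norm_scale [of "- 1" x] by simp

lemma coh_norm_nonneg: "N x \<ge> 0"
  using coh_norm_triangle [of x "- x"] coh_norm_eq_0 [of 0] by (simp add: coh_norm_minus)

lemma coh_norm_triangle_diff: "N (x - y) \<le> N x + N y"
  using coh_norm_triangle [of x "- y"] by (simp add: coh_norm_minus)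

lemma coh_norm_sum: "N (\<Sum>i\<in>I. f i) \<le> (\<Sum>i\<in>I. N (f i))"
proof (induction I rule: infinite_finite_induct)
  case (insert i I)
  then show ?case using coh_norm_triangle [of "f i" "sum f I"] by simp
qed (use coh_norm_eq_0 [of 0] in simp_all)

text \<open>On a finite-dimensional space every norm controls the coordinates.  In the induction step, a vector
  \<open>e\<close> outside the span of \<open>S\<close> has positive distance from it: otherwise the coordinates of a minimizing
  sequence in the span would be Cauchy by the induction hypothesis, and their limit would represent \<open>e\<close>.\<close>

lemma coh_norm_coordinates:
  assumes "finite S" "coh.independent S"
  shows "\<exists>C\<ge>0. \<forall>c. \<forall>b\<in>S. cmod (c b) \<le> C * N (\<Sum>b\<in>S. c b *\<^sub>C b)"
  using assms
proof (induction S)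
  case (insert e S)
  then have e: "e \<notin> coh.span S" and "coh.independent S"
    by (auto simp: coh.independent_insert split: if_splits)
  with insert obtain C where C: "C \<ge> 0" "\<And>c b. b \<in> S \<Longrightarrow> cmod (c b) \<le> C * N (\<Sum>b\<in>S. c b *\<^sub>C b)"
    by blast
  have "\<exists>\<delta>>0. \<forall>c. N (e - (\<Sum>b\<in>S. c b *\<^sub>C b)) \<ge> \<delta>"
  proof (rule ccontr)
    assume "\<not> ?thesis"
    then have "\<exists>c. N (e - (\<Sum>b\<in>S. c b *\<^sub>C b)) < inverse (real (Suc n))" for n
      by (metis inverse_positive_iff_positive not_le_imp_less of_nat_0_less_iff zero_less_Suc)
    then obtain c where c: "\<And>n. N (e - (\<Sum>b\<in>S. c n b *\<^sub>C b)) < inverse (real (Suc n))"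
      by metis
    have "convergent (\<lambda>n. c n b)" if b: "b \<in> S" for b
    proof -
      have cauchy: "cmod (c n b - c m b) \<le> C * (inverse (real (Suc n)) + inverse (real (Suc m)))"
          for n m
      proof -
        have "(\<Sum>b\<in>S. (c n b - c m b) *\<^sub>C b)
            = (e - (\<Sum>b\<in>S. c m b *\<^sub>C b)) - (e - (\<Sum>b\<in>S. c n b *\<^sub>C b))"
          by (simp add: coh.scale_left_diff_distrib sum_subtractf)
        then have "N (\<Sum>b\<in>S. (c n b - c m b) *\<^sub>C b) \<le> inverse (real (Suc n))
            + inverse (real (Suc m))"
          using coh_norm_triangle_diff [of "e - (\<Sum>b\<in>S. c m b *\<^sub>C b)" "e - (\<Sum>b\<in>S. c n b *\<^sub>C b)"] c
              [of n] c [of m]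
          by simp
        with C(2) [OF b, of "\<lambda>b. c n b - c m b"] C(1) show ?thesis
          by (meson mult_left_mono order_trans)
      qed
      have "Cauchy (\<lambda>n. c n b)"
      proof (rule CauchyI)
        fix d :: real assume d: "d > 0"
        have "(\<lambda>n. 2 * C * inverse (real (Suc n))) \<longlonglongrightarrow> 2 * C * 0"
          by (intro tendsto_mult tendsto_const LIMSEQ_inverse_real_of_nat)
        then have "eventually (\<lambda>n. 2 * C * inverse (real (Suc n)) < d) sequentially"
          using d by (intro order_tendstoD) auto
        then obtain M where M: "\<And>n. n \<ge> M \<Longrightarrow> 2 * C * inverse (real (Suc n)) < d"
          by (auto simp: eventually_sequentially)
        show "\<exists>M. \<forall>m\<ge>M. \<forall>n\<ge>M. norm (c m b - c n b) < d"
        proof (intro exI allI impI)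
          fix m n assume "m \<ge> M" "n \<ge> M"
          then show "norm (c m b - c n b) < d"
            using cauchy [of m n] M [of m] M [of n] by (simp add: distrib_left)
        qed
      qed
      then show ?thesis by (simp add: Cauchy_convergent_iff)
    qed
    then obtain l where l: "\<And>b. b \<in> S \<Longrightarrow> (\<lambda>n. c n b) \<longlonglongrightarrow> l b"
      unfolding convergent_def by metis
    have "N (e - (\<Sum>b\<in>S. l b *\<^sub>C b)) \<le> inverse (real (Suc n)) + (\<Sum>b\<in>S. cmod (c n b - l b) * N b)"
        for n
    proof -
      have eq: "e - (\<Sum>b\<in>S. l b *\<^sub>C b) = (e - (\<Sum>b\<in>S. c n b *\<^sub>C b)) + (\<Sum>b\<in>S. (c n b - l b) *\<^sub>C b)"
        by (simp add: coh.scale_left_diff_distrib sum_subtractf)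
      have "N (e - (\<Sum>b\<in>S. l b *\<^sub>C b)) \<le> N (e - (\<Sum>b\<in>S. c n b *\<^sub>C b)) + N (\<Sum>b\<in>S. (c n b - l b) *\<^sub>C b)"
        unfolding eq by (rule coh_norm_triangle)
      also have "\<dots> \<le> inverse (real (Suc n)) + (\<Sum>b\<in>S. N ((c n b - l b) *\<^sub>C b))"
        by (intro add_mono coh_norm_sum less_imp_le c)
      finally show ?thesis by (simp add: coh_norm_scale)
    qed
    moreover have "(\<lambda>n. inverse (real (Suc n)) + (\<Sum>b\<in>S. cmod (c n b - l b) * N b)) \<longlonglongrightarrow> 0
        + (\<Sum>b\<in>S. cmod (l b - l b) * N b)"
      by (intro tendsto_add LIMSEQ_inverse_real_of_nat tendsto_sum tendsto_mult tendsto_norm tendsto_diff l tendsto_const)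
    ultimately have "N (e - (\<Sum>b\<in>S. l b *\<^sub>C b)) \<le> 0"
      by (intro tendsto_le [OF _ _ tendsto_const]) (auto simp del: of_nat_Suc)
    then have "e = (\<Sum>b\<in>S. l b *\<^sub>C b)"
      using coh_norm_nonneg [of "e - (\<Sum>b\<in>S. l b *\<^sub>C b)"] coh_norm_eq_0 [of "e - (\<Sum>b\<in>S. l b *\<^sub>C b)"]
      by simp
    moreover have "(\<Sum>b\<in>S. l b *\<^sub>C b) \<in> coh.span S"
      by (intro coh.span_sum coh.span_scale coh.span_base)
    ultimately show False
      using e by simp
  qed
  then obtain \<delta> where \<delta>: "\<delta> > 0" "\<And>c. N (e - (\<Sum>b\<in>S. c b *\<^sub>C b)) \<ge> \<delta>" by blast
  show ?case
  proof (intro exI [of _ "1 / \<delta> + C * (1 + N e / \<delta>)"] conjI allI ballI)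
    show "1 / \<delta> + C * (1 + N e / \<delta>) \<ge> 0"
      using \<delta> C coh_norm_nonneg [of e] by simp
    fix c b assume b: "b \<in> insert e S"
    define w where "w = (\<Sum>b\<in>S. c b *\<^sub>C b)"
    have v: "(\<Sum>b\<in>insert e S. c b *\<^sub>C b) = c e *\<^sub>C e + w"
      using insert by (simp add: w_def)
    have ce: "cmod (c e) \<le> N (c e *\<^sub>C e + w) / \<delta>"
    proof (cases "c e = 0")
      case False
      then have "c e *\<^sub>C e + w = c e *\<^sub>C (e - (\<Sum>b\<in>S. (- c b / c e) *\<^sub>C b))"
        by (simp add: w_def coh.scale_right_diff_distrib coh.scale_right_distrib coh.scale_sum_right sum_negf)
      then have "N (c e *\<^sub>C e + w) \<ge> cmod (c e) * \<delta>"
        using \<delta>(2) [of "\<lambda>b. - c b / c e"] by (simp add: coh_norm_scale mult_left_mono)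
      with \<delta> show ?thesis by (simp add: field_simps)
    qed (use \<delta> coh_norm_nonneg in simp)
    have "N w \<le> N (c e *\<^sub>C e + w) + cmod (c e) * N e"
      using coh_norm_triangle_diff [of "c e *\<^sub>C e + w" "c e *\<^sub>C e"] by (simp add: coh_norm_scale)
    also have "\<dots> \<le> N (c e *\<^sub>C e + w) + N (c e *\<^sub>C e + w) / \<delta> * N e"
      by (intro add_left_mono mult_right_mono ce coh_norm_nonneg)
    finally have w: "N w \<le> (1 + N e / \<delta>) * N (c e *\<^sub>C e + w)"
      by (simp add: field_simps)
    have nn: "0 \<le> C * (1 + N e / \<delta>) * N (c e *\<^sub>C e + w)" "0 \<le> N (c e *\<^sub>C e + w) / \<delta>"
      using C \<delta> coh_norm_nonneg by simp_all
    show "cmod (c b) \<le> (1 / \<delta> + C * (1 + N e / \<delta>)) * N (\<Sum>b\<in>insert e S. c b *\<^sub>C b)"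
    proof (cases "b = e")
      case True
      then show ?thesis using ce nn unfolding v by (simp add: distrib_right)
    next
      case False
      with b have "cmod (c b) \<le> C * N w" unfolding w_def by (intro C) auto
      also have "\<dots> \<le> C * ((1 + N e / \<delta>) * N (c e *\<^sub>C e + w))"
        using w C by (intro mult_left_mono)
      finally show ?thesis using nn unfolding v by (simp add: distrib_right mult.assoc)
    qed
  qed
qed (auto intro: exI [of _ 0])

lemma coh_linear_bounded:
  fixes f :: "'x cohomology \<Rightarrow> 'x cohomology" and S :: "'x cohomology set"
  assumes S: "finite S" "coh.span S = UNIV"
    and f: "\<And>x y. f (x + y) = f x + f y" "\<And>c x. f (c *\<^sub>C x) = c *\<^sub>C f x"
  shows "\<exists>C\<ge>0. \<forall>x. N (f x) \<le> C * N x"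
proof -
  obtain B where B: "B \<subseteq> S" "coh.independent B" "coh.span B = coh.span S"
    using coh.maximal_independent_subset [of S] coh.span_mono coh.span_superset coh.span_span
    by (metis coh.span_eq subset_trans)
  have fin: "finite B" using B S finite_subset by blast
  obtain C where C: "C \<ge> 0" "\<And>c b. b \<in> B \<Longrightarrow> cmod (c b) \<le> C * N (\<Sum>b\<in>B. c b *\<^sub>C b)"
    using coh_norm_coordinates [OF fin B(2)] by blast
  have f0: "f 0 = 0" using f(2) [of 0 0] by simp
  have fsum: "f (\<Sum>i\<in>I. g i) = (\<Sum>i\<in>I. f (g i))" for I :: "'x cohomology set" and g
    by (induction I rule: infinite_finite_induct) (simp_all add: f f0)
  have "N (f x) \<le> (C * (\<Sum>b\<in>B. N (f b))) * N x" for x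
  proof -
    define c where "c = coh.representation B x"
    have x: "x = (\<Sum>b\<in>B. c b *\<^sub>C b)"
      unfolding c_def using B S fin by (intro coh.sum_representation_eq [symmetric]) auto
    have "N (f x) \<le> (\<Sum>b\<in>B. N (c b *\<^sub>C f b))"
      unfolding x fsum f(2) by (rule coh_norm_sum)
    also have "\<dots> \<le> (\<Sum>b\<in>B. C * N x * N (f b))"
      unfolding coh_norm_scale using C(2) [of _ c]
      by (intro sum_mono mult_right_mono coh_norm_nonneg) (simp flip: x)
    finally show ?thesis by (simp add: sum_distrib_left sum_distrib_right mult_ac)
  qed
  moreover have "C * (\<Sum>b\<in>B. N (f b)) \<ge> 0"
    using C by (simp add: sum_nonneg coh_norm_nonneg)
  ultimately show ?thesis by blast
qed

lemma coh_sums_unique: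
  assumes "coh_sums N f s" "coh_sums N f t"
  shows "s = t"
proof -
  have "N (s - t) \<le> N ((\<Sum>m<n. f m) - t) + N ((\<Sum>m<n. f m) - s)" for n
    using coh_norm_triangle_diff [of "(\<Sum>m<n. f m) - t" "(\<Sum>m<n. f m) - s"] by simp
  moreover have "(\<lambda>n. N ((\<Sum>m<n. f m) - t) + N ((\<Sum>m<n. f m) - s)) \<longlonglongrightarrow> 0 + 0"
    using assms unfolding coh_sums_def by (intro tendsto_add)
  ultimately have "N (s - t) \<le> 0"
    by (intro tendsto_le [OF _ _ tendsto_const]) auto
  then show ?thesis
    using coh_norm_nonneg [of "s - t"] coh_norm_eq_0 [of "s - t"] by simp
qed

lemma coh_series_eqI:
  assumes "coh_sums N (coh_series_term r \<alpha> \<beta> R \<phi>) s"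
  shows "coh_series N r \<alpha> \<beta> R \<phi> = s"
  unfolding coh_series_def using assms coh_sums_unique by blast

end

section \<open>Taylor polynomials in the nilpotent part\<close>

text \<open>The Taylor polynomial of \<open>f\<close> at \<open>z\<close>, evaluated at \<open>z + \<nu>\<close>.  It is used with \<open>\<nu>\<^sup>K = 0\<close>, in which case
  it is the whole Taylor series.\<close>

definition jet :: "nat \<Rightarrow> complex \<Rightarrow> 'x::topological_space cohomology \<Rightarrow> (complex \<Rightarrow> complex) \<Rightarrow> 'x cohomology" where
  "jet K z \<nu> f = (\<Sum>k<K. ((deriv ^^ k) f z / fact k) *\<^sub>C \<nu> ^ k)"

text \<open>By the Leibniz rule, since the products of order \<open>K\<close> and above vanish.  This is the multiplicativity
  of the functional calculus for the class \<open>z + \<nu>\<close>.\<close>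

lemma jet_mult:
  assumes f: "f holomorphic_on UNIV" and g: "g holomorphic_on UNIV" and \<nu>: "\<nu> ^ K = 0"
  shows "jet K z \<nu> (\<lambda>w. f w * g w) = jet K z \<nu> f * jet K z \<nu> g"
proof -
  define c where "c k = (deriv ^^ k) f z / fact k" for k
  define d where "d k = (deriv ^^ k) g z / fact k" for k
  have \<nu>': "\<nu> ^ k = 0" if "k \<ge> K" for k
    using \<nu> that by (metis le_Suc_ex mult_zero_left power_add)
  have "jet K z \<nu> (\<lambda>w. f w * g w) = (\<Sum>k<K. \<Sum>i\<le>k. (c i * d (k - i)) *\<^sub>C \<nu> ^ (i + (k - i)))"
    unfolding jet_def
  proof (rule sum.cong [OF refl])
    fix k
    have "(deriv ^^ k) (\<lambda>w. f w * g w) z / fact k = (\<Sum>i\<le>k. c i * d (k - i))"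
      using higher_deriv_mult [OF f g open_UNIV UNIV_I, of k z]
      by (simp add: sum_divide_distrib c_def d_def atLeast0AtMost binomial_fact field_simps)
    then show "((deriv ^^ k) (\<lambda>w. f w * g w) z / fact k) *\<^sub>C \<nu> ^ k
       = (\<Sum>i\<le>k. (c i * d (k - i)) *\<^sub>C \<nu> ^ (i + (k - i)))"
      by (simp add: coh.scale_sum_left)
  qed
  also have "\<dots> = (\<Sum>(i, j)\<in>{(i, j). i + j < K}. (c i * d j) *\<^sub>C \<nu> ^ (i + j))"
    by (rule sum.triangle_reindex [symmetric])
  also have "\<dots> = (\<Sum>(i, j)\<in>{..<K} \<times> {..<K}. (c i * d j) *\<^sub>C \<nu> ^ (i + j))"
  proof (rule sum.mono_neutral_left)
    show "\<forall>ij\<in>{..<K} \<times> {..<K} - {(i, j). i + j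
        < K}. (case ij of (i, j) \<Rightarrow> (c i * d j) *\<^sub>C \<nu> ^ (i + j)) = 0"
    proof -
      have "k < K" if "\<nu> ^ k \<noteq> 0" for k
        using \<nu>' that not_less by blast
      then show ?thesis by auto
    qed
  qed auto
  also have "\<dots> = (\<Sum>i<K. \<Sum>j<K. (c i *\<^sub>C \<nu> ^ i) * (d j *\<^sub>C \<nu> ^ j))"
    by (simp add: sum.cartesian_product power_add mult_ac)
  also have "\<dots> = jet K z \<nu> f * jet K z \<nu> g"
    by (simp add: jet_def c_def d_def sum_product)
  finally show ?thesis .
qed

lemma jet_cmult:
  assumes "f holomorphic_on UNIV"
  shows "jet K z \<nu> (\<lambda>w. c * f w) = c *\<^sub>C jet K z \<nu> f"
proof -
  have "(deriv ^^ k) (\<lambda>w. c * f w) z = c * (deriv ^^ k) f z" for k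
    using higher_deriv_cmult [OF assms UNIV_I open_UNIV, of k c z] by simp
  then show ?thesis by (simp add: jet_def coh.scale_sum_right)
qed

lemma jet_central:
  assumes "\<And>v. \<nu> * v = v * \<nu>"
  shows "jet K z \<nu> f * v = v * jet K z \<nu> f"
proof -
  have "\<nu> ^ k * v = v * \<nu> ^ k" for k
    by (induction k) (simp_all add: mult.assoc, metis assms mult.assoc)
  then show ?thesis by (simp add: jet_def sum_distrib_left sum_distrib_right)
qed

lemma coh_fun_eq_jet:
  assumes "nilpotent_part b ^ K = 0"
  shows "coh_fun f b = jet K (scalar_part b) (nilpotent_part b) f"
proof -
  have "nilpotent_part b ^ k = 0" if "k \<ge> K" for k
    using assms that by (metis le_Suc_ex mult_zero_left power_add)
  then have "{k. nilpotent_part b ^ k \<noteq> 0} \<subseteq> {..<K}"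
    using not_less by auto
  then show ?thesis
    unfolding coh_fun_def jet_def by (intro sum.mono_neutral_left) auto
qed

lemma scalar_part_eqI: "coh_comp 0 b = c *\<^sub>C 1 \<Longrightarrow> scalar_part b = c"
  unfolding scalar_part_def by (intro the_equality) auto

lemma of_nat_eq_scale: "of_nat s = of_nat s *\<^sub>C (1 :: 'x::topological_space cohomology)"
  by (induction s) (simp_all add: coh.scale_left_distrib)

lemma coh_comp_of_nat: "coh_comp p (of_nat s) = (if p = 0 then of_nat s else 0)"
  by (subst (1 2) of_nat_eq_scale) (simp add: coh_comp_scale coh_comp_one)

lemma nilpotent_part_shift: "nilpotent_part (of_nat s + b) = nilpotent_part b"
  by (simp add: nilpotent_part_def coh_comp_add coh_comp_of_nat)

lemma nilpotent_part_scale: "nilpotent_part (c *\<^sub>C b) = c *\<^sub>C nilpotent_part b"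
  by (simp add: nilpotent_part_def coh_comp_scale coh.scale_right_diff_distrib)

lemma coh_scale_power: "(c *\<^sub>C b) ^ k = (c ^ k) *\<^sub>C b ^ k"
  by (induction k) simp_all

lemma deriv_shift: "deriv (\<lambda>w. f (a + w)) z = deriv f (a + z)"
  unfolding deriv_def using DERIV_shift [of f _ z a] by (simp add: add.commute)

lemma higher_deriv_shift: "(deriv ^^ k) (\<lambda>w. f (a + w)) z = (deriv ^^ k) f (a + z)"
proof (induction k arbitrary: z)
  case (Suc k)
  then have "(deriv ^^ k) (\<lambda>w. f (a + w)) = (\<lambda>w. (deriv ^^ k) f (a + w))" by auto
  then show ?case by (simp add: deriv_shift)
qed simp

lemma higher_deriv_exp: "(deriv ^^ k) exp (z :: complex) = exp z"
proof -
  have "deriv exp = (exp :: complex \<Rightarrow> complex)"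
    by (intro ext DERIV_imp_deriv DERIV_exp)
  then have "(deriv ^^ k) exp = (exp :: complex \<Rightarrow> complex)"
    by (induction k) simp_all
  then show ?thesis by simp
qed

lemma higher_deriv_exp_linear: "(deriv ^^ k) (\<lambda>w. exp (c * (a + w))) z
    = c ^ k * exp (c * (a + z :: complex))"
proof (induction k arbitrary: z)
  case (Suc k)
  then have "(deriv ^^ k) (\<lambda>w. exp (c * (a + w))) = (\<lambda>w. c ^ k * exp (c * (a + w)))" by auto
  then show ?case
    by (auto intro!: DERIV_imp_deriv derivative_eq_intros)
qed simp

lemma coh_exp_eq_jet:
  assumes sc: "coh_comp 0 b = scalar_part b *\<^sub>C 1" and K: "nilpotent_part b ^ K = 0"
  shows "coh_exp (c *\<^sub>C (of_nat s + b))
      = jet K (scalar_part b) (nilpotent_part b) (\<lambda>w. exp (c * (of_nat s + w)))"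
proof -
  have n: "nilpotent_part (c *\<^sub>C (of_nat s + b)) = c *\<^sub>C nilpotent_part b"
    by (simp add: nilpotent_part_scale nilpotent_part_shift)
  have "coh_comp 0 (c *\<^sub>C (of_nat s + b)) = (c * (of_nat s + scalar_part b)) *\<^sub>C 1"
    by (subst of_nat_eq_scale)
       (simp add: coh_comp_scale coh_comp_add coh_comp_one sc coh.scale_right_distrib distrib_left coh.scale_left_distrib)
  then have s: "scalar_part (c *\<^sub>C (of_nat s + b)) = c * (of_nat s + scalar_part b)"
    by (rule scalar_part_eqI)
  have "coh_exp (c *\<^sub>C (of_nat s + b))
      = jet K (c * (of_nat s + scalar_part b)) (c *\<^sub>C nilpotent_part b) exp"
    using coh_fun_eq_jet [of "c *\<^sub>C (of_nat s + b)" K exp] K unfolding n s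
    by (simp add: coh_scale_power)
  then show ?thesis
    by (simp add: jet_def higher_deriv_exp higher_deriv_exp_linear coh_scale_power mult_ac)
qed

lemma coh_rGamma_eq_jet:
  assumes sc: "coh_comp 0 b = scalar_part b *\<^sub>C 1" and K: "nilpotent_part b ^ K = 0"
  shows "coh_fun rGamma (1 + (of_nat s + b))
      = jet K (scalar_part b) (nilpotent_part b) (\<lambda>w. rGamma (1 + (of_nat s + w)))"
proof -
  have b: "1 + (of_nat s + b) = of_nat (Suc s) + b" by (simp add: add.assoc)
  have "coh_comp 0 (of_nat (Suc s) + b) = (of_nat (Suc s) + scalar_part b) *\<^sub>C 1"
    by (subst of_nat_eq_scale) (simp add: coh_comp_scale coh_comp_add coh_comp_one sc coh.scale_left_distrib del: of_nat_Suc)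
  then have s: "scalar_part (of_nat (Suc s) + b) = of_nat (Suc s) + scalar_part b"
    by (rule scalar_part_eqI)
  have "(\<lambda>w. rGamma (1 + (of_nat s + w))) = (\<lambda>w :: complex. rGamma (of_nat (Suc s) + w))"
    by (simp add: add.assoc)
  then show ?thesis
    unfolding b using coh_fun_eq_jet [of "of_nat (Suc s) + b" K rGamma] K
    unfolding nilpotent_part_shift s
    by (simp add: jet_def higher_deriv_shift del: of_nat_Suc)
qed

section \<open>The exponential series with shifted exponents\<close>

definition exp_term :: "real \<Rightarrow> nat \<Rightarrow> complex \<Rightarrow> complex" where
  "exp_term x s w = complex_of_real x powr (of_nat s + w) * rGamma (1 + (of_nat s + w))"

lemma norm_pochhammer_ge:
  assumes "Re z \<ge> 0"
  shows "pochhammer (Re z) s \<le> cmod (pochhammer z s)"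
proof (induction s)
  case (Suc s)
  have "Re z + real s \<le> cmod (z + of_nat s)"
    using complex_Re_le_cmod [of "z + of_nat s"] by simp
  then show ?case
    unfolding pochhammer_Suc norm_mult using Suc assms by (intro mult_mono) auto
qed simp

text \<open>From \<open>\<Gamma>(1 + s + w) = \<Gamma>(1 + w) (1 + w) \<cdots> (s + w)\<close>, where the \<open>j\<close>-th factor has modulus at least \<open>j\<close>.\<close>

lemma norm_rGamma_shift_le:
  assumes "Re w \<ge> 0"
  shows "cmod (rGamma (1 + (of_nat s + w))) \<le> cmod (rGamma (1 + w)) / fact s"
proof -
  have "fact s = pochhammer (1::real) s" by (simp add: pochhammer_fact)
  also have "\<dots> \<le> pochhammer (Re (1 + w)) s"
    using assms by (simp add: pochhammer_prod, intro prod_mono) auto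
  also have "\<dots> \<le> cmod (pochhammer (1 + w) s)"
    using assms by (intro norm_pochhammer_ge) simp
  finally have p: "fact s \<le> cmod (pochhammer (1 + w) s)" .
  have "cmod (rGamma (1 + w)) = cmod (pochhammer (1 + w) s) * cmod (rGamma (1 + (of_nat s + w)))"
    by (subst pochhammer_rGamma [of _ s]) (simp add: norm_mult add_ac)
  also have "\<dots> \<ge> fact s * cmod (rGamma (1 + (of_nat s + w)))"
    using p by (intro mult_right_mono) auto
  finally show ?thesis by (simp add: field_simps)
qed

lemma norm_exp_term_le:
  assumes "Re w \<ge> 0" "x > 0"
  shows "cmod (exp_term x s w) \<le> x powr Re w * cmod (rGamma (1 + w)) * (x ^ s / fact s)"
proof -
  have "cmod (exp_term x s w) = x powr (real s + Re w) * cmod (rGamma (1 + (of_nat s + w)))"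
    using assms by (simp add: exp_term_def norm_mult norm_powr_real_powr)
  also have "\<dots> \<le> x powr (real s + Re w) * (cmod (rGamma (1 + w)) / fact s)"
    by (intro mult_left_mono norm_rGamma_shift_le assms) auto
  also have "x powr (real s + Re w) = x ^ s * x powr Re w"
    using assms by (simp add: powr_add powr_realpow)
  finally show ?thesis by (simp add: mult_ac)
qed

lemma summable_exp_term_abs:
  assumes "Re w \<ge> 0" "x > 0"
  shows "summable (\<lambda>s. cmod (exp_term x s w))"
proof (rule summable_comparison_test)
  show "\<exists>N. \<forall>s\<ge>N. norm (cmod (exp_term x s w))
      \<le> x powr Re w * cmod (rGamma (1 + w)) * (x ^ s / fact s)"
    using norm_exp_term_le [OF assms] by simp
  show "summable (\<lambda>s. x powr Re w * cmod (rGamma (1 + w)) * (x ^ s / fact s))"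
    using summable_exp [of x] by (intro summable_mult) (simp add: divide_inverse mult.commute)
qed

definition shifted_exp :: "complex \<Rightarrow> real \<Rightarrow> complex \<Rightarrow> complex" where
  "shifted_exp \<zeta> x w = (suminf (\<lambda>s. \<zeta> ^ s * exp_term x s w))"

lemma shifted_exp_sums:
  assumes "Re w \<ge> 0" "x > 0" "cmod \<zeta> = 1"
  shows "(\<lambda>s. \<zeta> ^ s * exp_term x s w) sums shifted_exp \<zeta> x w"
  unfolding shifted_exp_def
  using summable_exp_term_abs [OF assms(1,2)] assms(3)
  by (intro summable_sums summable_norm_cancel [of "\<lambda>s. \<zeta> ^ s * exp_term x s w"])
     (simp add: norm_mult norm_power)

text \<open>The function \<open>e\<^bsup>-\<zeta>t\<^esup>\<close> times \<open>shifted_exp\<close>.  Splitting off \<open>t\<^sup>w\<close> leaves a power series, and the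
  definition remains meaningful at \<open>t = 0\<close>, where the value is \<open>0\<close>.\<close>

definition damped :: "complex \<Rightarrow> complex \<Rightarrow> real \<Rightarrow> complex" where
  "damped \<zeta> w t = exp (- \<zeta> * of_real t)
      * (of_real t powr w * (suminf (\<lambda>s. (\<zeta> ^ s * rGamma (1 + (of_nat s + w))) * of_real t ^ s)))"

lemma summable_damped:
  assumes "Re w \<ge> 0" "cmod \<zeta> = 1"
  shows "summable (\<lambda>s. (\<zeta> ^ s * rGamma (1 + (of_nat s + w))) * y ^ s)"
proof (rule summable_comparison_test)
  show "\<exists>N. \<forall>s\<ge>N. cmod ((\<zeta> ^ s * rGamma (1 + (of_nat s + w))) * y ^ s)
      \<le> cmod (rGamma (1 + w)) * (cmod y ^ s / fact s)"
    using mult_right_mono [OF norm_rGamma_shift_le [OF assms(1)], of "cmod y ^ s" for s] assms(2)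
    by (auto simp: norm_mult norm_power)
  show "summable (\<lambda>s. cmod (rGamma (1 + w)) * (cmod y ^ s / fact s))"
    using summable_exp [of "cmod y"]
    by (intro summable_mult) (simp add: divide_inverse mult.commute)
qed

lemma damped_eq:
  assumes "Re w \<ge> 0" "cmod \<zeta> = 1" "t > 0"
  shows "damped \<zeta> w t = exp (- \<zeta> * of_real t) * shifted_exp \<zeta> t w"
proof -
  have "complex_of_real t powr w
      * (suminf (\<lambda>s. (\<zeta> ^ s * rGamma (1 + (of_nat s + w))) * of_real t ^ s))
      = (suminf (\<lambda>s. of_real t powr w * ((\<zeta> ^ s * rGamma (1 + (of_nat s + w))) * of_real t ^ s)))"
    by (rule suminf_mult [symmetric, OF summable_damped [OF assms(1,2)]])
  also have "\<dots> = shifted_exp \<zeta> t w"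
    unfolding shifted_exp_def exp_term_def using assms by (simp add: powr_add mult_ac)
  finally show ?thesis by (simp add: damped_def)
qed

lemma continuous_on_damped:
  assumes "Re w > 0" "cmod \<zeta> = 1"
  shows "continuous_on {0..b} (damped \<zeta> w)"
proof -
  have "isCont (\<lambda>y. suminf (\<lambda>s. (\<zeta> ^ s * rGamma (1 + (of_nat s + w))) * y ^ s)) y" for y
    using termdiffs_strong_converges_everywhere [OF summable_damped] assms
    by (intro DERIV_isCont) (auto intro!: less_imp_le)
  then have "continuous_on UNIV (\<lambda>y. suminf (\<lambda>s. (\<zeta> ^ s * rGamma (1 + (of_nat s + w))) * y ^ s))"
    by (simp add: continuous_at_imp_continuous_on)
  then have "continuous_on {0..b} (\<lambda>t. suminf (\<lambda>s. (\<zeta> ^ s * rGamma (1 + (of_nat s + w)))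
      * complex_of_real t ^ s))"
    by (rule continuous_on_compose2) (auto intro: continuous_intros)
  then show ?thesis
    unfolding damped_def [abs_def] using assms
    by (intro continuous_intros) auto
qed

text \<open>Term by term, the recursion \<open>(s + w) / \<Gamma>(1 + s + w) = 1 / \<Gamma>(s + w)\<close> shows that \<open>shifted_exp\<close> solves
  \<open>F' = \<zeta>F + t\<^bsup>w - 1\<^esup> / \<Gamma>(w)\<close>; the damping removes the homogeneous part.\<close>

lemma damped_derivative:
  assumes "Re w > 0" "cmod \<zeta> = 1" "t > 0"
  shows "(damped \<zeta> w has_vector_derivative exp (- \<zeta> * of_real t)
      * (of_real t powr (w - 1) * rGamma w)) (at t)"
proof -
  define c where "c s = \<zeta> ^ s * rGamma (1 + (of_nat s + w))" for s
  define P where "P y = (suminf (\<lambda>s. c s * y ^ s))" for y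
  define P' where "P' y = (suminf (\<lambda>s. diffs c s * y ^ s))" for y
  have sm: "summable (\<lambda>s. c s * y ^ s)" for y
    unfolding c_def using assms by (intro summable_damped) auto
  have P: "(P has_field_derivative P' y) (at y)" for y
    unfolding P_def [abs_def] P'_def by (rule termdiffs_strong_converges_everywhere [OF sm])
  let ?t = "complex_of_real t"
  have rec: "w * P ?t + ?t * P' ?t = rGamma w + \<zeta> * ?t * P ?t"
  proof -
    have d: "summable (\<lambda>s. diffs c s * y ^ s)" for y
      by (rule termdiff_converges_all [OF sm])
    have "(\<lambda>s. of_nat s * c s * ?t ^ s) sums (?t * P' ?t)"
    proof -
      have "(\<lambda>s. ?t * (diffs c s * ?t ^ s)) sums (?t * P' ?t)"
        unfolding P'_def by (intro sums_mult summable_sums d)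
      then have "(\<lambda>s. of_nat (Suc s) * c (Suc s) * ?t ^ Suc s) sums (?t * P' ?t)"
        by (simp add: diffs_def mult_ac)
      then show ?thesis
        using sums_Suc [of "\<lambda>s. of_nat s * c s * ?t ^ s"] by simp
    qed
    moreover have "(\<lambda>s. w * (c s * ?t ^ s)) sums (w * P ?t)"
      unfolding P_def by (intro sums_mult summable_sums sm)
    ultimately have "(\<lambda>s. w * (c s * ?t ^ s) + of_nat s * c s * ?t ^ s)
        sums (w * P ?t + ?t * P' ?t)"
      by (intro sums_add)
    moreover have "w * (c s * ?t ^ s) + of_nat s * c s * ?t ^ s
        = \<zeta> ^ s * rGamma (of_nat s + w) * ?t ^ s" for s
    proof -
      have "w * (c s * ?t ^ s) + of_nat s * c s * ?t ^ s
          = \<zeta> ^ s * ((of_nat s + w) * rGamma (of_nat s + w + 1)) * ?t ^ s"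
        unfolding c_def by (simp add: algebra_simps)
      then show ?thesis by (simp only: rGamma_plus1)
    qed
    ultimately have "(\<lambda>s. \<zeta> ^ s * rGamma (of_nat s + w) * ?t ^ s) sums (w * P ?t + ?t * P' ?t)"
      by simp
    moreover have "(\<lambda>s. \<zeta> ^ s * rGamma (of_nat s + w) * ?t ^ s) sums (\<zeta> * ?t * P ?t + rGamma w)"
    proof -
      have "(\<lambda>s. \<zeta> * ?t * (c s * ?t ^ s)) sums (\<zeta> * ?t * P ?t)"
        unfolding P_def by (intro sums_mult summable_sums sm)
      then have "(\<lambda>s. \<zeta> ^ Suc s * rGamma (of_nat (Suc s) + w) * ?t ^ Suc s) sums (\<zeta> * ?t * P ?t)"
        by (simp add: c_def mult_ac add_ac)
      then show ?thesis
        using sums_Suc [of "\<lambda>s. \<zeta> ^ s * rGamma (of_nat s + w) * ?t ^ s"] by simp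
    qed
    ultimately have "w * P ?t + ?t * P' ?t = \<zeta> * ?t * P ?t + rGamma w"
      by (rule sums_unique2)
    then show ?thesis by (simp only: add.commute)
  qed
  have "((\<lambda>y. exp (- \<zeta> * y) * (y powr w * P y)) has_field_derivative
      (exp (- \<zeta> * ?t) * ((w * ?t powr (w - 1)) * P ?t + ?t powr w * P' ?t)
          - \<zeta> * exp (- \<zeta> * ?t) * (?t powr w * P ?t))) (at ?t)"
    using assms by (auto intro!: derivative_eq_intros P has_field_derivative_powr
        simp: algebra_simps)
  also have "exp (- \<zeta> * ?t) * ((w * ?t powr (w - 1)) * P ?t + ?t powr w * P' ?t)
      - \<zeta> * exp (- \<zeta> * ?t) * (?t powr w * P ?t)
     = exp (- \<zeta> * ?t) * (?t powr (w - 1) * rGamma w)"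
  proof -
    have "?t powr w = ?t powr (w - 1) * ?t"
      using assms powr_add [of ?t "w - 1" 1] by simp
    then have "exp (- \<zeta> * ?t) * ((w * ?t powr (w - 1)) * P ?t + ?t powr w * P' ?t)
        - \<zeta> * exp (- \<zeta> * ?t) * (?t powr w * P ?t)
      = exp (- \<zeta> * ?t) * ?t powr (w - 1) * ((w * P ?t + ?t * P' ?t) - \<zeta> * ?t * P ?t)"
      by (simp add: algebra_simps)
    then show ?thesis by (simp add: rec)
  qed
  finally have "((\<lambda>t. exp (- \<zeta> * of_real t)
      * (of_real t powr w * P (of_real t))) has_vector_derivative
     exp (- \<zeta> * ?t) * (?t powr (w - 1) * rGamma w)) (at t)"
    by (rule has_vector_derivative_real_field)
  then show ?thesis
    by (simp add: damped_def [abs_def] P_def c_def)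
qed

lemma damped_0 [simp]: "damped \<zeta> w 0 = 0"
  by (simp add: damped_def)

text \<open>The derivative integrates to Euler's integral for \<open>\<Gamma>(w)\<close>, divided by \<open>\<Gamma>(w)\<close>.\<close>

lemma damped_tendsto_1:
  assumes "Re w > 0"
  shows "(damped 1 w \<longlongrightarrow> 1) at_top"
proof -
  define f where "f t = complex_of_real t powr (w - 1) / of_real (exp t)" for t
  have G: "(f has_integral Gamma w) {0..}"
    unfolding f_def [abs_def] by (rule Gamma_integral_complex [OF assms])
  have nz: "Gamma w \<noteq> 0" using assms by (auto simp: Gamma_eq_zero_iff elim!: nonpos_Ints_cases)
  have D: "damped 1 w b = rGamma w * integral {0..b} f" if "b > 0" for b
  proof -
    have "((\<lambda>t. exp (- 1 * of_real t)
        * (of_real t powr (w - 1) * rGamma w)) has_integral damped 1 w b - damped 1 w 0) {0..b}"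
      using assms that by (intro fundamental_theorem_of_calculus_interior continuous_on_damped damped_derivative) auto
    then have "((\<lambda>t. rGamma w * f t) has_integral damped 1 w b) {0..b}"
      by (simp add: f_def exp_minus exp_of_real field_simps)
    moreover have "f integrable_on {0..b}"
      using G by (meson atLeastAtMost_iff atLeast_iff has_integral_integrable integrable_on_subinterval subsetI)
    ultimately show ?thesis
      by (metis has_integral_integral has_integral_mult_right has_integral_unique)
  qed
  have "((\<lambda>b. integral {0..b} f) \<longlongrightarrow> Gamma w) at_top"
  proof (rule tendstoI)
    fix e :: real assume "e > 0"
    then obtain B where B: "B > 0" "\<And>a b. ball 0 B \<subseteq> cbox a b \<Longrightarrow>
        cmod (integral (cbox a b) (\<lambda>x. if x \<in> {0..} then f x else 0) - Gamma w) < e"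
      using G unfolding has_integral_alt' [of f] by blast
    show "eventually (\<lambda>b. dist (integral {0..b} f) (Gamma w) < e) at_top"
      using eventually_ge_at_top [of B]
    proof eventually_elim
      case (elim b)
      have ball: "ball 0 B \<subseteq> cbox (- B) b"
        using elim by (auto simp: dist_real_def)
      have int: "{0..} \<inter> cbox (- B) b = {0..b}" using B by auto
      have "integral (cbox (- B) b) (\<lambda>x. if x \<in> {0..} then f x else 0) = integral {0..b} f"
        unfolding int [symmetric] by (rule Henstock_Kurzweil_Integration.integral_restrict_Int)
      then show ?case
        using B(2) [OF ball] by (simp only: dist_norm)
    qed
  qed
  then have "((\<lambda>b. rGamma w * integral {0..b} f) \<longlongrightarrow> rGamma w * Gamma w) at_top"
    by (intro tendsto_intros)
  moreover have "rGamma w * Gamma w = 1"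
    using nz by (simp add: rGamma_inverse_Gamma)
  moreover have "eventually (\<lambda>b. rGamma w * integral {0..b} f = damped 1 w b) at_top"
    using eventually_gt_at_top [of 0] by eventually_elim (simp add: D)
  ultimately show ?thesis
    using Lim_transform_eventually [of "\<lambda>b. rGamma w * integral {0..b} f" 1 at_top "damped 1 w"]
    by simp
qed

lemma power_le_exp:
  assumes "\<delta> > (0::real)"
  shows "\<exists>C>0. \<forall>t\<ge>0. 1 + t ^ n \<le> C * exp (\<delta> * t)"
proof (intro exI [of _ "1 + fact n / \<delta> ^ n"] conjI allI impI)
  fix t :: real assume t: "t \<ge> 0"
  have "(\<delta> * t) ^ n / fact n \<le> exp (\<delta> * t)"
  proof -
    have "(\<lambda>k. (\<delta> * t) ^ k /\<^sub>R fact k) sums exp (\<delta> * t)" by (rule exp_converges)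
    then have "sum (\<lambda>k. (\<delta> * t) ^ k /\<^sub>R fact k) {n} \<le> exp (\<delta> * t)"
      using assms t by (metis (no_types, lifting) finite.emptyI finite_insert sum_le_suminf sums_iff
          mult_nonneg_nonneg less_imp_le zero_le_power inverse_nonnegative_iff_nonnegative fact_ge_zero scaleR_nonneg_nonneg)
    then show ?thesis by (simp add: divide_inverse mult.commute)
  qed
  then have "t ^ n \<le> fact n / \<delta> ^ n * exp (\<delta> * t)"
    using assms by (simp add: field_simps power_mult_distrib)
  moreover have "1 \<le> exp (\<delta> * t)" using assms t by simp
  ultimately have "1 + t ^ n \<le> exp (\<delta> * t) + fact n / \<delta> ^ n * exp (\<delta> * t)"
    by (intro add_mono)
  then show "1 + t ^ n \<le> (1 + fact n / \<delta> ^ n) * exp (\<delta> * t)"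
    by (simp only: distrib_right mult_1)
qed (use assms in \<open>simp add: add_pos_pos\<close>)

lemma compact_bound:
  fixes f :: "complex \<Rightarrow> complex"
  assumes "continuous_on (cball w0 1) f"
  shows "\<exists>G>0. \<forall>w\<in>cball w0 1. cmod (f w) \<le> G"
proof -
  have "bounded (f ` cball w0 1)"
    using assms by (intro compact_imp_bounded compact_continuous_image) auto
  then show ?thesis by (auto simp: bounded_pos)
qed

lemma Re_cball: "w \<in> cball w0 1 \<Longrightarrow> \<bar>Re w - Re w0\<bar> \<le> 1"
  using abs_Re_le_cmod [of "w - w0"] by (simp add: dist_norm norm_minus_commute)

text \<open>The derivative is bounded by a constant times \<open>t\<^bsup>Re w - 1\<^esup> e\<^bsup>-t Re \<zeta>\<^esup>\<close>, and the power of \<open>t\<close> is absorbed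
  by \<open>e\<^bsup>\<delta>t\<^esup>\<close> for any \<open>\<delta> > 0\<close>.  The constant is uniform for \<open>w\<close> in a disc, which is essential for
  differentiating in \<open>w\<close> later.\<close>

lemma damped_diff_bound:
  assumes "Re w0 \<ge> 3" "cmod \<zeta> = 1" "\<delta> > 0" "\<delta> \<noteq> Re \<zeta>"
  shows "\<exists>C>0. \<forall>w\<in>cball w0 1. \<forall>a b. 0 \<le> a \<longrightarrow> a < b \<longrightarrow> cmod (damped \<zeta> w b - damped \<zeta> w a)
           \<le> C * (exp ((\<delta> - Re \<zeta>) * b) / (\<delta> - Re \<zeta>) - exp ((\<delta> - Re \<zeta>) * a) / (\<delta> - Re \<zeta>))"
proof -
  obtain G where G: "G > 0" "\<And>w. w \<in> cball w0 1 \<Longrightarrow> cmod (rGamma w) \<le> G"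
    using compact_bound [of w0 rGamma] holomorphic_on_imp_continuous_on [OF holomorphic_rGamma]
    by blast
  obtain M :: nat where M: "Re w0 \<le> real M" using real_arch_simple by blast
  obtain C where C: "C > 0" "\<And>t. t \<ge> 0 \<Longrightarrow> 1 + t ^ M \<le> C * exp (\<delta> * t)"
    using power_le_exp [OF assms(3), of M] by blast
  define \<kappa> where "\<kappa> = \<delta> - Re \<zeta>"
  have \<kappa>: "\<kappa> \<noteq> 0" using assms by (simp add: \<kappa>_def)
  show ?thesis
    unfolding \<kappa>_def [symmetric]
  proof (intro exI [of _ "C * G"] conjI ballI allI impI)
    fix w a b assume w: "w \<in> cball w0 1" and a: "0 \<le> (a::real)" and ab: "a < b"
    have Re_w: "2 \<le> Re w" "Re w \<le> real M + 1"
      using Re_cball [OF w] assms(1) M by auto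
    have "cmod (damped \<zeta> w b - damped \<zeta> w a) \<le> C * G * (exp (\<kappa> * b) / \<kappa>)
        - C * G * (exp (\<kappa> * a) / \<kappa>)"
    proof (rule differentiable_bound_general [OF ab])
      show "continuous_on {a..b} (damped \<zeta> w)"
        using continuous_on_damped [of w \<zeta> b] Re_w assms(2) a by (auto elim: continuous_on_subset)
      show "continuous_on {a..b} (\<lambda>t. C * G * (exp (\<kappa> * t) / \<kappa>))"
        using \<kappa> by (intro continuous_intros) auto
      fix t assume t: "a < t" "t < b"
      then have t0: "t > 0" using a by simp
      show "(damped \<zeta> w has_vector_derivative exp (- \<zeta> * of_real t)
          * (of_real t powr (w - 1) * rGamma w)) (at t)"
        using t0 Re_w assms by (intro damped_derivative) auto
      show "((\<lambda>t. C * G * (exp (\<kappa> * t) / \<kappa>)) has_vector_derivative C * G * exp (\<kappa> * t)) (at t)"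
        using \<kappa> by (auto simp flip: has_real_derivative_iff_has_vector_derivative
            intro!: derivative_eq_intros)
      have "t powr (Re w - 1) \<le> 1 + t ^ M"
      proof (cases "t \<le> 1")
        case True
        then have "t powr (Re w - 1) \<le> 1" using t0 Re_w by (intro powr_le1) auto
        then show ?thesis using t0 by (simp add: add_increasing2)
      next
        case False
        then have "t powr (Re w - 1) \<le> t powr real M" using Re_w by (intro powr_mono) auto
        then show ?thesis using t0 by (simp add: powr_realpow)
      qed
      also have "\<dots> \<le> C * exp (\<delta> * t)" using C t0 by simp
      finally have 1: "t powr (Re w - 1) \<le> C * exp (\<delta> * t)" .
      have "cmod (exp (- \<zeta> * of_real t) * (of_real t powr (w - 1) * rGamma w))
          = exp (- Re \<zeta> * t) * (t powr (Re w - 1) * cmod (rGamma w))"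
        using t0 by (simp add: norm_mult norm_powr_real_powr)
      also have "\<dots> \<le> exp (- Re \<zeta> * t) * (C * exp (\<delta> * t) * G)"
        using C G(2) [OF w] 1 by (intro mult_left_mono mult_mono) auto
      also have "\<dots> = C * G * exp (\<kappa> * t)"
        by (simp add: \<kappa>_def left_diff_distrib exp_diff exp_minus field_simps)
      finally show "cmod (exp (- \<zeta> * of_real t) * (of_real t powr (w - 1) * rGamma w))
          \<le> C * G * exp (\<kappa> * t)" .
    qed
    then show "cmod (damped \<zeta> w b - damped \<zeta> w a) \<le> C * G * (exp (\<kappa> * b) / \<kappa> - exp (\<kappa> * a) / \<kappa>)"
      by (simp add: right_diff_distrib)
  qed (use C G in simp)
qed

lemma shifted_exp_eq_damped:
  assumes "Re w \<ge> 0" "cmod \<zeta> = 1" "t > 0"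
  shows "shifted_exp \<zeta> t w = exp (\<zeta> * of_real t) * damped \<zeta> w t"
  by (simp add: damped_eq [OF assms] exp_minus flip: exp_add)

lemma shifted_exp_one_asymp:
  assumes "Re w0 \<ge> 3"
  shows "\<exists>C>0. \<forall>w\<in>cball w0 1. \<forall>x>0. cmod (shifted_exp 1 x w - exp x) \<le> C * exp (1/2 * x)"
proof -
  obtain C where C: "C > 0" "\<And>w a b. w \<in> cball w0 1 \<Longrightarrow> 0 \<le> a \<Longrightarrow> a < b \<Longrightarrow>
      cmod (damped 1 w b - damped 1 w a) \<le> C * (2 * exp (- a / 2) - 2 * exp (- b / 2))"
  proof -
    have e: "exp ((1/2 - Re 1) * b) / (1/2 - Re 1) = - 2 * exp (- b / 2)" for b :: real by simp
    obtain C where C: "C > 0" "\<forall>w\<in>cball w0 1. \<forall>a b. 0 \<le> a \<longrightarrow> a < b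
        \<longrightarrow> cmod (damped 1 w b - damped 1 w a)
           \<le> C * (exp ((1/2 - Re 1) * b) / (1/2 - Re 1) - exp ((1/2 - Re 1) * a) / (1/2 - Re 1))"
      using damped_diff_bound [of w0 1 "1/2"] assms by auto
    show thesis
    proof (rule that [OF C(1)])
      fix w and a b :: real assume "w \<in> cball w0 1" "0 \<le> a" "a < b"
      with C(2) show "cmod (damped 1 w b - damped 1 w a)
          \<le> C * (2 * exp (- a / 2) - 2 * exp (- b / 2))"
        unfolding e by fastforce
    qed
  qed
  show ?thesis
  proof (intro exI [of _ "2 * C"] conjI ballI allI impI)
    fix w and x :: real assume w: "w \<in> cball w0 1" and x: "x > 0"
    have Re_w: "2 \<le> Re w" using Re_cball [OF w] assms by auto
    have "cmod (1 - damped 1 w x) \<le> C * (2 * exp (- x / 2))"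
    proof (rule tendsto_upperbound)
      show "((\<lambda>b. cmod (damped 1 w b - damped 1 w x)) \<longlongrightarrow> cmod (1 - damped 1 w x)) at_top"
        using Re_w by (intro tendsto_intros damped_tendsto_1) auto
      show "eventually (\<lambda>b. cmod (damped 1 w b - damped 1 w x) \<le> C * (2 * exp (- x / 2))) at_top"
        using eventually_gt_at_top [of x]
      proof eventually_elim
        case (elim b)
        have "cmod (damped 1 w b - damped 1 w x) \<le> C * (2 * exp (- x / 2) - 2 * exp (- b / 2))"
          using C(2) [OF w _ elim] x by simp
        also have "\<dots> \<le> C * (2 * exp (- x / 2))"
          using C(1) by (intro mult_left_mono) auto
        finally show ?case .
      qed
    qed simp
    then have b: "cmod (damped 1 w x - 1) \<le> 2 * C * exp (- x / 2)"
      by (simp add: norm_minus_commute mult_ac)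
    have "shifted_exp 1 x w - exp x = exp (of_real x) * (damped 1 w x - 1)"
      using shifted_exp_eq_damped [of w 1 x] Re_w x by (simp add: algebra_simps exp_of_real)
    then have "cmod (shifted_exp 1 x w - exp x) = exp x * cmod (damped 1 w x - 1)"
      by (simp add: norm_mult)
    also have "\<dots> \<le> exp x * (2 * C * exp (- x / 2))"
      by (intro mult_left_mono b) auto
    also have "\<dots> = 2 * C * (exp x * exp (- x / 2))" by simp
    also have "exp x * exp (- x / 2) = exp (1/2 * x)"
      by (simp flip: exp_add)
    finally show "cmod (shifted_exp 1 x w - exp x) \<le> 2 * C * exp (1/2 * x)" .
  qed (use C in simp)
qed

lemma shifted_exp_other_asymp:
  assumes "Re w0 \<ge> 3" "cmod \<zeta> = 1" "\<zeta> \<noteq> 1"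
  shows "\<exists>C>0. \<exists>c<1. \<forall>w\<in>cball w0 1. \<forall>x>0. cmod (shifted_exp \<zeta> x w) \<le> C * exp (c * x)"
proof -
  have "Re \<zeta> \<noteq> 1"
  proof
    assume "Re \<zeta> = 1"
    with assms(2) have "Im \<zeta> = 0" by (simp add: cmod_def real_sqrt_eq_1_iff)
    with \<open>Re \<zeta> = 1\<close> assms(3) show False by (simp add: complex_eq_iff)
  qed
  moreover have "Re \<zeta> \<le> 1" "Re \<zeta> \<ge> -1" using assms(2) abs_Re_le_cmod [of \<zeta>] by auto
  ultimately have rho: "Re \<zeta> < 1" "Re \<zeta> \<ge> -1" by auto
  \<comment> \<open>Any positive number between \<open>Re \<zeta>\<close> and \<open>1\<close> serves; this one is positive since \<open>Re \<zeta> \<ge> -1\<close>.\<close>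
  define \<delta> where "\<delta> = (3 + Re \<zeta>) / 4"
  have \<delta>: "\<delta> > 0" "\<delta> < 1" "\<delta> - Re \<zeta> > 0" using rho by (auto simp: \<delta>_def)
  obtain C where C: "C > 0" "\<And>w a b. w \<in> cball w0 1 \<Longrightarrow> 0 \<le> a \<Longrightarrow> a < b \<Longrightarrow>
      cmod (damped \<zeta> w b - damped \<zeta> w a)
          \<le> C * (exp ((\<delta> - Re \<zeta>) * b) / (\<delta> - Re \<zeta>) - exp ((\<delta> - Re \<zeta>) * a) / (\<delta> - Re \<zeta>))"
    using damped_diff_bound [OF assms(1,2) \<delta>(1)] \<delta> by auto
  show ?thesis
  proof (rule exI [of _ "C / (\<delta> - Re \<zeta>)"], rule conjI [OF _ exI [of _ \<delta>]], goal_cases)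
    case 2
    show ?case
    proof (intro conjI ballI allI impI)
      fix w and x :: real assume w: "w \<in> cball w0 1" and x: "x > 0"
      have Re_w: "2 \<le> Re w" using Re_cball [OF w] assms by auto
      have "cmod (damped \<zeta> w x) \<le> C * (exp ((\<delta> - Re \<zeta>) * x) / (\<delta> - Re \<zeta>) - 1 / (\<delta> - Re \<zeta>))"
        using C(2) [OF w _ x] by simp
      also have "\<dots> \<le> C * (exp ((\<delta> - Re \<zeta>) * x) / (\<delta> - Re \<zeta>))"
        using C(1) \<delta> by (intro mult_left_mono) auto
      finally have "exp (Re \<zeta> * x) * cmod (damped \<zeta> w x)
          \<le> exp (Re \<zeta> * x) * (C * (exp ((\<delta> - Re \<zeta>) * x) / (\<delta> - Re \<zeta>)))"
        by (intro mult_left_mono) auto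
      also have "\<dots> = C / (\<delta> - Re \<zeta>) * exp (\<delta> * x)"
        by (simp add: left_diff_distrib exp_diff)
      finally show "cmod (shifted_exp \<zeta> x w) \<le> C / (\<delta> - Re \<zeta>) * exp (\<delta> * x)"
        using shifted_exp_eq_damped [of w \<zeta> x] Re_w x assms(2) by (simp add: norm_mult)
    qed (use \<delta> in auto)
  qed (use C \<delta> in auto)
qed

text \<open>Exponential accuracy: no negative powers of \<open>x\<close> appear, and for \<open>\<zeta> \<noteq> 1\<close> the sum is exponentially
  smaller than \<open>e\<^sup>x\<close> because \<open>Re \<zeta> < 1\<close>.\<close>

lemma shifted_exp_asymp:
  assumes "Re w0 \<ge> 3" "cmod \<zeta> = 1"
  shows "\<exists>C>0. \<exists>c<1. \<forall>w\<in>cball w0 1. \<forall>x>0.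
           cmod (shifted_exp \<zeta> x w - (if \<zeta> = 1 then exp x else 0)) \<le> C * exp (c * x)"
proof (cases "\<zeta> = 1")
  case True
  from shifted_exp_one_asymp [OF assms(1)] obtain C where
    "C > 0" "\<forall>w\<in>cball w0 1. \<forall>x>0. cmod (shifted_exp 1 x w - exp x) \<le> C * exp (1/2 * x)" by blast
  then have "C > 0 \<and> (\<exists>c<1. \<forall>w\<in>cball w0 1. \<forall>x>0.
           cmod (shifted_exp \<zeta> x w - (if \<zeta> = 1 then exp x else 0)) \<le> C * exp (c * x))"
    using True by (intro conjI exI [of _ "1/2"]) simp_all
  then show ?thesis by blast
qed (use shifted_exp_other_asymp [OF assms] in auto)

section \<open>Summation over the multiples of r\<close>

definition sparse_exp :: "real \<Rightarrow> nat \<Rightarrow> real \<Rightarrow> complex \<Rightarrow> complex" where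
  "sparse_exp \<omega> r x w = (suminf (\<lambda>m. exp (\<i> * of_real (\<omega> * real (r * m))) * exp_term x (r * m) w))"

lemma summable_sparse:
  fixes f :: "nat \<Rightarrow> real"
  assumes "summable f" "r > 0" and that: "\<And>n. f n \<ge> 0"
  shows "summable (\<lambda>m. f (r * m))"
proof -
  have "summable (\<lambda>n. if r dvd n then f n else 0)"
    by (rule summable_comparison_test' [OF assms(1), of 0]) (use that in auto)
  moreover have "strict_mono (\<lambda>m. r * m)" using assms(2) by (auto simp: strict_mono_def)
  moreover have "(if r dvd n then f n else 0) = 0" if "n \<notin> range (\<lambda>m. r * m)" for n
    using that by (auto simp: dvd_def)
  ultimately have "summable (\<lambda>m. if r dvd r * m then f (r * m) else 0)"
    using summable_mono_reindex [of "\<lambda>m. r * m" "\<lambda>n. if r dvd n then f n else 0"] by blast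
  then show ?thesis by simp
qed

lemma sparse_exp_sums:
  assumes "Re w \<ge> 0" "x > 0" "r > 0"
  shows "(\<lambda>m. exp (\<i> * of_real (\<omega> * real (r * m))) * exp_term x (r * m) w) sums sparse_exp \<omega> r x w"
proof -
  have "summable (\<lambda>m. cmod (exp_term x (r * m) w))"
    using summable_sparse [OF summable_exp_term_abs [OF assms(1,2)] assms(3)] by simp
  then have "summable (\<lambda>m. exp (\<i> * of_real (\<omega> * real (r * m))) * exp_term x (r * m) w)"
    by (intro summable_norm_cancel
        [of "\<lambda>m. exp (\<i> * of_real (\<omega> * real (r * m))) * exp_term x (r * m) w"])
       (simp add: norm_mult)
  then show ?thesis unfolding sparse_exp_def by (rule summable_sums)
qed

lemma roots_of_unity_filter:
  fixes r s :: nat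
  assumes "r > 0"
  shows "(\<Sum>j<r. exp (\<i> * of_real (2 * pi * real j / real r)) ^ s)
      = (if r dvd s then of_nat r else 0)"
proof -
  define \<xi> where "\<xi> = exp (\<i> * of_real (2 * pi * real s / real r))"
  have e: "exp (\<i> * of_real (2 * pi * real j / real r)) ^ s = \<xi> ^ j" for j
    unfolding \<xi>_def by (simp flip: exp_of_nat_mult) (simp add: field_simps)
  have r: "\<xi> ^ r = 1"
    using assms unfolding \<xi>_def
    by (simp flip: exp_of_nat_mult) (metis cis_conv_exp cis_multiple_2pi Ints_of_nat mult.commute mult.assoc of_real_mult of_real_of_nat_eq of_real_numeral)
  have "\<xi> = 1 \<longleftrightarrow> r dvd s"
  proof -
    have "\<xi> = 1 \<longleftrightarrow> (\<exists>n::int. 2 * pi * real s / real r = of_int (2 * n) * pi)"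
      unfolding \<xi>_def exp_eq_1 by simp
    also have "\<dots> \<longleftrightarrow> (\<exists>n::int. real s = of_int n * real r)"
      using assms by (simp add: field_simps)
    also have "\<dots> \<longleftrightarrow> (\<exists>n::int. int s = n * int r)"
      by (metis of_int_eq_iff of_int_mult of_int_of_nat_eq)
    also have "\<dots> \<longleftrightarrow> int r dvd int s" by (auto simp: dvd_def mult.commute)
    finally show ?thesis by simp
  qed
  then show ?thesis
    unfolding e using r by (auto simp: sum_gp_strict)
qed

lemma sparse_exp_filter:
  assumes "Re w \<ge> 0" "x > 0" "r > 0"
  shows "sparse_exp \<omega> r x w = (1 / of_nat r)
      * (\<Sum>j<r. shifted_exp (exp (\<i> * of_real (\<omega> + 2 * pi * real j / real r))) x w)"
proof -
  let ?\<zeta> = "\<lambda>j::nat. exp (\<i> * of_real (\<omega> + 2 * pi * real j / real r))"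
  let ?\<xi> = "\<lambda>j::nat. exp (\<i> * of_real (2 * pi * real j / real r))"
  define f where "f s = (if r dvd s then exp (\<i> * of_real (\<omega> * real s)) * exp_term x s w else 0)"
      for s
  have "(\<lambda>s. (1 / of_nat r) * (\<Sum>j<r. ?\<zeta> j ^ s * exp_term x s w)) sums
      ((1 / of_nat r) * (\<Sum>j<r. shifted_exp (?\<zeta> j) x w))"
    using assms by (intro sums_mult sums_sum shifted_exp_sums) (auto simp flip: cis_conv_exp)
  moreover have "(1 / of_nat r) * (\<Sum>j<r. ?\<zeta> j ^ s * exp_term x s w) = f s" for s
  proof -
    have "?\<zeta> j ^ s
        = exp (\<i> * of_real (\<omega> * real s)) * ?\<xi> j ^ s" for j
      by (simp add: distrib_left exp_add power_mult_distrib) (simp add: mult_ac flip: exp_of_nat_mult)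
    then have "(\<Sum>j<r. ?\<zeta> j ^ s * exp_term x s w)
        = exp (\<i> * of_real (\<omega> * real s)) * (\<Sum>j<r. ?\<xi> j ^ s) * exp_term x s w"
      by (simp add: sum_distrib_left sum_distrib_right)
    then show ?thesis using assms(3) unfolding roots_of_unity_filter [OF assms(3)]
    by (simp add: f_def)
  qed
  ultimately have "f sums ((1 / of_nat r) * (\<Sum>j<r. shifted_exp (?\<zeta> j) x w))"
    by simp
  moreover have "strict_mono (\<lambda>m. r * m)" using assms(3) by (auto simp: strict_mono_def)
  ultimately have "(\<lambda>m. f (r * m)) sums ((1 / of_nat r) * (\<Sum>j<r. shifted_exp (?\<zeta> j) x w))"
    by (subst sums_mono_reindex) (auto simp: f_def dvd_def)
  then show ?thesis
    using sparse_exp_sums [OF assms] by (auto simp: f_def dest: sums_unique2)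
qed

text \<open>The filter averages \<open>shifted_exp\<close> over the points \<open>e\<^bsup>i\<omega>\<^esup> \<xi>\<^sup>j\<close> with \<open>\<xi>\<close> a primitive \<open>r\<close>-th root of
  unity.  If \<open>e\<^bsup>i\<omega>r\<^esup> = 1\<close> then the phases in \<open>sparse_exp\<close> are all \<open>1\<close> and one may take \<open>\<omega> = 0\<close>, where exactly
  the point with \<open>j = 0\<close> equals \<open>1\<close>; otherwise no point does.\<close>

lemma sparse_exp_asymp:
  assumes "Re w0 \<ge> 3" "r > 0"
  shows "\<exists>C>0. \<exists>c<1. \<forall>w\<in>cball w0 1. \<forall>x>0.
           cmod (sparse_exp \<omega> r x w - (if exp (\<i> * of_real (\<omega> * real r)) = 1 then exp x / of_nat r
               else 0)) \<le> C * exp (c * x)"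
proof -
  have main: "\<exists>C>0. \<exists>c<1. \<forall>w\<in>cball w0 1. \<forall>x>0.
           cmod (sparse_exp \<omega> r x w - (if \<omega> = 0 then exp x / of_nat r else 0)) \<le> C * exp (c * x)"
    if \<omega>: "\<omega> = 0 \<or> exp (\<i> * of_real (\<omega> * real r)) \<noteq> 1" for \<omega>
  proof -
    define \<zeta> where "\<zeta> j = exp (\<i> * of_real (\<omega> + 2 * pi * real j / real r))" for j :: nat
    have "\<exists>C c. C > 0 \<and> c < 1 \<and> (\<forall>w\<in>cball w0 1. \<forall>x>0.
           cmod (shifted_exp (\<zeta> j) x w - (if \<zeta> j = 1 then exp x else 0)) \<le> C * exp (c * x))" for j
      using shifted_exp_asymp [OF assms(1), of "\<zeta> j"] unfolding \<zeta>_def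
      by (auto simp flip: cis_conv_exp)
    then obtain C c where C: "\<And>j. C j > 0" "\<And>j. c j < (1::real)"
        "\<And>j w x. w \<in> cball w0 1 \<Longrightarrow> x > 0 \<Longrightarrow>
           cmod (shifted_exp (\<zeta> j) x w - (if \<zeta> j = 1 then exp x else 0)) \<le> C j * exp (c j * x)"
      by metis
    have \<zeta>1: "\<zeta> j = 1 \<longleftrightarrow> \<omega> = 0 \<and> j = 0" if "j < r" for j
    proof
      assume z: "\<zeta> j = 1"
      have "\<zeta> j ^ r = exp (\<i> * of_real (\<omega> * real r)) * exp (\<i> * of_real (2 * pi * real j))"
      proof -
        have "of_nat r * (\<i> * complex_of_real (\<omega> + 2 * pi * real j / real r))
            = \<i> * of_real (\<omega> * real r) + \<i> * of_real (2 * pi * real j)"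
          using assms(2) by (simp add: field_simps)
        then show ?thesis
          unfolding \<zeta>_def by (simp only: exp_add flip: exp_of_nat_mult)
      qed
      also have "exp (\<i> * of_real (2 * pi * real j)) = 1"
        by (simp add: exp_eq_1) (metis of_int_of_nat_eq)
      finally have "exp (\<i> * of_real (\<omega> * real r)) = 1" using z by simp
      with \<omega> have 0: "\<omega> = 0" by simp
      from z obtain n :: int where "2 * pi * real j / real r = of_int (2 * n) * pi"
        unfolding \<zeta>_def exp_eq_1 by (auto simp: 0)
      then have "real j = of_int n * real r"
        using assms(2) by (simp add: field_simps)
      then have "int j = n * int r"
        by (metis of_int_eq_iff of_int_mult of_int_of_nat_eq)
      then have "r dvd j" by (metis dvd_triv_right int_dvd_int_iff)
      with that have "j = 0" by (auto dest: dvd_imp_le)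
      with 0 show "\<omega> = 0 \<and> j = 0" by simp
    qed (simp add: \<zeta>_def)
    define c' where "c' = Max (c ` {..<r})"
    have ne: "{..<r} \<noteq> {}" using assms(2) by auto
    have c': "c' < 1" unfolding c'_def using ne C(2) by (subst Max_less_iff) auto
    have cc': "c j \<le> c'" if "j < r" for j unfolding c'_def using that by (intro Max_ge) auto
    have "cmod (sparse_exp \<omega> r x w - (if \<omega> = 0 then exp x / of_nat r else 0))
        \<le> (\<Sum>j<r. C j) * exp (c' * x)"
      if w: "w \<in> cball w0 1" and x: "x > 0" for w x
    proof -
      have Re_w: "2 \<le> Re w" using Re_cball [OF w] assms by auto
      have "(\<Sum>j<r. (if \<zeta> j = 1 then exp x else 0))
          = (\<Sum>j<r. if j = 0 then (if \<omega> = 0 then exp x else 0) else (0::real))"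
        using \<zeta>1 by (intro sum.cong) auto
      also have "\<dots> = (if \<omega> = 0 then exp x else 0)" using assms(2) by simp
      finally have s: "(\<Sum>j<r. complex_of_real (if \<zeta> j = 1 then exp x else 0))
          = (if \<omega> = 0 then exp x else 0)"
        unfolding of_real_sum [symmetric] by simp
      have "sparse_exp \<omega> r x w - (if \<omega> = 0 then exp x / of_nat r else 0)
          = (1 / of_nat r) * ((\<Sum>j<r. shifted_exp (\<zeta> j) x w) - (if \<omega> = 0 then exp x else 0))"
      proof -
        have "sparse_exp \<omega> r x w = (1 / of_nat r) * (\<Sum>j<r. shifted_exp (\<zeta> j) x w)"
          using Re_w x assms(2) unfolding \<zeta>_def by (intro sparse_exp_filter) auto
        then show ?thesis by (simp only: right_diff_distrib) simp
      qed
      also have "\<dots> = (1 / of_nat r) * (\<Sum>j<r. shifted_exp (\<zeta> j) x w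
          - complex_of_real (if \<zeta> j = 1 then exp x else 0))"
        unfolding sum_subtractf s ..
      finally have "cmod (sparse_exp \<omega> r x w - (if \<omega> = 0 then exp x / of_nat r else 0))
          = (1 / real r) * cmod (\<Sum>j<r. shifted_exp (\<zeta> j) x w
              - complex_of_real (if \<zeta> j = 1 then exp x else 0))"
        by (simp add: norm_mult norm_divide)
      also have "\<dots> \<le> 1 * cmod (\<Sum>j<r. shifted_exp (\<zeta> j) x w
          - complex_of_real (if \<zeta> j = 1 then exp x else 0))"
        using assms(2) by (intro mult_right_mono) auto
      also have "\<dots> \<le> (\<Sum>j<r. cmod (shifted_exp (\<zeta> j) x w
          - complex_of_real (if \<zeta> j = 1 then exp x else 0)))"
        by (simp add: norm_sum)
      also have "\<dots> \<le> (\<Sum>j<r. C j * exp (c' * x))"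
      proof (rule sum_mono)
        fix j assume j: "j \<in> {..<r}"
        have "cmod (shifted_exp (\<zeta> j) x w - complex_of_real (if \<zeta> j = 1 then exp x else 0))
            \<le> C j * exp (c j * x)"
          using C(3) [OF w x, of j] by (simp add: if_distrib cong: if_cong)
        also have "\<dots> \<le> C j * exp (c' * x)"
          using j C(1) [of j] x cc' by (intro mult_left_mono) (auto intro: mult_right_mono)
        finally show "cmod (shifted_exp (\<zeta> j) x w - complex_of_real (if \<zeta> j = 1 then exp x else 0))
            \<le> C j * exp (c' * x)" .
      qed
      finally show ?thesis by (simp add: sum_distrib_right)
    qed
    moreover have "(\<Sum>j<r. C j) > 0" using C(1) ne by (intro sum_pos) auto
    ultimately show ?thesis using c' by blast
  qed
  show ?thesis
  proof (cases "exp (\<i> * of_real (\<omega> * real r)) = 1")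
    case True
    have "exp (\<i> * of_real (\<omega> * real (r * m))) = 1" for m
    proof -
      have "exp (\<i> * of_real (\<omega> * real (r * m))) = exp (\<i> * of_real (\<omega> * real r)) ^ m"
        by (simp add: mult_ac flip: exp_of_nat_mult)
      then show ?thesis using True by simp
    qed
    then have "sparse_exp \<omega> r x w = sparse_exp 0 r x w" for x w
      by (simp add: sparse_exp_def)
    then show ?thesis using main [of 0] True by simp
  next
    case False
    then have "\<omega> \<noteq> 0" by auto
    with main [of \<omega>] False show ?thesis by simp
  qed
qed

section \<open>Estimates for weighted sums\<close>

abbreviation rising :: "nat \<Rightarrow> complex \<Rightarrow> nat \<Rightarrow> complex" where
  "rising u w j \<equiv> pochhammer (1 + (of_nat u + w)) j"

text \<open>Dividing by a rising factorial amounts to shifting the exponent: this is why inverse factorials are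
  better suited to these series than negative powers of \<open>m\<close>.\<close>

lemma exp_term_shift:
  assumes "x > 0"
  shows "exp_term x s w = rising s w j * (exp_term x s (w + of_nat j) / of_real x ^ j)"
proof -
  have "rGamma (1 + (of_nat s + w)) = rising s w j * rGamma (1 + (of_nat s + (w + of_nat j)))"
    by (subst pochhammer_rGamma [of _ j]) (simp add: add_ac)
  moreover have "complex_of_real x powr (of_nat s + (w + of_nat j))
      = of_real x powr (of_nat s + w) * of_real x ^ j"
    using assms by (simp add: powr_add flip: add.assoc)
  ultimately show ?thesis
    using assms by (simp add: exp_term_def)
qed

text \<open>Up to a factor independent of \<open>s\<close>, the imaginary part of \<open>w\<close> only makes \<open>1 / \<Gamma>(1 + s + w)\<close> smaller,
  because it increases the modulus of every factor of the rising factorial.\<close>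

lemma norm_rGamma_shift_le_real:
  assumes "Re w \<ge> 0"
  shows "cmod (rGamma (1 + (of_nat s + w)))
       \<le> cmod (rGamma (1 + w)) * Gamma (1 + Re w) * rGamma (1 + (real s + Re w))"
proof -
  define p where "p = pochhammer (1 + Re w) s"
  have p: "p > 0" unfolding p_def using assms by (intro pochhammer_pos) auto
  have "p \<le> cmod (pochhammer (1 + w) s)"
    using norm_pochhammer_ge [of "1 + w" s] assms by (simp add: p_def)
  then have "p * cmod (rGamma (1 + (of_nat s + w)))
      \<le> cmod (pochhammer (1 + w) s) * cmod (rGamma (1 + (of_nat s + w)))"
    by (rule mult_right_mono) simp
  also have "\<dots> = cmod (rGamma (1 + w))"
    by (subst (2) pochhammer_rGamma [of _ s]) (simp add: norm_mult add_ac)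
  finally have 1: "p * cmod (rGamma (1 + (of_nat s + w))) \<le> cmod (rGamma (1 + w))" .
  have "Gamma (1 + Re w) > 0"
    using assms by (intro Gamma_real_pos) auto
  then have "Gamma (1 + Re w) * rGamma (1 + Re w) = 1"
    by (simp add: rGamma_inverse_Gamma)
  moreover have "rGamma (1 + Re w) = p * rGamma (1 + (real s + Re w))"
    unfolding p_def by (subst pochhammer_rGamma [of _ s]) (simp add: add_ac)
  ultimately have 2: "Gamma (1 + Re w) * (p * rGamma (1 + (real s + Re w))) = 1" by simp
  have "p * cmod (rGamma (1 + (of_nat s + w)))
      \<le> cmod (rGamma (1 + w)) * (Gamma (1 + Re w) * (p * rGamma (1 + (real s + Re w))))"
    unfolding 2 using 1 by simp
  then show ?thesis using p by (simp add: mult_ac)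
qed

lemma rGamma_real_nonneg: "x > 0 \<Longrightarrow> rGamma (x :: real) \<ge> 0"
  using Gamma_real_pos [of x] by (simp add: rGamma_inverse_Gamma)

lemma pochhammer_real_le:
  assumes "a \<ge> 0"
  shows "pochhammer (1 + (real s + a)) L \<le> ((real s + 1) * (1 + a + real L)) ^ L"
proof -
  have "pochhammer (1 + (real s + a)) L = (\<Prod>i<L. 1 + (real s + a) + real i)"
    by (simp add: pochhammer_prod atLeast0LessThan)
  also have "\<dots> \<le> (\<Prod>i<L. (real s + 1) * (1 + a + real L))"
  proof (rule prod_mono, intro conjI)
    fix i assume "i \<in> {..<L}"
    then have "1 + (real s + a) + real i \<le> 1 + (real s + a) + real L" by simp
    also have "\<dots> \<le> (real s + 1) * (1 + a + real L)"
      using assms by (simp add: algebra_simps)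
    finally show "1 + (real s + a) + real i \<le> (real s + 1) * (1 + a + real L)" .
  qed (use assms in auto)
  finally show ?thesis by simp
qed

lemma continuous_on_rGamma_shift: "continuous_on A (\<lambda>w :: complex. rGamma (1 + w))"
  by (intro holomorphic_on_imp_continuous_on holomorphic_intros)

text \<open>The weight \<open>(m + 1)\<^bsup>-L\<^esup>\<close> is at most a constant times \<open>\<Gamma>(1 + s + a) / \<Gamma>(1 + s + a + L)\<close> with \<open>s = rm\<close> and
  \<open>a = Re w\<close>.  So the sum is bounded by \<open>x\<^bsup>-L\<^esup>\<close> times \<open>shifted_exp 1\<close> at the real exponent
  \<open>a + L\<close>, which is \<open>O(e\<^sup>x)\<close> uniformly in \<open>a\<close>.\<close>

lemma weighted_exp_term_bound:
  assumes "Re w0 \<ge> 3" "r > 0"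
  shows "\<exists>C>0. \<forall>w\<in>cball w0 1. \<forall>x>0.
           (suminf (\<lambda>m. cmod (exp_term x (r * m) w) / (real m + 1) ^ L)) \<le> C * (exp x / x ^ L)"
proof -
  have "continuous_on (cball w0 1) (\<lambda>w. Gamma (complex_of_real (1 + Re w)))"
  proof (rule continuous_on_compose2 [OF continuous_on_Gamma [of "- \<int>\<^sub>\<le>\<^sub>0"]])
    have "complex_of_real (1 + Re w) \<notin> \<int>\<^sub>\<le>\<^sub>0" if "w \<in> cball w0 1" for w
    proof
      assume "complex_of_real (1 + Re w) \<in> \<int>\<^sub>\<le>\<^sub>0"
      then obtain n where "complex_of_real (1 + Re w) = - of_nat n"
      by (auto elim: nonpos_Ints_cases')
      then have "1 + Re w = - real n" by (simp add: complex_eq_iff)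
      then show False using Re_cball [OF that] assms(1) by simp
    qed
    then show "(\<lambda>w. complex_of_real (1 + Re w)) ` cball w0 1 \<subseteq> - \<int>\<^sub>\<le>\<^sub>0" by blast
  qed (auto intro!: continuous_intros)
  then have "continuous_on (cball w0 1) (\<lambda>w. rGamma (1 + w) * Gamma (complex_of_real (1 + Re w)))"
    by (intro continuous_on_mult continuous_on_rGamma_shift)
  from compact_bound [OF this] obtain G where G: "G > 0"
    "\<And>w. w \<in> cball w0 1 \<Longrightarrow> cmod (rGamma (1 + w) * Gamma (complex_of_real (1 + Re w))) \<le> G" by blast
  have G': "cmod (rGamma (1 + w)) * Gamma (1 + Re w) \<le> G" if w: "w \<in> cball w0 1" for w
  proof -
    have "Gamma (1 + Re w) > 0" using Re_cball [OF w] assms(1) by (intro Gamma_real_pos) auto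
    then show ?thesis using G(2) [OF w] by (simp only: norm_mult Gamma_complex_of_real) simp
  qed
  obtain C where C: "C > 0" "\<And>w x. w \<in> cball (of_real (Re w0 + real L)) 1 \<Longrightarrow> x > 0 \<Longrightarrow>
      cmod (shifted_exp 1 x w - exp x) \<le> C * exp (1/2 * x)"
    using shifted_exp_one_asymp [of "of_real (Re w0 + real L)"] assms(1) by auto
  define D where "D = 2 + Re w0 + real L"
  have D: "D > 0" using assms by (simp add: D_def)
  define K where "K = real r ^ L * (G * D ^ L)"
  have K: "K > 0" using G D assms by (simp add: K_def)
  show ?thesis
  proof (intro exI [of _ "K * (1 + C)"] conjI ballI allI impI)
    fix w and x :: real assume w: "w \<in> cball w0 1" and x: "x > 0"
    define a where "a = Re w"
    have a: "a \<ge> 2" "a \<le> Re w0 + 1" using Re_cball [OF w] assms by (auto simp: a_def)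
    define \<tau> where "\<tau> s = x powr (real s + (a + real L)) * rGamma (1 + (real s + (a + real L)))"
        for s :: nat
    have \<tau>0: "\<tau> s \<ge> 0" for s
      unfolding \<tau>_def using a by (intro mult_nonneg_nonneg rGamma_real_nonneg) auto
    have \<tau>: "complex_of_real (\<tau> s) = exp_term x s (of_real (a + real L))" for s
    proof -
      have "complex_of_real (\<tau> s) = of_real x powr of_real (real s + (a + real L))
          * rGamma (of_real (1 + (real s + (a + real L))))"
        using x by (simp add: \<tau>_def powr_of_real rGamma_complex_of_real del: of_real_add)
      then show ?thesis by (simp add: exp_term_def)
    qed
    have "(\<lambda>s. 1 ^ s * exp_term x s (of_real (a + real L)))
        sums shifted_exp 1 x (of_real (a + real L))"
      using a x by (intro shifted_exp_sums) auto
    then have "(\<lambda>s. complex_of_real (\<tau> s)) sums shifted_exp 1 x (of_real (a + real L))"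
      by (simp add: \<tau>)
    then have \<tau>_sums: "\<tau> sums Re (shifted_exp 1 x (of_real (a + real L)))"
      using sums_Re by fastforce
    have "complex_of_real (a + real L) \<in> cball (of_real (Re w0 + real L)) 1"
      using Re_cball [OF w] by (simp add: a_def dist_complex_def norm_complex_def abs_minus_commute)
    from C(2) [OF this x] have "Re (shifted_exp 1 x (of_real (a + real L)) - exp x)
        \<le> C * exp (1/2 * x)"
      using complex_Re_le_cmod order_trans by blast
    also have "\<dots> \<le> C * exp x" using C x by (intro mult_left_mono) auto
    finally have \<tau>_bound: "suminf \<tau> \<le> (1 + C) * exp x"
      using sums_unique [OF \<tau>_sums] by (simp add: distrib_right)
    have term_le: "cmod (exp_term x s w) / (real s + 1) ^ L \<le> G * D ^ L / x ^ L * \<tau> s" for s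
    proof -
      have pos: "rGamma (1 + (real s + (a + real L))) \<ge> 0"
        using a by (intro rGamma_real_nonneg) auto
      have "rGamma (1 + (real s + a))
          = pochhammer (1 + (real s + a)) L * rGamma (1 + (real s + (a + real L)))"
        by (subst pochhammer_rGamma [of _ L]) (simp add: add_ac)
      also have "\<dots> \<le> ((real s + 1) * (1 + a + real L)) ^ L * rGamma (1 + (real s + (a + real L)))"
        using a pos by (intro mult_right_mono pochhammer_real_le) auto
      also have "\<dots> \<le> ((real s + 1) * D) ^ L * rGamma (1 + (real s + (a + real L)))"
        using a pos by (intro mult_right_mono power_mono mult_left_mono) (auto simp: D_def)
      finally have 1: "rGamma (1 + (real s + a))
          \<le> ((real s + 1) * D) ^ L * rGamma (1 + (real s + (a + real L)))" .
      have "cmod (exp_term x s w) = x powr (real s + a) * cmod (rGamma (1 + (of_nat s + w)))"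
        using x by (simp add: exp_term_def norm_mult norm_powr_real_powr a_def)
      also have "\<dots> \<le> x powr (real s + a) * (G * rGamma (1 + (real s + a)))"
      proof (rule mult_left_mono)
        have "cmod (rGamma (1 + (of_nat s + w)))
            \<le> cmod (rGamma (1 + w)) * Gamma (1 + Re w) * rGamma (1 + (real s + Re w))"
          using a by (intro norm_rGamma_shift_le_real) (simp add: a_def)
        also have "\<dots> \<le> G * rGamma (1 + (real s + a))"
          unfolding a_def [symmetric] using a G' [OF w]
          by (intro mult_right_mono rGamma_real_nonneg) (auto simp: a_def)
        finally show "cmod (rGamma (1 + (of_nat s + w))) \<le> G * rGamma (1 + (real s + a))" .
      qed simp
      also have "\<dots> \<le> x powr (real s + a)
          * (G * (((real s + 1) * D) ^ L * rGamma (1 + (real s + (a + real L)))))"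
        using G 1 by (intro mult_left_mono) auto
      also have "\<dots> = G * D ^ L * (real s + 1) ^ L / x ^ L * \<tau> s"
      proof -
        have "x powr (real s + (a + real L)) = x powr (real s + a) * x ^ L"
          using x by (simp add: powr_add powr_realpow)
        then show ?thesis using x by (simp add: \<tau>_def power_mult_distrib)
      qed
      finally show ?thesis by (simp add: field_simps)
    qed
    have sp: "cmod (exp_term x (r * m) w) / (real m + 1) ^ L \<le> K / x ^ L * \<tau> (r * m)" for m
    proof -
      have "real (r * m) + 1 \<le> real r * (real m + 1)" using assms(2) by (simp add: distrib_left)
      then have "(real (r * m) + 1) ^ L \<le> real r ^ L * (real m + 1) ^ L"
        unfolding power_mult_distrib [symmetric] by (intro power_mono) auto
      then have "1 / (real m + 1) ^ L \<le> real r ^ L / (real (r * m) + 1) ^ L"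
        by (simp add: field_simps add_pos_nonneg)
      then have "cmod (exp_term x (r * m) w) * (1 / (real m + 1) ^ L)
          \<le> cmod (exp_term x (r * m) w) * (real r ^ L / (real (r * m) + 1) ^ L)"
        by (intro mult_left_mono) auto
      also have "\<dots> = real r ^ L * (cmod (exp_term x (r * m) w) / (real (r * m) + 1) ^ L)" by simp
      also have "\<dots> \<le> real r ^ L * (G * D ^ L / x ^ L * \<tau> (r * m))"
        by (intro mult_left_mono term_le) auto
      finally show ?thesis by (simp add: K_def mult_ac)
    qed
    have sm: "summable (\<lambda>m. \<tau> (r * m))"
      using sums_summable [OF \<tau>_sums] assms(2) \<tau>0 by (rule summable_sparse)
    have "(suminf (\<lambda>m. \<tau> (r * m))) \<le> suminf \<tau>"
    proof -
      define f where "f s = (if r dvd s then \<tau> s else 0)" for s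
      have f: "summable f"
        by (rule summable_comparison_test' [OF sums_summable [OF \<tau>_sums], of 0]) (use \<tau>0 in \<open>auto
            simp: f_def\<close>)
      have "(\<lambda>m. f (r * m)) sums suminf f"
        using assms(2) f by (subst sums_mono_reindex) (auto simp: f_def dvd_def strict_mono_def)
      then have "(suminf (\<lambda>m. \<tau> (r * m))) = suminf f" by (simp add: f_def sums_iff)
      also have "\<dots> \<le> suminf \<tau>"
        using f sums_summable [OF \<tau>_sums] by (intro suminf_le) (auto simp: f_def \<tau>0)
      finally show ?thesis .
    qed
    also note \<tau>_bound
    finally have "K / x ^ L * (suminf (\<lambda>m. \<tau> (r * m))) \<le> K / x ^ L * ((1 + C) * exp x)"
      using K x by (intro mult_left_mono) auto
    moreover have "(suminf (\<lambda>m. cmod (exp_term x (r * m) w) / (real m + 1) ^ L))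
        \<le> (suminf (\<lambda>m. K / x ^ L * \<tau> (r * m)))"
    proof (rule suminf_le [OF sp])
      show "summable (\<lambda>m. K / x ^ L * \<tau> (r * m))" using sm by (rule summable_mult)
      then show "summable (\<lambda>m. cmod (exp_term x (r * m) w) / (real m + 1) ^ L)"
        by (rule summable_comparison_test' [of _ 0]) (use sp in auto)
    qed
    moreover have "(suminf (\<lambda>m. K / x ^ L * \<tau> (r * m))) = K / x ^ L * (suminf (\<lambda>m. \<tau> (r * m)))"
      by (rule suminf_mult [OF sm])
    ultimately show "(suminf (\<lambda>m. cmod (exp_term x (r * m) w) / (real m + 1) ^ L))
        \<le> K * (1 + C) * (exp x / x ^ L)"
      by simp
  qed (use K C in simp)
qed

lemma exp_term_uniform_summable:
  assumes "Re w0 \<ge> 3" "r > 0" "x > 0"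
  shows "\<exists>M. summable M \<and> (\<forall>w\<in>cball w0 1. \<forall>m. cmod (exp_term x (r * m) w) \<le> M m)"
proof -
  obtain G where G: "G > 0" "\<And>w. w \<in> cball w0 1 \<Longrightarrow> cmod (of_real x powr w * rGamma (1 + w)) \<le> G"
  proof -
    have "continuous_on (cball w0 1) (\<lambda>w. of_real x powr w * rGamma (1 + w))"
      using assms(3) by (intro continuous_on_mult continuous_on_rGamma_shift continuous_on_powr_complex continuous_intros) auto
    from compact_bound [OF this] show thesis using that by blast
  qed
  have "summable (\<lambda>s. G * (x ^ s / fact s))"
    using summable_exp [of x] by (intro summable_mult) (simp add: divide_inverse mult.commute)
  then have "summable (\<lambda>m. G * (x ^ (r * m) / fact (r * m)))"
    using G assms by (rule_tac summable_sparse [of "\<lambda>s. G * (x ^ s / fact s)"]) auto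
  moreover have "cmod (exp_term x (r * m) w) \<le> G * (x ^ (r * m) / fact (r * m))"
      if w: "w \<in> cball w0 1" for w m
  proof -
    have "cmod (exp_term x (r * m) w)
        \<le> x powr Re w * cmod (rGamma (1 + w)) * (x ^ (r * m) / fact (r * m))"
      using Re_cball [OF w] assms by (intro norm_exp_term_le) auto
    also have "\<dots> \<le> G * (x ^ (r * m) / fact (r * m))"
      using G(2) [OF w] assms(3)
      by (intro mult_right_mono) (auto simp: norm_mult norm_powr_real_powr)
    finally show ?thesis .
  qed
  ultimately show ?thesis by blast
qed

text \<open>The terms with \<open>\<epsilon> m\<close> small are controlled by \<open>weighted_exp_term_bound\<close>; the finitely many others grow
  only polynomially in \<open>x\<close>.\<close>

lemma remainder_uniform_limit:
  fixes e :: "nat \<Rightarrow> complex \<Rightarrow> complex" and \<epsilon> :: "nat \<Rightarrow> real"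
  assumes w0: "Re w0 \<ge> 3" and r: "r > 0"
    and e: "\<And>m w. w \<in> cball w0 1 \<Longrightarrow> cmod (e m w) \<le> \<epsilon> m / (real m + 1) ^ L"
    and \<epsilon>: "\<epsilon> \<longlonglongrightarrow> 0"
    and u: "\<And>m. cmod (u m) \<le> 1"
  shows "uniform_limit (cball w0 1)
           (\<lambda>x w. of_real (x ^ L * exp (- x))
               * (suminf (\<lambda>m. u m * exp_term x (r * m) w * e m w))) (\<lambda>_. 0) at_top"
proof (rule uniform_limitI)
  let ?R = "\<lambda>x w. suminf (\<lambda>m. u m * exp_term x (r * m) w * e m w)"
  fix d :: real assume d: "d > 0"
  obtain C where C: "C > 0" "\<And>w x. w \<in> cball w0 1 \<Longrightarrow> x > 0 \<Longrightarrow>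
      (suminf (\<lambda>m. cmod (exp_term x (r * m) w) / (real m + 1) ^ L)) \<le> C * (exp x / x ^ L)"
    using weighted_exp_term_bound [OF w0 r, of L] by blast
  define \<delta> where "\<delta> = d / (2 * C)"
  have \<delta>: "\<delta> > 0" "\<delta> * C = d / 2" using d C by (auto simp: \<delta>_def)
  obtain M where M: "\<And>m. m \<ge> M \<Longrightarrow> \<epsilon> m < \<delta>"
    using order_tendstoD(2) [OF \<epsilon> \<delta>(1)] by (auto simp: eventually_sequentially)
  have \<epsilon>0: "\<epsilon> m \<ge> 0" for m
  proof -
    have "0 \<le> \<epsilon> m / (real m + 1) ^ L"
      by (rule order_trans [OF norm_ge_zero e [of w0 m]]) simp
    moreover have "(real m + 1) ^ L > 0" by simp
    ultimately show ?thesis by (simp only: zero_le_divide_iff) linarith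
  qed
  define E where "E = (\<Sum>m<M. \<epsilon> m)"
  have E: "E \<ge> 0" "\<And>m. m < M \<Longrightarrow> \<epsilon> m \<le> E"
    unfolding E_def using \<epsilon>0 by (auto intro: sum_nonneg member_le_sum)
  have \<epsilon>_le: "\<epsilon> m / (real m + 1) ^ L \<le> \<delta> / (real m + 1) ^ L + (if m < M then E else 0)" for m
  proof (cases "m < M")
    case True
    have "\<epsilon> m / (real m + 1) ^ L \<le> \<epsilon> m / 1"
      using \<epsilon>0 [of m] by (intro divide_left_mono) auto
    with True E(2) [OF True] \<delta> show ?thesis by (simp add: add_increasing)
  next
    case False
    then show ?thesis using M [of m] by (simp add: divide_right_mono)
  qed
  obtain G where G: "G > 0" "\<And>w. w \<in> cball w0 1 \<Longrightarrow> cmod (rGamma (1 + w)) \<le> G"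
    using compact_bound [OF continuous_on_rGamma_shift] by blast
  obtain P :: nat where P: "Re w0 + 1 + real (r * M) \<le> real P" using real_arch_simple by blast
  have et: "cmod (exp_term x (r * m) w) \<le> G * x ^ P" if w: "w \<in> cball w0 1" and x: "x \<ge> 1"
      and m: "m < M" for w x m
  proof -
    have "cmod (exp_term x (r * m) w)
        \<le> x powr Re w * cmod (rGamma (1 + w)) * (x ^ (r * m) / fact (r * m))"
      using Re_cball [OF w] w0 x by (intro norm_exp_term_le) auto
    also have "\<dots> \<le> x powr Re w * G * (x ^ (r * m) / 1)"
      using x G(2) [OF w] G(1) by (intro mult_mono divide_left_mono) (auto simp: fact_ge_1)
    also have "\<dots> = G * x powr (Re w + real (r * m))"
      using x by (simp add: powr_add powr_realpow del: of_nat_mult)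
    also have "\<dots> \<le> G * x powr real P"
    proof (intro mult_left_mono powr_mono)
      have "real (r * m) \<le> real (r * M)" using m by (intro of_nat_mono mult_le_mono2) auto
      then show "Re w + real (r * m) \<le> real P" using Re_cball [OF w] P by linarith
    qed (use G x in auto)
    finally show ?thesis using x by (simp add: powr_realpow)
  qed
  define F where "F = E * (real M * G)"
  have "((\<lambda>x::real. F * (x ^ (L + P) * exp (- x))) \<longlongrightarrow> 0) at_top" by real_asymp
  then have ev: "eventually (\<lambda>x. F * (x ^ (L + P) * exp (- x)) < d / 2) at_top"
    using d by (intro order_tendstoD) auto
  show "eventually (\<lambda>x. \<forall>w\<in>cball w0 1. dist (of_real (x ^ L * exp (- x)) * (?R x w)) 0 < d) at_top"
    using ev eventually_ge_at_top [of 1]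
  proof eventually_elim
    case (elim x)
    show ?case
    proof
      fix w assume w: "w \<in> cball w0 1"
      have x: "x > 0" using elim by simp
      define g where "g m = cmod (exp_term x (r * m) w)" for m
      have g0: "g m \<ge> 0" for m by (simp add: g_def)
      have sg: "summable g"
        using exp_term_uniform_summable [OF w0 r x] w unfolding g_def
        by (auto intro: summable_comparison_test' [of _ 0])
      have sg1: "summable (\<lambda>m. g m / (real m + 1) ^ L)"
      proof (rule summable_comparison_test' [OF sg, of 0])
        fix m :: nat
        have "g m / (real m + 1) ^ L \<le> g m / 1" by (intro divide_left_mono g0) auto
        then show "norm (g m / (real m + 1) ^ L) \<le> g m" using g0 [of m] by simp
      qed
      have sf: "(\<lambda>m. g m * (if m < M then E else 0)) sums (\<Sum>m<M. g m * E)"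
        using sums_If_finite_set [of "{..<M}" "\<lambda>m. g m * E"] by (simp add: if_distrib cong: if_cong)
      have s2: "summable (\<lambda>m. \<delta> * (g m / (real m + 1) ^ L) + g m * (if m < M then E else 0))"
        by (intro summable_add summable_mult sg1 sums_summable [OF sf])
      have le: "cmod (u m * exp_term x (r * m) w * e m w) \<le> \<delta> * (g m / (real m + 1) ^ L)
          + g m * (if m < M then E else 0)" for m
      proof -
        have "cmod (u m * exp_term x (r * m) w * e m w) \<le> 1 * g m * (\<epsilon> m / (real m + 1) ^ L)"
          unfolding norm_mult g_def using u [of m] e [OF w, of m] by (intro mult_mono) auto
        also have "\<dots> \<le> 1 * g m * (\<delta> / (real m + 1) ^ L + (if m < M then E else 0))"
          using g0 [of m] by (intro mult_left_mono \<epsilon>_le) auto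
        finally show ?thesis by (simp add: distrib_left mult.commute)
      qed
      have sn: "summable (\<lambda>m. cmod (u m * exp_term x (r * m) w * e m w))"
        by (rule summable_comparison_test' [OF s2, of 0]) (use le in auto)
      have "cmod (?R x w) \<le> (suminf (\<lambda>m. cmod (u m * exp_term x (r * m) w * e m w)))"
        by (rule summable_norm [OF sn])
      also have "\<dots> \<le> (suminf (\<lambda>m. \<delta> * (g m / (real m + 1) ^ L) + g m * (if m < M then E else 0)))"
        by (intro suminf_le le sn s2)
      also have "\<dots> = \<delta> * (suminf (\<lambda>m. g m / (real m + 1) ^ L)) + (\<Sum>m<M. g m * E)"
        unfolding suminf_mult [OF sg1, symmetric] sums_unique [OF sf]
        by (intro suminf_add [symmetric] summable_mult sg1 sums_summable [OF sf])
      also have "\<dots> \<le> \<delta> * (C * (exp x / x ^ L)) + (\<Sum>m<M. G * x ^ P * E)"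
        using C(2) [OF w x] et [OF w elim(2)] \<delta> E(1) unfolding g_def
        by (intro add_mono mult_left_mono sum_mono mult_right_mono) auto
      also have "\<dots> = (\<delta> * C) * (exp x / x ^ L) + F * x ^ P"
        by (simp add: F_def)
      also have "\<dots> = d / 2 * (exp x / x ^ L) + F * x ^ P"
        by (simp only: \<delta>(2))
      finally have "cmod (?R x w) \<le> d / 2 * (exp x / x ^ L) + F * x ^ P" .
      then have "(x ^ L * exp (- x)) * cmod (?R x w)
           \<le> (x ^ L * exp (- x)) * (d / 2 * (exp x / x ^ L) + F * x ^ P)"
        using x by (intro mult_left_mono) auto
      also have "\<dots> = d / 2 + F * (x ^ (L + P) * exp (- x))"
        using x by (simp add: distrib_left exp_minus power_add field_simps)
      also have "\<dots> < d" using elim(1) by simp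
      finally show "dist (of_real (x ^ L * exp (- x)) * (?R x w)) 0 < d"
        using x by (simp add: norm_mult norm_power)
    qed
  qed
qed

section \<open>Inverse factorial expansions\<close>

text \<open>The sequence \<open>g\<close>, with a holomorphic parameter \<open>w\<close>, has the expansion
  \<open>g u w = (\<Sum>j\<le>L. c j w \<Gamma>(1 + u + w) / \<Gamma>(1 + u + w + j)) + O(u\<^bsup>-L-1\<^esup>)\<close>, uniformly for \<open>w\<close> in the unit disc
  around \<open>w0\<close>.\<close>

definition inv_fact_expansion ::
    "complex \<Rightarrow> nat \<Rightarrow> (nat \<Rightarrow> complex \<Rightarrow> complex) \<Rightarrow> (nat \<Rightarrow> complex \<Rightarrow> complex) \<Rightarrow> bool" where
  "inv_fact_expansion w0 L c g \<longleftrightarrow> (\<forall>j. c j holomorphic_on UNIV) \<and>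
     (\<exists>C\<ge>0. \<forall>u. \<forall>w\<in>cball w0 1.
        cmod (g u w - (\<Sum>j\<le>L. c j w / rising u w j)) \<le> C / (real u + 1) ^ Suc L)"

lemma norm_pochhammer_shift_ge:
  assumes "Re w \<ge> 0"
  shows "(real u + 1) ^ j \<le> cmod (rising u w j)"
proof -
  have "(real u + 1) ^ j = (\<Prod>i<j. real u + 1)" by simp
  also have "\<dots> \<le> (\<Prod>i<j. Re (1 + (of_nat u + w)) + real i)"
    using assms by (intro prod_mono) auto
  also have "\<dots> = pochhammer (Re (1 + (of_nat u + w))) j"
    by (simp add: pochhammer_prod atLeast0LessThan)
  also have "\<dots> \<le> cmod (rising u w j)"
    using assms by (intro norm_pochhammer_ge) auto
  finally show ?thesis .
qed

lemma inv_fact_expansion_add_small: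
  assumes "inv_fact_expansion w0 L c g" "C \<ge> 0"
    and "\<And>u w. w \<in> cball w0 1 \<Longrightarrow> cmod (g' u w - g u w) \<le> C / (real u + 1) ^ Suc L"
  shows "inv_fact_expansion w0 L c g'"
proof -
  obtain D where D: "D \<ge> 0" "\<And>u w. w \<in> cball w0 1 \<Longrightarrow>
        cmod (g u w - (\<Sum>j\<le>L. c j w / rising u w j)) \<le> D / (real u + 1) ^ Suc L"
    using assms(1) unfolding inv_fact_expansion_def by blast
  have "cmod (g' u w - (\<Sum>j\<le>L. c j w / rising u w j)) \<le> (C + D) / (real u + 1) ^ Suc L"
    if "w \<in> cball w0 1" for u w
  proof -
    have "g' u w - (\<Sum>j\<le>L. c j w / rising u w j)
      = (g' u w - g u w) + (g u w - (\<Sum>j\<le>L. c j w / rising u w j))" by simp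
    also have "cmod \<dots> \<le> C / (real u + 1) ^ Suc L + D / (real u + 1) ^ Suc L"
      by (intro norm_triangle_mono assms(3) D(2) that)
    finally show ?thesis by (simp only: add_divide_distrib)
  qed
  with assms D(1) show ?thesis
    unfolding inv_fact_expansion_def by (intro conjI exI [of _ "C + D"]) auto
qed

lemma inv_fact_expansion_add:
  assumes "inv_fact_expansion w0 L c g" "inv_fact_expansion w0 L c' g'"
  shows "inv_fact_expansion w0 L (\<lambda>j w. c j w + c' j w) (\<lambda>u w. g u w + g' u w)"
proof -
  obtain D where D: "D \<ge> 0" "\<And>u w. w \<in> cball w0 1 \<Longrightarrow>
        cmod (g u w - (\<Sum>j\<le>L. c j w / rising u w j)) \<le> D / (real u + 1) ^ Suc L"
    using assms(1) unfolding inv_fact_expansion_def by blast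
  obtain D' where D': "D' \<ge> 0" "\<And>u w. w \<in> cball w0 1 \<Longrightarrow>
        cmod (g' u w - (\<Sum>j\<le>L. c' j w / rising u w j)) \<le> D' / (real u + 1) ^ Suc L"
    using assms(2) unfolding inv_fact_expansion_def by blast
  have "cmod (g u w + g' u w - (\<Sum>j\<le>L. (c j w + c' j w) / rising u w j))
      \<le> (D + D') / (real u + 1) ^ Suc L"
    if "w \<in> cball w0 1" for u w
  proof -
    have "g u w + g' u w - (\<Sum>j\<le>L. (c j w + c' j w) / rising u w j)
      = (g u w - (\<Sum>j\<le>L. c j w / rising u w j)) + (g' u w - (\<Sum>j\<le>L. c' j w / rising u w j))"
      by (simp add: add_divide_distrib sum.distrib)
    also have "cmod \<dots> \<le> D / (real u + 1) ^ Suc L + D' / (real u + 1) ^ Suc L"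
      by (intro norm_triangle_mono D(2) D'(2) that)
    finally show ?thesis by (simp only: add_divide_distrib)
  qed
  with assms D(1) D'(1) show ?thesis
    unfolding inv_fact_expansion_def
    by (intro conjI exI [of _ "D + D'"]) (auto intro!: holomorphic_intros)
qed

lemma inv_fact_expansion_cmult:
  assumes "inv_fact_expansion w0 L c g" "h holomorphic_on UNIV"
  shows "inv_fact_expansion w0 L (\<lambda>j w. h w * c j w) (\<lambda>u w. h w * g u w)"
proof -
  obtain D where D: "D \<ge> 0" "\<And>u w. w \<in> cball w0 1 \<Longrightarrow>
        cmod (g u w - (\<Sum>j\<le>L. c j w / rising u w j)) \<le> D / (real u + 1) ^ Suc L"
    using assms(1) unfolding inv_fact_expansion_def by blast
  have "continuous_on (cball w0 1) h"
    using assms(2) by (meson holomorphic_on_imp_continuous_on holomorphic_on_subset subset_UNIV)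
  from compact_bound [OF this] obtain H where H: "H > 0" "\<And>w. w \<in> cball w0 1 \<Longrightarrow> cmod (h w) \<le> H"
  by blast
  have "cmod (h w * g u w - (\<Sum>j\<le>L. (h w * c j w) / rising u w j)) \<le> (H * D) / (real u + 1) ^ Suc L"
    if w: "w \<in> cball w0 1" for u w
  proof -
    have "h w * g u w - (\<Sum>j\<le>L. (h w * c j w) / rising u w j)
      = h w * (g u w - (\<Sum>j\<le>L. c j w / rising u w j))"
      by (simp add: right_diff_distrib sum_distrib_left)
    also have "cmod \<dots> \<le> H * (D / (real u + 1) ^ Suc L)"
      unfolding norm_mult using H D(2) [OF w, of u] w by (intro mult_mono) auto
    finally show ?thesis by simp
  qed
  with assms D(1) H(1) show ?thesis
    unfolding inv_fact_expansion_def
    by (intro conjI exI [of _ "H * D"]) (auto intro!: holomorphic_intros)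
qed

lemma inv_fact_expansion_0: "inv_fact_expansion w0 L (\<lambda>_ _. 0) (\<lambda>_ _. 0)"
  unfolding inv_fact_expansion_def by (auto intro: exI [of _ 0])

lemma inv_fact_expansion_sum:
  assumes "\<And>i. i \<in> I \<Longrightarrow> inv_fact_expansion w0 L (c i) (g i)"
  shows "inv_fact_expansion w0 L (\<lambda>j w. \<Sum>i\<in>I. c i j w) (\<lambda>u w. \<Sum>i\<in>I. g i u w)"
  using assms
  by (induction I rule: infinite_finite_induct) (simp_all add: inv_fact_expansion_0 inv_fact_expansion_add)

lemma inv_fact_expansion_pochhammer:
  assumes "j \<le> L"
  shows "inv_fact_expansion w0 L (\<lambda>i _. if i = j then 1 else 0) (\<lambda>u w. 1 / rising u w j)"
proof -
  have "(\<Sum>i\<le>L. (if i = j then 1 else 0) / rising u w i) = 1 / rising u w j" for u and w :: complex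
  proof -
    have "(\<Sum>i\<le>L. (if i = j then 1 else 0) / rising u w i)
        = (\<Sum>i\<le>L. if i = j then 1 / rising u w i else 0)"
      by (intro sum.cong) auto
    then show ?thesis using assms by simp
  qed
  then show ?thesis unfolding inv_fact_expansion_def by (auto intro: exI [of _ 0])
qed

text \<open>Downward induction on \<open>j\<close>, starting at \<open>j = L\<close> where the term is itself a remainder.  The step is the
  identity \<open>1/v = 1/s + (s - v) / (v s)\<close> for \<open>v = u + q\<close> and \<open>s = 1 + u + w + j\<close>, in which \<open>s - v\<close> does
  not depend on \<open>u\<close>.\<close>

lemma inv_fact_expansion_inverse:
  assumes w0: "Re w0 \<ge> 3" and q: "q > 0"
  shows "\<exists>c. c 0 = (\<lambda>_. 0) \<and>
    inv_fact_expansion w0 L c (\<lambda>u w. 1 / (of_nat u + of_nat q) / rising u w j)"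
proof (induction "L - j" arbitrary: j)
  case 0
  then have j: "j \<ge> L" by simp
  have "inv_fact_expansion w0 L (\<lambda>_ _. 0) (\<lambda>u w. 1 / (of_nat u + of_nat q) / rising u w j)"
  proof (rule inv_fact_expansion_add_small [OF inv_fact_expansion_0, of 1])
    fix u w assume w: "w \<in> cball w0 1"
    have "(real u + 1) ^ Suc L \<le> (real u + 1) * (real u + 1) ^ j"
      unfolding power_Suc using j by (intro mult_left_mono power_increasing) auto
    also have "\<dots> \<le> (real u + real q) * cmod (rising u w j)"
      using q Re_cball [OF w] w0 by (intro mult_mono norm_pochhammer_shift_ge) auto
    finally have "1 / ((real u + real q) * cmod (rising u w j)) \<le> 1 / (real u + 1) ^ Suc L"
    proof (intro divide_left_mono)
      show "0 < (real u + real q) * cmod (rising u w j) * (real u + 1) ^ Suc L"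
        using q Re_cball [OF w] w0
        by (intro mult_pos_pos order_less_le_trans [OF _ norm_pochhammer_shift_ge]) auto
    qed auto
    moreover have "cmod (of_nat u + of_nat q) = real u + real q"
      by (metis norm_of_nat of_nat_add)
    ultimately show "cmod (1 / (of_nat u + of_nat q) / rising u w j - 0) \<le> 1 / (real u + 1) ^ Suc L"
      by (simp add: norm_divide norm_mult)
  qed simp
  then show ?case by (intro exI [of _ "\<lambda>_ _. 0"]) simp
next
  case (Suc d)
  then have j: "Suc j \<le> L" "d = L - Suc j" by auto
  obtain c where c: "c 0 = (\<lambda>_. 0)"
    "inv_fact_expansion w0 L c (\<lambda>u w. 1 / (of_nat u + of_nat q) / rising u w (Suc j))"
    using Suc.hyps(1) [OF j(2)] by blast
  define c' where "c' = (\<lambda>i w. (if i = Suc j then 1 else 0)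
      + (w - of_nat q + of_nat j + 1) * c i w)"
  have "inv_fact_expansion w0 L c' (\<lambda>u w. 1 / rising u w (Suc j) +
        (w - of_nat q + of_nat j + 1) * (1 / (of_nat u + of_nat q) / rising u w (Suc j)))"
    unfolding c'_def using j(1) c(2)
    by (intro inv_fact_expansion_add inv_fact_expansion_pochhammer inv_fact_expansion_cmult) (auto
        intro!: holomorphic_intros)
  then have "inv_fact_expansion w0 L c' (\<lambda>u w. 1 / (of_nat u + of_nat q) / rising u w j)"
  proof (rule inv_fact_expansion_add_small [of _ _ _ _ 0])
    fix u w assume w: "w \<in> cball w0 1"
    have "Re (1 + (of_nat u + w) + of_nat j) > 0" using Re_cball [OF w] w0 by simp
    then have a: "1 + (of_nat u + w) + of_nat j \<noteq> 0" by (metis less_irrefl zero_complex.sel(1))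
    have "complex_of_nat (u + q) \<noteq> 0" using q by (simp del: of_nat_add)
    then have b: "of_nat u + of_nat q \<noteq> (0::complex)" by simp
    have "cmod (rising u w j) > 0"
      using Re_cball [OF w] w0 by (intro order_less_le_trans [OF _ norm_pochhammer_shift_ge]) auto
    then have p: "rising u w j \<noteq> 0" by simp
    have "1 / v / p = 1 / (p * s) + (s - v) * (1 / v / (p * s))" if "v \<noteq> 0" "p \<noteq> 0" "s \<noteq> 0"
        for p s v :: complex
    proof -
      have "1 / v / p = (v + (s - v)) / (v * (p * s))" using that by simp
      also have "\<dots> = 1 / (p * s) + (s - v) * (1 / v / (p * s))"
        unfolding add_divide_distrib using that by simp
      finally show ?thesis .
    qed
    from this [OF b p a]
    have "1 / (of_nat u + of_nat q) / rising u w j -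
         (1 / rising u w (Suc j) +
          (w - of_nat q + of_nat j + 1) * (1 / (of_nat u + of_nat q) / rising u w (Suc j))) = 0"
      by (simp add: pochhammer_Suc algebra_simps)
    then show "cmod (1 / (of_nat u + of_nat q) / rising u w j -
         (1 / rising u w (Suc j) +
          (w - of_nat q + of_nat j + 1) * (1 / (of_nat u + of_nat q) / rising u w (Suc j))))
              \<le> 0 / (real u + 1) ^ Suc L"
      by (simp only: norm_zero)
  qed simp
  then show ?case by (intro exI [of _ c']) (simp add: c'_def c(1))
qed

lemma inv_fact_expansion_inverse_power:
  assumes w0: "Re w0 \<ge> 3" and q: "q > 0"
  shows "\<exists>c. c 0 = (\<lambda>_. if l = 0 then 1 else 0)
      \<and> inv_fact_expansion w0 L c (\<lambda>u w. 1 / (of_nat u + of_nat q) ^ l)"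
proof (induction l)
  case 0
  show ?case
    using inv_fact_expansion_pochhammer [of 0 L w0]
    by (intro exI [of _ "\<lambda>i _. if i = 0 then 1 else 0"]) auto
next
  case (Suc l)
  then obtain c where c: "inv_fact_expansion w0 L c (\<lambda>u w. 1 / (of_nat u + of_nat q) ^ l)" by blast
  obtain D where D: "D \<ge> 0" "\<And>u w. w \<in> cball w0 1 \<Longrightarrow>
        cmod (1 / (of_nat u + of_nat q) ^ l - (\<Sum>j\<le>L. c j w / rising u w j))
            \<le> D / (real u + 1) ^ Suc L"
    using c unfolding inv_fact_expansion_def by blast
  have "\<forall>i. \<exists>c. c 0 = (\<lambda>_. 0) \<and>
    inv_fact_expansion w0 L c (\<lambda>u w. 1 / (of_nat u + of_nat q) / rising u w i)"
    using inv_fact_expansion_inverse [OF w0 q] by blast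
  from choice [OF this] obtain d where d: "\<And>i. d i 0 = (\<lambda>_. 0)"
    "\<And>i. inv_fact_expansion w0 L (d i) (\<lambda>u w. 1 / (of_nat u + of_nat q) / rising u w i)"
    by blast
  define c' where "c' = (\<lambda>j w. \<Sum>i\<le>L. c i w * d i j w)"
  have "inv_fact_expansion w0 L c' (\<lambda>u w. \<Sum>i\<le>L. c i w * (1 / (of_nat u + of_nat q) / rising u w i))"
    unfolding c'_def using c unfolding inv_fact_expansion_def [of w0 L c]
    by (intro inv_fact_expansion_sum inv_fact_expansion_cmult d) auto
  then have "inv_fact_expansion w0 L c' (\<lambda>u w. 1 / (of_nat u + of_nat q) ^ Suc l)"
  proof (rule inv_fact_expansion_add_small [of _ _ _ _ D])
    fix u w assume w: "w \<in> cball w0 1"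
    have "1 / (of_nat u + of_nat q) ^ Suc l
        - (\<Sum>i\<le>L. c i w * (1 / (of_nat u + of_nat q) / rising u w i))
      = (1 / (of_nat u + of_nat q)) * (1 / (of_nat u + of_nat q) ^ l
          - (\<Sum>j\<le>L. c j w / rising u w j))"
      by (simp add: right_diff_distrib sum_distrib_left mult_ac)
    also have "cmod \<dots> \<le> 1 * (D / (real u + 1) ^ Suc L)"
      unfolding norm_mult
    proof (intro mult_mono D(2) w)
      have "cmod (of_nat u + of_nat q) = real u + real q" by (metis norm_of_nat of_nat_add)
      then show "cmod (1 / (of_nat u + of_nat q)) \<le> 1"
        using q by (simp add: norm_divide)
    qed auto
    finally show "cmod (1 / (of_nat u + of_nat q) ^ Suc l
        - (\<Sum>i\<le>L. c i w * (1 / (of_nat u + of_nat q) / rising u w i))) \<le> D / (real u + 1) ^ Suc L"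
      by simp
  qed (use D in simp)
  then show ?case by (intro exI [of _ c']) (simp add: c'_def d(1))
qed

section \<open>Asymptotics of scalar series, with derivatives in the exponent\<close>

lemma uniform_limit_0_dominated:
  fixes f :: "real \<Rightarrow> complex \<Rightarrow> complex"
  assumes "eventually (\<lambda>x. \<forall>w\<in>S. cmod (f x w) \<le> g x) at_top" "(g \<longlongrightarrow> 0) at_top"
  shows "uniform_limit S f (\<lambda>_. 0) at_top"
proof (rule uniform_limitI)
  fix e :: real assume "e > 0"
  with assms(2) have "eventually (\<lambda>x. g x < e) at_top" by (intro order_tendstoD)
  with assms(1) show "eventually (\<lambda>x. \<forall>w\<in>S. dist (f x w) 0 < e) at_top"
    by eventually_elim force
qed

lemma uniform_limit_0_sum:
  fixes f :: "'i \<Rightarrow> real \<Rightarrow> complex \<Rightarrow> complex"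
  assumes "\<And>i. i \<in> I \<Longrightarrow> uniform_limit S (f i) (\<lambda>_. 0) at_top"
  shows "uniform_limit S (\<lambda>x w. \<Sum>i\<in>I. f i x w) (\<lambda>_. 0) at_top"
  using assms
proof (induction I rule: infinite_finite_induct)
  case (insert i I)
  then show ?case using uniform_limit_add
      [where X = S and f = "f i" and l = "\<lambda>_. 0" and F = at_top and g = "\<lambda>x w. \<Sum>i\<in>I. f i x w" and m
      = "\<lambda>_. 0"]
    by simp
qed (auto intro: uniform_limit_const)

lemma summable_exp_term_bounded_coeff:
  assumes "Re w \<ge> 0" "x > 0" "r > 0" "\<And>m. cmod (c m) \<le> K"
  shows "summable (\<lambda>m. exp_term x (r * m) w * c m)"
proof (rule summable_comparison_test' [of _ 0])
  show "summable (\<lambda>m. cmod (exp_term x (r * m) w) * K)"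
    using summable_sparse [OF summable_exp_term_abs [OF assms(1,2)] assms(3)]
    by (intro summable_mult2) simp
  show "cmod (exp_term x (r * m) w * c m) \<le> cmod (exp_term x (r * m) w) * K" for m
    unfolding norm_mult by (intro mult_left_mono assms(4)) simp
qed

lemma norm_exp_i [simp]: "cmod (exp (\<i> * complex_of_real t)) = 1"
  by (simp flip: cis_conv_exp)

text \<open>Each inverse factorial in the expansion of the coefficients contributes \<open>sparse_exp\<close> at the exponent
  \<open>w + j\<close>, divided by \<open>x\<^sup>j\<close>.  The coefficients are indexed from \<open>q\<close> on because a truncation of the series
  is what moves the exponent into the half-plane \<open>Re w0 \<ge> 3\<close>.\<close>

lemma exp_series_uniform_asymp:
  fixes r q L :: nat and a \<eta> A' :: "nat \<Rightarrow> complex" and \<omega> :: real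
  defines "u \<equiv> \<lambda>m. exp (\<i> * of_real (\<omega> * real (r * m)))"
  assumes w0: "Re w0 \<ge> 3" and r: "r > 0" and q: "q > 0"
    and a: "\<And>m. a m = (\<Sum>l\<le>L. A' l / of_nat (m + q) ^ l) + \<eta> m"
    and \<eta>: "(\<lambda>m. cmod (\<eta> m) * (real m + 1) ^ L) \<longlonglongrightarrow> 0"
  shows "\<exists>b. (\<forall>j. b j holomorphic_on UNIV) \<and> b 0 = (\<lambda>_. A' 0) \<and>
    uniform_limit (cball w0 1)
      (\<lambda>x w. of_real (x ^ L) * (of_real (exp (- x))
          * (suminf (\<lambda>m. u m * exp_term x (r * m) w * a m))
         - (if exp (\<i> * of_real (\<omega> * real r)) = 1 then 1 / of_nat r else 0)
             * (\<Sum>j\<le>L. b j w / of_real x ^ j)))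
      (\<lambda>_. 0) at_top"
proof -
  \<comment> \<open>The limit of \<open>e\<^bsup>-x\<^esup> sparse_exp \<omega> r x w\<close>, whatever \<open>w\<close> is.\<close>
  define \<rho> where "\<rho> = (if exp (\<i> * complex_of_real (\<omega> * real r)) = 1 then 1 / complex_of_nat r
      else 0)"
  have u: "cmod (u m) = 1" for m unfolding u_def by simp
  have rq: "r * q > 0" using r q by simp
  have "\<forall>l. \<exists>c. c 0 = (\<lambda>_. if l = 0 then 1 else 0) \<and>
      inv_fact_expansion w0 L c (\<lambda>u w. 1 / (of_nat u + of_nat (r * q)) ^ l)"
    using inv_fact_expansion_inverse_power [OF w0 rq] by blast
  from choice [OF this] obtain c where c: "\<And>l. c l 0 = (\<lambda>_. if l = 0 then 1 else 0)"
    "\<And>l. inv_fact_expansion w0 L (c l) (\<lambda>u w. 1 / (of_nat u + of_nat (r * q)) ^ l)"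
    by blast
  define b where "b = (\<lambda>j w. \<Sum>l\<le>L. (A' l * of_nat r ^ l) * c l j w)"
  define g where "g = (\<lambda>(u::nat) (w::complex). \<Sum>l\<le>L. (A' l * of_nat r ^ l)
      * (1 / (of_nat u + of_nat (r * q)) ^ l))"
  have b: "inv_fact_expansion w0 L b g"
    unfolding b_def g_def by (intro inv_fact_expansion_sum inv_fact_expansion_cmult c) auto
  have b_hol: "b j holomorphic_on UNIV" for j using b by (simp add: inv_fact_expansion_def)
  have "b 0 = (\<lambda>_. \<Sum>l\<le>L. if l = 0 then A' 0 else 0)"
    unfolding b_def c(1) by (intro ext sum.cong) auto
  then have b0: "b 0 = (\<lambda>_. A' 0)" by simp
  obtain D where D: "D \<ge> 0" "\<And>u w. w \<in> cball w0 1 \<Longrightarrow>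
        cmod (g u w - (\<Sum>j\<le>L. b j w / rising u w j)) \<le> D / (real u + 1) ^ Suc L"
    using b unfolding inv_fact_expansion_def by blast
  have g: "a m = g (r * m) w + \<eta> m" for m w
  proof -
    have "A' l * of_nat r ^ l * (1 / (of_nat (r * m) + of_nat (r * q)) ^ l)
        = A' l / of_nat (m + q) ^ l" for l
    proof -
      have "(of_nat (r * m) + of_nat (r * q) :: complex) = of_nat r * of_nat (m + q)"
        by (simp add: distrib_left)
      then show ?thesis using r by (simp add: power_mult_distrib)
    qed
    then show ?thesis unfolding a g_def by simp
  qed
  define e where "e m w = a m - (\<Sum>j\<le>L. b j w / rising (r * m) w j)" for m w
  define \<epsilon> where "\<epsilon> m = D / (real m + 1) + cmod (\<eta> m) * (real m + 1) ^ L" for m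
  have e: "cmod (e m w) \<le> \<epsilon> m / (real m + 1) ^ L" if w: "w \<in> cball w0 1" for m w
  proof -
    have "e m w = (g (r * m) w - (\<Sum>j\<le>L. b j w / rising (r * m) w j)) + \<eta> m"
      unfolding e_def g [of m w] by simp
    also have "cmod \<dots> \<le> D / (real (r * m) + 1) ^ Suc L + cmod (\<eta> m)"
      by (intro norm_triangle_mono D(2) w order_refl)
    also have "D / (real (r * m) + 1) ^ Suc L \<le> D / (real m + 1) ^ Suc L"
    proof (intro divide_left_mono D(1) power_mono add_right_mono)
      have "m \<le> r * m" using r by simp
      then show "real m \<le> real (r * m)" by (rule of_nat_mono)
    qed (auto intro!: mult_pos_pos zero_less_power add_nonneg_pos)
    finally have "cmod (e m w) \<le> D / (real m + 1) ^ Suc L + cmod (\<eta> m)" by simp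
    also have "\<dots> = \<epsilon> m / (real m + 1) ^ L"
    proof -
      have "real m + 1 \<noteq> 0" by (metis add_nonneg_pos less_irrefl of_nat_0_le_iff zero_less_one)
      then show ?thesis by (simp add: \<epsilon>_def add_divide_distrib)
    qed
    finally show ?thesis .
  qed
  have "(\<lambda>m. D / (real m + 1)) \<longlonglongrightarrow> 0" by real_asymp
  from tendsto_add [OF this \<eta>] have \<epsilon>: "\<epsilon> \<longlonglongrightarrow> 0" unfolding \<epsilon>_def [abs_def] by simp
  obtain K where K: "\<And>m. \<bar>\<epsilon> m\<bar> \<le> K"
    using convergent_imp_Bseq [OF convergentI [OF \<epsilon>]] by (auto simp: Bseq_def)
  have e_K: "cmod (e m w) \<le> K" if w: "w \<in> cball w0 1" for m w
  proof -
    have p: "1 \<le> (real m + 1) ^ L" by (rule one_le_power) simp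
    have "cmod (e m w) \<le> \<epsilon> m / (real m + 1) ^ L" by (rule e [OF w])
    also have "\<dots> \<le> \<bar>\<epsilon> m\<bar> / (real m + 1) ^ L" using p by (intro divide_right_mono) auto
    also have "\<dots> \<le> \<bar>\<epsilon> m\<bar> / 1" using p by (intro divide_left_mono) auto
    also have "\<dots> \<le> K" using K by simp
    finally show ?thesis .
  qed
  define S where "S j x w = sparse_exp \<omega> r x (w + of_nat j)" for j x w
  let ?A = "\<lambda>x w. suminf (\<lambda>m. u m * exp_term x (r * m) w * a m)"
  let ?R = "\<lambda>x w. suminf (\<lambda>m. u m * exp_term x (r * m) w * e m w)"
  let ?E = "\<lambda>j x w. of_real (x ^ L) * (b j w / of_real x ^ j * (of_real (exp (- x)) * S j x w - \<rho>))"
  have split: "(?A x w)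
      = (\<Sum>j\<le>L. b j w / of_real x ^ j * S j x w) + (?R x w)"
    if w: "w \<in> cball w0 1" and x: "x > 0" for x w
  proof -
    have Re_w: "Re w \<ge> 2" using Re_cball [OF w] w0 by auto
    have 1: "(\<lambda>m. \<Sum>j\<le>L. b j w / of_real x ^ j * (u m * exp_term x (r * m) (w + of_nat j)))
        sums (\<Sum>j\<le>L. b j w / of_real x ^ j * S j x w)"
      unfolding S_def u_def using Re_w x r by (intro sums_sum sums_mult sparse_exp_sums) auto
    have "summable (\<lambda>m. exp_term x (r * m) w * (u m * e m w))"
      using Re_w x r e_K [OF w]
      by (intro summable_exp_term_bounded_coeff [of _ _ _ _ K]) (auto simp: norm_mult u)
    then have 2: "(\<lambda>m. u m * exp_term x (r * m) w * e m w) sums (?R x w)"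
      by (simp add: mult_ac summable_sums)
    have eq: "(\<Sum>j\<le>L. b j w / of_real x ^ j * (u m * exp_term x (r * m) (w + of_nat j)))
        + u m * exp_term x (r * m) w * e m w
        = u m * exp_term x (r * m) w * a m" for m
    proof -
      have "b j w / of_real x ^ j * (u m * exp_term x (r * m) (w + of_nat j))
          = u m * exp_term x (r * m) w * (b j w / rising (r * m) w j)" for j
      proof -
        have "cmod (rising (r * m) w j) > 0"
          using Re_w by (intro order_less_le_trans [OF _ norm_pochhammer_shift_ge]) (auto
              intro!: zero_less_power add_nonneg_pos)
        then have "rising (r * m) w j \<noteq> 0" by simp
        then show ?thesis
          unfolding exp_term_shift [OF x, of "r * m" w j] by simp
      qed
      then have "(\<Sum>j\<le>L. b j w / of_real x ^ j * (u m * exp_term x (r * m) (w + of_nat j)))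
         = u m * exp_term x (r * m) w * (\<Sum>j\<le>L. b j w / rising (r * m) w j)"
        by (simp add: sum_distrib_left)
      then show ?thesis by (simp add: e_def right_diff_distrib)
    qed
    from sums_add [OF 1 2] show ?thesis unfolding eq by (rule sums_unique [symmetric])
  qed
  have main: "uniform_limit (cball w0 1) (\<lambda>x w. ?E j x w) (\<lambda>_. 0) at_top"
    if j: "j \<le> L" for j
  proof -
    have "continuous_on (cball w0 1) (b j)"
      using b_hol by (meson holomorphic_on_imp_continuous_on holomorphic_on_subset subset_UNIV)
    from compact_bound [OF this] obtain B where B: "B > 0" "\<And>w. w \<in> cball w0 1 \<Longrightarrow> cmod (b j w) \<le> B"
    by blast
    obtain C k where C: "C > 0" "k < (1::real)" "\<And>w x. w \<in> cball (w0 + of_nat j) 1 \<Longrightarrow> x > 0 \<Longrightarrow>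
        cmod (sparse_exp \<omega> r x w - (if exp (\<i> * of_real (\<omega> * real r)) = 1 then exp x / of_nat r
            else 0)) \<le> C * exp (k * x)"
      using sparse_exp_asymp [of "w0 + of_nat j" r \<omega>] w0 r by auto
    show ?thesis
    proof (rule uniform_limit_0_dominated)
      have "((\<lambda>x::real. B * C * (x ^ L * exp (- ((1 - k) * x)))) \<longlongrightarrow> 0) at_top"
        using C(2) by real_asymp
      then show "((\<lambda>x. B * C * (x ^ L * exp ((k - 1) * x))) \<longlongrightarrow> 0) at_top"
        by (simp add: algebra_simps)
      show "eventually (\<lambda>x. \<forall>w\<in>cball w0 1. cmod (?E j x w)
           \<le> B * C * (x ^ L * exp ((k - 1) * x))) at_top"
        using eventually_ge_at_top [of 1]
      proof eventually_elim
        case (elim x)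
        then have x: "x > 0" by simp
        show ?case
        proof
          fix w assume w: "w \<in> cball w0 1"
          then have w': "w + of_nat j \<in> cball (w0 + of_nat j) 1" by (simp add: dist_norm)
          have "of_real (exp (- x)) * S j x w - \<rho>
              = of_real (exp (- x)) * (S j x w - of_real (exp x) * \<rho>)"
            by (simp add: right_diff_distrib flip: mult.assoc of_real_mult exp_add)
          also have "of_real (exp x) * \<rho>
              = (if exp (\<i> * of_real (\<omega> * real r)) = 1 then exp x / of_nat r else 0)"
            by (simp add: \<rho>_def)
          finally have "cmod (of_real (exp (- x)) * S j x w - \<rho>) \<le> exp (- x) * (C * exp (k * x))"
            using C(3) [OF w' x] by (simp add: norm_mult S_def)
          also have "\<dots> = C * exp ((k - 1) * x)"
            by (simp add: left_diff_distrib exp_diff exp_minus field_simps)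
          finally have 1: "cmod (of_real (exp (- x)) * S j x w - \<rho>) \<le> C * exp ((k - 1) * x)" .
          have 2: "cmod (b j w / of_real x ^ j) \<le> B"
          proof -
            have "cmod (b j w / of_real x ^ j) = cmod (b j w) / x ^ j" using x
            by (simp add: norm_divide norm_power)
            also have "\<dots> \<le> cmod (b j w) / 1" using elim x
            by (intro divide_left_mono one_le_power) auto
            finally show ?thesis using B(2) [OF w] by simp
          qed
          have "cmod (?E j x w)
              \<le> x ^ L * (B * (C * exp ((k - 1) * x)))"
            unfolding norm_mult using x B(1) 1 2 by (intro mult_mono) (auto simp: norm_power)
          then show "cmod (?E j x w)
             \<le> B * C * (x ^ L * exp ((k - 1) * x))"
            by (simp add: mult_ac)
        qed
      qed
    qed
  qed
  have rem: "uniform_limit (cball w0 1)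
           (\<lambda>x w. of_real (x ^ L * exp (- x)) * (?R x w)) (\<lambda>_. 0) at_top"
    using u by (intro remainder_uniform_limit [OF w0 r e \<epsilon>]) auto
  have sum: "uniform_limit (cball w0 1) (\<lambda>x w. \<Sum>j\<le>L. ?E j x w) (\<lambda>_. 0) at_top"
    by (rule uniform_limit_0_sum) (use main in auto)
  have tot: "uniform_limit (cball w0 1) (\<lambda>x w. (\<Sum>j\<le>L. ?E j x w)
      + of_real (x ^ L * exp (- x)) * (?R x w)) (\<lambda>_. 0) at_top"
    using uniform_limit_add [OF sum rem] by simp
  have "eventually (\<lambda>x. \<forall>w\<in>cball w0 1. (\<Sum>j\<le>L. ?E j x w)
      + of_real (x ^ L * exp (- x)) * (?R x w)
     = of_real (x ^ L) * (of_real (exp (- x)) * (?A x w)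
         - \<rho> * (\<Sum>j\<le>L. b j w / of_real x ^ j))) at_top"
    using eventually_gt_at_top [of 0]
  proof eventually_elim
    case (elim x)
    show ?case
    proof
      fix w assume w: "w \<in> cball w0 1"
      show "(\<Sum>j\<le>L. ?E j x w)
      + of_real (x ^ L * exp (- x)) * (?R x w)
     = of_real (x ^ L) * (of_real (exp (- x)) * (?A x w) - \<rho> * (\<Sum>j\<le>L. b j w / of_real x ^ j))"
        unfolding split [OF w elim]
        by (simp add: right_diff_distrib distrib_left sum_distrib_left sum_subtractf mult_ac)
    qed
  qed
  with tot have "uniform_limit (cball w0 1) (\<lambda>x w. of_real (x ^ L)
      * (of_real (exp (- x)) * (?A x w) - \<rho> * (\<Sum>j\<le>L. b j w / of_real x ^ j))) (\<lambda>_. 0) at_top"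
    by (subst (asm) uniform_limit_cong) auto
  with b_hol b0 show ?thesis unfolding \<rho>_def by blast
qed

lemma higher_deriv_sum:
  assumes "\<And>i. i \<in> I \<Longrightarrow> f i holomorphic_on S" "open S" "z \<in> S"
  shows "(deriv ^^ k) (\<lambda>w. \<Sum>i\<in>I. f i w) z = (\<Sum>i\<in>I. (deriv ^^ k) (f i) z)"
  using assms(1)
proof (induction I rule: infinite_finite_induct)
  case (insert i I)
  then have "(\<lambda>w. \<Sum>i\<in>I. f i w) holomorphic_on S" by (intro holomorphic_intros) auto
  with insert show ?case
    using higher_deriv_add [of "f i" S "\<lambda>w. \<Sum>i\<in>I. f i w" z k] assms by simp
qed simp_all

lemma holomorphic_exp_term: "x > 0 \<Longrightarrow> exp_term x s holomorphic_on S"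
  unfolding exp_term_def [abs_def] powr_def by (auto intro!: holomorphic_intros)

text \<open>Both the summation over \<open>m\<close> and the limit in \<open>x\<close> are uniform near \<open>w0\<close>, hence commute with
  differentiation in the exponent.  In particular the derivatives obey the same asymptotics, although
  each term acquires a power of \<open>ln x\<close>.\<close>

theorem exp_series_derivative_asymp:
  fixes r q L :: nat and a \<eta> A' :: "nat \<Rightarrow> complex" and \<omega> :: real
  defines "u \<equiv> \<lambda>m. exp (\<i> * of_real (\<omega> * real (r * m)))"
  assumes w0: "Re w0 \<ge> 3" and r: "r > 0" and q: "q > 0"
    and a: "\<And>m. a m = (\<Sum>l\<le>L. A' l / of_nat (m + q) ^ l) + \<eta> m"
    and \<eta>: "(\<lambda>m. cmod (\<eta> m) * (real m + 1) ^ L) \<longlonglongrightarrow> 0"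
  shows "\<exists>b H. (\<forall>j. b j holomorphic_on UNIV) \<and> b 0 = (\<lambda>_. A' 0) \<and>
    (\<forall>k. \<forall>x>0. (\<lambda>m. u m * a m * (deriv ^^ k) (exp_term x (r * m)) w0) sums H k x) \<and>
    (\<forall>k. ((\<lambda>x. of_real (x ^ L) * (of_real (exp (- x)) * H k x
         - (if exp (\<i> * of_real (\<omega> * real r)) = 1 then 1 / of_nat r else 0)
             * (\<Sum>j\<le>L. (deriv ^^ k) (b j) w0 / of_real x ^ j)))
      \<longlongrightarrow> 0) at_top)"
proof -
  define \<rho> where "\<rho> = (if exp (\<i> * complex_of_real (\<omega> * real r)) = 1 then 1 / complex_of_nat r
      else 0)"
  define h where "h x w = (suminf (\<lambda>m. u m * exp_term x (r * m) w * a m))" for x w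
  obtain b where b: "\<And>j. b j holomorphic_on UNIV" "b 0 = (\<lambda>_. A' 0)"
    and lim: "uniform_limit (cball w0 1)
      (\<lambda>x w. of_real (x ^ L) * (of_real (exp (- x)) * h x w - \<rho> * (\<Sum>j\<le>L. b j w / of_real x ^ j)))
      (\<lambda>_. 0) at_top"
    using exp_series_uniform_asymp [OF w0 r q a \<eta>, of \<omega>] unfolding \<rho>_def h_def u_def by blast
  have bj: "b j holomorphic_on A" for j A using b(1) holomorphic_on_subset by blast
  have "\<exists>K. \<forall>m. cmod (a m) \<le> K"
  proof -
    have "(\<lambda>m. A' l / of_nat (m + q) ^ l) \<longlonglongrightarrow> (if l = 0 then A' 0 else 0)" for l
    proof (cases "l = 0")
      case False
      have "(\<lambda>m. inverse (complex_of_nat (m + q)) ^ l) \<longlonglongrightarrow> 0 ^ l"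
        by (intro tendsto_power LIMSEQ_ignore_initial_segment [OF lim_inverse_n])
      from tendsto_mult_left [OF this, of "A' l"] show ?thesis
        using False by (simp add: divide_inverse power_inverse zero_power)
    qed simp
    then have "(\<lambda>m. \<Sum>l\<le>L. A' l / of_nat (m + q) ^ l) \<longlonglongrightarrow> (\<Sum>l\<le>L. if l = 0 then A' 0 else 0)"
      by (rule tendsto_sum)
    then have "Bseq (\<lambda>m. \<Sum>l\<le>L. A' l / of_nat (m + q) ^ l)"
      by (intro convergent_imp_Bseq convergentI)
    moreover have "Bseq \<eta>"
    proof (rule Bseq_eventually_mono)
      show "Bseq (\<lambda>m. cmod (\<eta> m) * (real m + 1) ^ L)"
      by (rule convergent_imp_Bseq [OF convergentI [OF \<eta>]])
      have "cmod (\<eta> m) * 1 \<le> cmod (\<eta> m) * (real m + 1) ^ L" for m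
        by (intro mult_left_mono one_le_power) auto
      then show "eventually (\<lambda>m. norm (\<eta> m) \<le> norm (cmod (\<eta> m) * (real m + 1) ^ L)) sequentially"
        by (simp add: abs_mult)
    qed
    ultimately obtain K1 K2 where "\<And>m. cmod (\<Sum>l\<le>L. A' l / of_nat (m + q) ^ l) \<le> K1" "\<And>m. cmod (\<eta> m)
        \<le> K2"
      unfolding Bseq_def by blast
    then have "cmod (a m) \<le> K1 + K2" for m
      unfolding a by (rule norm_triangle_mono)
    then show ?thesis by blast
  qed
  then obtain K where K: "\<And>m. cmod (a m) \<le> K" by blast
  have K0: "K \<ge> 0" using K [of 0] norm_ge_zero order_trans by blast
  have unif: "uniform_limit (cball w0 1) (\<lambda>n w. \<Sum>m<n. u m * exp_term x (r * m) w
      * a m) (h x) sequentially" if x: "x > 0" for x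
  proof -
    obtain M where M: "summable M" "\<And>w m. w \<in> cball w0 1 \<Longrightarrow> cmod (exp_term x (r * m) w) \<le> M m"
      using exp_term_uniform_summable [OF w0 r x] by blast
    show ?thesis
      unfolding h_def [abs_def]
    proof (rule Weierstrass_m_test [of _ _ "\<lambda>m. M m * K"])
      show "cmod (u m * exp_term x (r * m) w * a m) \<le> M m * K" if w: "w \<in> cball w0 1" for m w
        unfolding norm_mult u_def using M(2) [OF w, of m] K [of m] K0
        by (simp, intro mult_mono) (auto intro: order_trans [OF norm_ge_zero])
      show "summable (\<lambda>m. M m * K)" using M(1) by (rule summable_mult2)
    qed
  qed
  define H where "H k x = (deriv ^^ k) (h x) w0" for k x
  have sums: "(\<lambda>m. u m * a m * (deriv ^^ k) (exp_term x (r * m)) w0) sums H k x" if x: "x > 0"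
      for k x
  proof -
    have hol: "(\<lambda>w. u m * exp_term x (r * m) w * a m) holomorphic_on A" for m A
      using holomorphic_exp_term [OF x, of "r * m" A] by (intro holomorphic_intros) auto
    have "((\<lambda>n. (deriv ^^ k) (\<lambda>w. \<Sum>m<n. u m * exp_term x (r * m) w * a m) w0)
        \<longlongrightarrow> (deriv ^^ k) (h x) w0) sequentially"
    proof (rule higher_deriv_complex_uniform_limit)
      show "uniform_limit (ball w0 1) (\<lambda>n w. \<Sum>m<n. u m * exp_term x (r * m) w
          * a m) (h x) sequentially"
        using unif [OF x] by (rule uniform_limit_on_subset) auto
      show "eventually (\<lambda>n. (\<lambda>w. \<Sum>m<n. u m * exp_term x (r * m) w
          * a m) holomorphic_on ball w0 1) sequentially"
        by (intro always_eventually allI holomorphic_on_sum hol)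
    qed auto
    moreover have "(deriv ^^ k) (\<lambda>w. \<Sum>m<n. u m * exp_term x (r * m) w * a m) w0
        = (\<Sum>m<n. u m * a m * (deriv ^^ k) (exp_term x (r * m)) w0)" for n
    proof -
      have "(deriv ^^ k) (\<lambda>w. \<Sum>m<n. u m * exp_term x (r * m) w * a m) w0
          = (\<Sum>m<n. (deriv ^^ k) (\<lambda>w. u m * exp_term x (r * m) w * a m) w0)"
        by (rule higher_deriv_sum [of _ _ UNIV]) (auto intro: hol)
      also have "\<dots> = (\<Sum>m<n. (deriv ^^ k) (\<lambda>w. (u m * a m) * exp_term x (r * m) w) w0)"
        by (simp add: mult_ac)
      also have "\<dots> = (\<Sum>m<n. u m * a m * (deriv ^^ k) (exp_term x (r * m)) w0)"
        by (intro sum.cong refl higher_deriv_cmult [of _ UNIV] holomorphic_exp_term x) auto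
      finally show ?thesis .
    qed
    ultimately show ?thesis by (simp add: sums_def H_def)
  qed
  have h_hol: "h x holomorphic_on ball w0 1" if x: "x > 0" for x
  proof (rule holomorphic_uniform_limit [OF _ unif [OF x]])
    have "(\<lambda>w. \<Sum>m<n. u m * exp_term x (r * m) w * a m) holomorphic_on A" for n A
      by (intro holomorphic_intros holomorphic_exp_term x)
    then show "eventually (\<lambda>n. continuous_on (cball w0 1) (\<lambda>w. \<Sum>m<n. u m * exp_term x (r * m) w
        * a m)
        \<and> (\<lambda>w. \<Sum>m<n. u m * exp_term x (r * m) w * a m) holomorphic_on ball w0 1) sequentially"
      by (intro always_eventually allI conjI holomorphic_on_imp_continuous_on)
  qed auto
  have "((\<lambda>x. of_real (x ^ L) * (of_real (exp (- x)) * H k x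
      - \<rho> * (\<Sum>j\<le>L. (deriv ^^ k) (b j) w0 / of_real x ^ j))) \<longlongrightarrow> 0) at_top" for k
  proof -
    define F where "F x w = of_real (x ^ L)
        * (of_real (exp (- x)) * h x w - \<rho> * (\<Sum>j\<le>L. b j w / of_real x ^ j))" for x w
    have "((\<lambda>x. (deriv ^^ k) (F x) w0) \<longlongrightarrow> (deriv ^^ k) (\<lambda>_. 0) w0) at_top"
    proof (rule higher_deriv_complex_uniform_limit)
      show "uniform_limit (ball w0 1) F (\<lambda>_. 0) at_top"
        using lim unfolding F_def [abs_def] by (rule uniform_limit_on_subset) auto
      show "eventually (\<lambda>x. F x holomorphic_on ball w0 1) at_top"
        using eventually_gt_at_top [of 0]
      proof eventually_elim
        case (elim x)
        then show ?case unfolding F_def [abs_def]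
          by (intro holomorphic_intros h_hol bj) auto
      qed
    qed auto
    moreover have "eventually (\<lambda>x. (deriv ^^ k) (F x) w0
        = of_real (x ^ L) * (of_real (exp (- x)) * H k x
            - \<rho> * (\<Sum>j\<le>L. (deriv ^^ k) (b j) w0 / of_real x ^ j))) at_top"
      using eventually_gt_at_top [of 0]
    proof eventually_elim
      case (elim x)
      let ?B = "ball w0 1"
      have B: "open ?B" "w0 \<in> ?B" by auto
      have hb: "(\<lambda>w. b j w / of_real x ^ j) holomorphic_on ?B" for j
        using elim by (intro holomorphic_intros bj) auto
      have hs: "(\<lambda>w. \<Sum>j\<le>L. b j w / of_real x ^ j) holomorphic_on ?B"
        by (intro holomorphic_on_sum hb)
      have 1: "(deriv ^^ k) (F x) w0
          = of_real (x ^ L) * (deriv ^^ k) (\<lambda>w. of_real (exp (- x)) * h x w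
          - \<rho> * (\<Sum>j\<le>L. b j w / of_real x ^ j)) w0"
        unfolding F_def [abs_def] using elim
        by (intro higher_deriv_cmult [OF _ B(2,1)] holomorphic_intros h_hol hs)
      also have "(deriv ^^ k) (\<lambda>w. of_real (exp (- x)) * h x w
          - \<rho> * (\<Sum>j\<le>L. b j w / of_real x ^ j)) w0
         = (deriv ^^ k) (\<lambda>w. of_real (exp (- x)) * h x w) w0
             - (deriv ^^ k) (\<lambda>w. \<rho> * (\<Sum>j\<le>L. b j w / of_real x ^ j)) w0"
        using elim by (intro higher_deriv_diff [OF _ _ B] holomorphic_intros h_hol hs)
      also have "(deriv ^^ k) (\<lambda>w. of_real (exp (- x)) * h x w) w0 = of_real (exp (- x)) * H k x"
        unfolding H_def using elim by (intro higher_deriv_cmult [OF _ B(2,1)] h_hol)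
      also have "(deriv ^^ k) (\<lambda>w. \<rho> * (\<Sum>j\<le>L. b j w / of_real x ^ j)) w0
          = \<rho> * (deriv ^^ k) (\<lambda>w. \<Sum>j\<le>L. b j w / of_real x ^ j) w0"
        by (intro higher_deriv_cmult [OF _ B(2,1)] hs)
      also have "(deriv ^^ k) (\<lambda>w. \<Sum>j\<le>L. b j w / of_real x ^ j) w0
          = (\<Sum>j\<le>L. (deriv ^^ k) (\<lambda>w. b j w / of_real x ^ j) w0)"
        by (rule higher_deriv_sum [OF hb B])
      also have "\<dots> = (\<Sum>j\<le>L. (deriv ^^ k) (b j) w0 / of_real x ^ j)"
      proof (rule sum.cong [OF refl])
        fix j
        show "(deriv ^^ k) (\<lambda>w. b j w / of_real x ^ j) w0 = (deriv ^^ k) (b j) w0 / of_real x ^ j"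
          using higher_deriv_cmult [OF bj B(2,1), of k "1 / of_real x ^ j" j] by simp
      qed
      finally show ?case .
    qed
    ultimately show ?thesis
      by (auto intro: Lim_transform_eventually)
  qed
  with b sums show ?thesis unfolding \<rho>_def by blast
qed

section \<open>Asymptotics of cohomology-valued series\<close>

lemma exp_term_of_polar:
  assumes "T > 0" "R > 0"
  shows "exp (of_real (ln T) * (of_nat s + w)) * exp (\<i> * of_real \<theta> * (of_nat s + w))
      * rGamma (1 + (of_nat s + w))
       * (exp (of_real (ln R) * (of_nat s + w)) * exp (\<i> * of_real \<phi> * (of_nat s + w)))
     = exp (\<i> * of_real (\<theta> + \<phi>) * w)
         * (exp (\<i> * of_real ((\<theta> + \<phi>) * real s)) * exp_term (T * R) s w)"
proof -
  have "complex_of_real (T * R) powr (of_nat s + w)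
      = exp (of_real (ln T) * (of_nat s + w)) * exp (of_real (ln R) * (of_nat s + w))"
    using assms by (simp add: powr_def ln_mult Ln_of_real flip: exp_add of_real_mult) (simp add: algebra_simps)
  moreover have "exp (\<i> * of_real \<theta> * (of_nat s + w)) * exp (\<i> * of_real \<phi> * (of_nat s + w))
      = exp (\<i> * of_real (\<theta> + \<phi>) * w) * exp (\<i> * of_real ((\<theta> + \<phi>) * real s))"
    by (simp flip: exp_add) (simp add: algebra_simps)
  ultimately show ?thesis
    by (simp add: exp_term_def mult_ac)
qed

text \<open>The properties of an even class on a connected manifold with finite-dimensional cohomology on which
  the calculus with powers \<open>t\<^sup>\<beta>\<close> depends.\<close>

locale coh_exponent =
  fixes \<beta> :: "'x::topological_space cohomology" and K :: nat
  assumes scalar: "coh_comp 0 \<beta> = scalar_part \<beta> *\<^sub>C 1"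
    and nilpotent: "nilpotent_part \<beta> ^ K = 0"
    and central: "nilpotent_part \<beta> * v = v * nilpotent_part \<beta>"
begin

abbreviation "z0 \<equiv> scalar_part \<beta>"
abbreviation "\<nu> \<equiv> nilpotent_part \<beta>"

lemma coh_exp_jet: "coh_exp (c *\<^sub>C (of_nat s + \<beta>)) = jet K z0 \<nu> (\<lambda>w. exp (c * (of_nat s + w)))"
  by (rule coh_exp_eq_jet [OF scalar nilpotent])

lemma coh_exp_jet_0: "coh_exp (c *\<^sub>C \<beta>) = jet K z0 \<nu> (\<lambda>w. exp (c * w))"
  using coh_exp_jet [of c 0] by simp

lemma polar_powr_jet:
  "polar_powr R \<phi> (of_nat s + \<beta>)
      = jet K z0 \<nu> (\<lambda>w. exp (of_real (ln R) * (of_nat s + w)))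
      * jet K z0 \<nu> (\<lambda>w. exp (\<i> * of_real \<phi> * (of_nat s + w)))"
  by (simp add: polar_powr_def coh_powr_def coh_exp_jet)

lemma coh_series_term_jet:
  assumes "T > 0" "R > 0"
    and \<alpha>: "\<alpha> (r * m) = Mittag_Leffler_coeff T \<theta> (of_nat (r * m) + \<beta>) * V"
  shows "coh_series_term r \<alpha> \<beta> R \<phi> m = coh_exp ((\<i> * of_real (\<theta> + \<phi>)) *\<^sub>C \<beta>) *
     (exp (\<i> * of_real ((\<theta> + \<phi>) * real (r * m))) *\<^sub>C (jet K z0 \<nu> (exp_term (T * R) (r * m)) * V))"
proof -
  define s where "s = r * m"
  define J where "J = jet K z0 \<nu>"
  have Jm: "J (\<lambda>w. f w * g w) = J f * J g" if "f holomorphic_on UNIV" "g holomorphic_on UNIV"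
      for f g
    unfolding J_def by (rule jet_mult [OF that nilpotent])
  have Jc: "v * J f = J f * v" for v f
    unfolding J_def by (rule jet_central [symmetric]) (rule central)
  define f1 f2 f3 f4 f5 :: "complex \<Rightarrow> complex" where
    "f1 = (\<lambda>w. exp (of_real (ln T) * (of_nat s + w)))" and
    "f2 = (\<lambda>w. exp (\<i> * of_real \<theta> * (of_nat s + w)))" and
    "f3 = (\<lambda>w. rGamma (1 + (of_nat s + w)))" and
    "f4 = (\<lambda>w. exp (of_real (ln R) * (of_nat s + w)))" and
    "f5 = (\<lambda>w. exp (\<i> * of_real \<phi> * (of_nat s + w)))"
  note f_defs = f1_def f2_def f3_def f4_def f5_def
  have hol: "f1 holomorphic_on UNIV" "f2 holomorphic_on UNIV" "f3 holomorphic_on UNIV" "f4 holomorphic_on UNIV" "f5 holomorphic_on UNIV"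
    unfolding f_defs by (auto intro!: holomorphic_intros)
  have "Mittag_Leffler_coeff T \<theta> (of_nat s + \<beta>) = J f1 * J f2 * J f3"
    unfolding Mittag_Leffler_coeff_def coh_powr_def f_defs J_def
    by (simp add: coh_exp_jet coh_rGamma_eq_jet [OF scalar nilpotent])
  with \<alpha> have \<alpha>s: "\<alpha> s = J f1 * J f2 * J f3 * V"
    unfolding s_def [symmetric] by simp
  have "coh_series_term r \<alpha> \<beta> R \<phi> m = (J f1 * J f2 * J f3 * V) * (J f4 * J f5)"
    unfolding coh_series_term_def s_def [symmetric] \<alpha>s polar_powr_jet f4_def f5_def J_def ..
  also have "\<dots> = (J f1 * J f2 * J f3) * (V * J (\<lambda>w. f4 w * f5 w))"
    using hol by (simp add: Jm mult.assoc)
  also have "\<dots> = J (\<lambda>w. f1 w * f2 w * f3 w) * (J (\<lambda>w. f4 w * f5 w) * V)"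
    unfolding Jc [of V] using hol by (simp add: Jm holomorphic_on_mult)
  also have "\<dots> = J (\<lambda>w. f1 w * f2 w * f3 w * (f4 w * f5 w)) * V"
    using hol by (simp add: Jm holomorphic_on_mult mult.assoc)
  also have "(\<lambda>w. f1 w * f2 w * f3 w * (f4 w * f5 w))
     = (\<lambda>w. exp (\<i> * of_real (\<theta> + \<phi>) * w)
         * (exp (\<i> * of_real ((\<theta> + \<phi>) * real s)) * exp_term (T * R) s w))"
    unfolding f_defs by (intro ext exp_term_of_polar assms)
  also have "J \<dots> = J (\<lambda>w. exp (\<i> * of_real (\<theta> + \<phi>) * w))
      * J (\<lambda>w. exp (\<i> * of_real ((\<theta> + \<phi>) * real s)) * exp_term (T * R) s w)"
    using assms by (intro Jm) (auto intro!: holomorphic_intros holomorphic_exp_term simp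
        del: of_real_add)
  also have "J (\<lambda>w. exp (\<i> * of_real ((\<theta> + \<phi>) * real s)) * exp_term (T * R) s w)
      = exp (\<i> * of_real ((\<theta> + \<phi>) * real s)) *\<^sub>C J (exp_term (T * R) s)"
    unfolding J_def using assms by (intro jet_cmult holomorphic_exp_term) simp
  also have "J (\<lambda>w. exp (\<i> * of_real (\<theta> + \<phi>) * w)) = coh_exp ((\<i> * of_real (\<theta> + \<phi>)) *\<^sub>C \<beta>)"
    unfolding J_def by (rule coh_exp_jet_0 [symmetric])
  finally show ?thesis
    by (simp add: J_def s_def mult.assoc)
qed

text \<open>Each single term is \<open>|t|\<^bsup>rm + z0\<^esup>\<close> times a polynomial in \<open>ln |t|\<close>, so that finitely many terms are
  negligible.  The coefficient \<open>\<alpha> (r * m)\<close> is arbitrary, as it is for small \<open>m\<close>.\<close>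

lemma coh_series_term_growth:
  assumes N: "coh_norm N" and T: "T > 0"
  shows "((\<lambda>R. exp (- (T * R)) * R ^ L * N (coh_series_term r \<alpha> \<beta> R \<phi> m)) \<longlongrightarrow> 0) at_top"
proof -
  define s where "s = r * m"
  define X where "X = jet K z0 \<nu> (\<lambda>w. exp (\<i> * of_real \<phi> * (of_nat s + w)))"
  define G where "G k = N (\<alpha> s * (\<nu> ^ k * X))" for k
  have bound: "N (coh_series_term r \<alpha> \<beta> R \<phi> m)
      \<le> (\<Sum>k<K. \<bar>ln R\<bar> ^ k * exp (ln R * (real s + Re z0)) / fact k * G k)" for R
  proof -
    have "coh_series_term r \<alpha> \<beta> R \<phi> m
        = \<alpha> s * (jet K z0 \<nu> (\<lambda>w. exp (of_real (ln R) * (of_nat s + w))) * X)"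
      unfolding coh_series_term_def s_def [symmetric] polar_powr_jet X_def by simp
    also have "\<dots> = (\<Sum>k<K. (of_real (ln R) ^ k * exp (of_real (ln R) * (of_nat s + z0)) / fact k)
        *\<^sub>C (\<alpha> s * (\<nu> ^ k * X)))"
      unfolding jet_def [of K z0 \<nu> "\<lambda>w. exp (of_real (ln R)
          * (of_nat s + w))"] higher_deriv_exp_linear
      by (simp add: sum_distrib_left sum_distrib_right)
    also have "N \<dots> \<le> (\<Sum>k<K. N ((of_real (ln R) ^ k * exp (of_real (ln R) * (of_nat s + z0))
        / fact k) *\<^sub>C (\<alpha> s * (\<nu> ^ k * X))))"
      by (rule coh_norm_sum [OF N])
    finally show ?thesis
      by (simp add: coh_norm_scale [OF N] G_def norm_mult norm_divide norm_power)
  qed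
  have lim: "((\<lambda>R. exp (- (T * R)) * R ^ L
      * (\<bar>ln R\<bar> ^ k * exp (ln R * (real s + Re z0)) / fact k * G k)) \<longlongrightarrow> 0) at_top" for k
  proof -
    define p where "p = real s + Re z0 + real (k + L)"
    have "((\<lambda>R. G k / fact k * (R powr p * exp (- (T * R)))) \<longlongrightarrow> 0) at_top"
      using T by real_asymp
    then show ?thesis
    proof (rule Lim_null_comparison [rotated])
      have G0: "G k \<ge> 0" unfolding G_def by (rule coh_norm_nonneg [OF N])
      show "eventually (\<lambda>R. norm (exp (- (T * R)) * R ^ L
          * (\<bar>ln R\<bar> ^ k * exp (ln R * (real s + Re z0)) / fact k * G k))
          \<le> G k / fact k * (R powr p * exp (- (T * R)))) at_top"
        using eventually_ge_at_top [of 1]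
      proof eventually_elim
        case (elim R)
        have "\<bar>ln R\<bar> ^ k \<le> R ^ k"
        proof (intro power_mono)
          have "ln R \<ge> 0" "ln R < R" using elim ln_less_self [of R] by auto
          then show "\<bar>ln R\<bar> \<le> R" by simp
        qed simp
        then have "exp (- (T * R)) * R ^ L
            * (\<bar>ln R\<bar> ^ k * exp (ln R * (real s + Re z0)) / fact k * G k)
          \<le> exp (- (T * R)) * R ^ L * (R ^ k * exp (ln R * (real s + Re z0)) / fact k * G k)"
          using elim G0 by (intro mult_left_mono mult_right_mono divide_right_mono) auto
        also have "\<dots> = G k / fact k * (R powr p * exp (- (T * R)))"
        proof -
          have "R powr p = exp (ln R * (real s + Re z0)) * R ^ k * R ^ L"
            using elim by (simp add: p_def powr_add powr_def flip: powr_realpow) (simp add: exp_add exp_of_nat_mult algebra_simps)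
          then show ?thesis by simp
        qed
        finally show ?case using elim G0 by simp
      qed
    qed
  qed
  have "((\<lambda>R. \<Sum>k<K. exp (- (T * R)) * R ^ L
      * (\<bar>ln R\<bar> ^ k * exp (ln R * (real s + Re z0)) / fact k * G k)) \<longlongrightarrow> (\<Sum>k<K. 0)) at_top"
    by (intro tendsto_sum lim)
  then have "((\<lambda>R. exp (- (T * R)) * R ^ L
      * (\<Sum>k<K. \<bar>ln R\<bar> ^ k * exp (ln R * (real s + Re z0)) / fact k * G k)) \<longlongrightarrow> 0) at_top"
    by (simp add: sum_distrib_left)
  then show ?thesis
  proof (rule Lim_null_comparison [rotated])
    show "eventually (\<lambda>R. norm (exp (- (T * R)) * R ^ L * N (coh_series_term r \<alpha> \<beta> R \<phi> m))
        \<le> exp (- (T * R)) * R ^ L * (\<Sum>k<K. \<bar>ln R\<bar> ^ k * exp (ln R * (real s + Re z0)) / fact k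
            * G k)) at_top"
      using eventually_ge_at_top [of 0]
    proof eventually_elim
      case (elim R)
      then show ?case
        using mult_left_mono [OF bound [of R], of "exp (- (T * R)) * R ^ L"] coh_norm_nonneg [OF N]
        by (simp add: abs_mult)
    qed
  qed
qed

end

lemma coh_sums_combination:
  assumes N: "coh_norm N" and f: "\<And>i. i \<in> I \<Longrightarrow> f i sums F i"
  shows "coh_sums N (\<lambda>m. \<Sum>i\<in>I. f i m *\<^sub>C v i) (\<Sum>i\<in>I. F i *\<^sub>C v i)"
  unfolding coh_sums_def
proof (rule Lim_null_comparison)
  have "((\<lambda>n. \<Sum>i\<in>I. cmod ((\<Sum>m<n. f i m) - F i) * N (v i)) \<longlonglongrightarrow> (\<Sum>i\<in>I. cmod (F i - F i) * N (v i)))"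
    using f unfolding sums_def by (intro tendsto_intros) auto
  then show "((\<lambda>n. \<Sum>i\<in>I. cmod ((\<Sum>m<n. f i m) - F i) * N (v i)) \<longlonglongrightarrow> 0)" by simp
  show "eventually (\<lambda>n. norm (N ((\<Sum>m<n. \<Sum>i\<in>I. f i m *\<^sub>C v i) - (\<Sum>i\<in>I. F i *\<^sub>C v i)))
      \<le> (\<Sum>i\<in>I. cmod ((\<Sum>m<n. f i m) - F i) * N (v i))) sequentially"
  proof (intro always_eventually allI)
    fix n
    have "(\<Sum>m<n. \<Sum>i\<in>I. f i m *\<^sub>C v i) - (\<Sum>i\<in>I. F i *\<^sub>C v i) = (\<Sum>i\<in>I. ((\<Sum>m<n. f i m) - F i) *\<^sub>C v i)"
      by (subst sum.swap) (simp add: coh.scale_left_diff_distrib coh.scale_sum_left sum_subtractf)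
    also have "N \<dots> \<le> (\<Sum>i\<in>I. N (((\<Sum>m<n. f i m) - F i) *\<^sub>C v i))"
      by (rule coh_norm_sum [OF N])
    finally show "norm (N ((\<Sum>m<n. \<Sum>i\<in>I. f i m *\<^sub>C v i) - (\<Sum>i\<in>I. F i *\<^sub>C v i)))
      \<le> (\<Sum>i\<in>I. cmod ((\<Sum>m<n. f i m) - F i) * N (v i))"
      using coh_norm_nonneg [OF N] by (simp add: coh_norm_scale [OF N])
  qed
qed

lemma coh_sums_shift:
  assumes "coh_sums N (\<lambda>m. f (m + n)) s"
  shows "coh_sums N f ((\<Sum>m<n. f m) + s)"
proof -
  have "(\<Sum>m<k + n. f m) = (\<Sum>m<n. f m) + (\<Sum>m<k. f (m + n))" for k
    by (induction k) (simp_all add: add.assoc)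
  then have "(\<lambda>k. N ((\<Sum>m<k + n. f m) - ((\<Sum>m<n. f m) + s))) \<longlonglongrightarrow> 0"
    using assms unfolding coh_sums_def by simp
  then show ?thesis unfolding coh_sums_def by (rule LIMSEQ_offset)
qed

lemma resonance_iff:
  assumes "r > 0"
  shows "(\<exists>k::int. \<omega> = 2 * pi / real r * of_int k) \<longleftrightarrow> exp (\<i> * complex_of_real (\<omega> * real r)) = 1"
proof -
  have "exp (\<i> * complex_of_real (\<omega> * real r)) = 1 \<longleftrightarrow> (\<exists>k::int. \<omega> * real r = of_int (2 * k) * pi)"
    unfolding exp_eq_1 by simp
  also have "\<dots> \<longleftrightarrow> (\<exists>k::int. \<omega> = 2 * pi / real r * of_int k)"
    using assms by (simp add: field_simps)
  finally show ?thesis by simp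
qed

lemma exp_term_add: "exp_term x (s + s') w = exp_term x s (of_nat s' + w)"
  by (simp add: exp_term_def add.assoc)

lemma jet_exp_term_add: "jet K z \<nu> (exp_term x (s + s')) = jet K (of_nat s' + z) \<nu> (exp_term x s)"
proof -
  have "exp_term x (s + s') = (\<lambda>w. exp_term x s (of_nat s' + w))"
    by (intro ext exp_term_add)
  then show ?thesis by (simp add: jet_def higher_deriv_shift)
qed

text \<open>In a basis \<open>Bs\<close>, the series is a finite combination of the classes \<open>P * (\<nu>\<^sup>k * b)\<close>, whose coefficients
  are the scalar series \<open>H b k\<close> of \<open>exp_series_derivative_asymp\<close>, up to the finitely many dropped terms.
  The classes \<open>B j\<close> collect the coefficients of \<open>x\<^bsup>-j\<^esup>\<close>.\<close>

lemma (in coh_exponent) coh_series_asymptotics: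
  fixes A' :: "nat \<Rightarrow> 'x cohomology" and T \<theta> \<phi> :: real
  assumes N: "coh_norm N" and S: "finite S" "coh.span S = (UNIV :: 'x cohomology set)"
    and r: "r > 0" and T: "T > 0"
    and \<epsilon>: "(\<lambda>m. N (\<epsilon> m)) \<in> o(\<lambda>m. 1 / real m ^ L)"
    and \<alpha>: "\<forall>\<^sub>F m in sequentially. \<alpha> (r * m) = Mittag_Leffler_coeff T \<theta> (of_nat (r * m) + \<beta>) *
                ((\<Sum>l\<le>L. complex_of_real (1 / real m ^ l) *\<^sub>C A' l) + \<epsilon> m)"
  defines "\<omega> \<equiv> \<theta> + \<phi>"
  defines "P \<equiv> coh_exp ((\<i> * of_real \<omega>) *\<^sub>C \<beta>)"
  shows "\<exists>X B. (\<forall>R>0. coh_sums N (coh_series_term r \<alpha> \<beta> R \<phi>) (X R)) \<and> B 0 = A' 0 \<and>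
    ((\<lambda>R. R ^ L * N (complex_of_real (exp (- (T * R))) *\<^sub>C X R -
        (if exp (\<i> * complex_of_real (\<omega> * real r)) = 1
         then \<Sum>l\<le>L. complex_of_real (1 / real r) *\<^sub>C P * (complex_of_real (1 / (T * R) ^ l) *\<^sub>C B l)
         else 0))) \<longlongrightarrow> 0) at_top"
proof -
  let ?main = "\<lambda>B R. \<Sum>l\<le>L. complex_of_real (1 / real r) *\<^sub>C P
      * (complex_of_real (1 / (T * R) ^ l) *\<^sub>C B l)"
  note triangle = coh_norm_triangle [OF N] and scale = coh_norm_scale [OF N] and N_sum
      = coh_norm_sum [OF N]
    and nonneg = coh_norm_nonneg [OF N]
  obtain Bs where Bs: "Bs \<subseteq> S" "coh.independent Bs" "coh.span Bs = (UNIV :: 'x cohomology set)"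
    using coh.maximal_independent_subset [of S] coh.span_mono coh.span_superset coh.span_span S(2)
    by (metis coh.span_eq subset_trans)
  have fin: "finite Bs" using Bs(1) S(1) finite_subset by blast
  define co where "co b v = coh.representation Bs v b" for b v
  have co_sum: "v = (\<Sum>b\<in>Bs. co b v *\<^sub>C b)" for v
    unfolding co_def using Bs fin by (intro coh.sum_representation_eq [symmetric]) auto
  have co_add: "co b (v + w) = co b v + co b w" and co_scale: "co b (c *\<^sub>C v) = c * co b v"
      for b c v w
    unfolding co_def using Bs by (simp_all add: coh.representation_add coh.representation_scale)
  have co_0: "co b 0 = 0" for b using co_scale [of b 0 0] by simp
  have co_lsum: "co b (\<Sum>i\<in>I. f i) = (\<Sum>i\<in>I. co b (f i))" for b f and I :: "nat set"
    by (induction I rule: infinite_finite_induct) (simp_all add: co_add co_0)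
  obtain C where C: "C \<ge> 0" "\<And>c b. b \<in> Bs \<Longrightarrow> cmod (c b) \<le> C * N (\<Sum>b\<in>Bs. c b *\<^sub>C b)"
    using coh_norm_coordinates [OF N fin Bs(2)] by blast
  have co_le: "cmod (co b v) \<le> C * N v" if "b \<in> Bs" for b v
    using C(2) [OF that, of "\<lambda>b. co b v"] unfolding co_sum [symmetric] .
  obtain M0 where M0: "\<And>m. m \<ge> M0 \<Longrightarrow> \<alpha> (r * m) = Mittag_Leffler_coeff T \<theta> (of_nat (r * m) + \<beta>) *
                ((\<Sum>l\<le>L. complex_of_real (1 / real m ^ l) *\<^sub>C A' l) + \<epsilon> m)"
    using \<alpha> by (auto simp: eventually_sequentially)
  obtain n0 :: nat where n0: "3 - Re z0 \<le> real n0" using real_arch_simple by blast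
  \<comment> \<open>Dropping the first \<open>q\<close> terms moves the point of expansion to \<open>w0\<close>, far to the right.\<close>
  define q where "q = max M0 (max 1 n0)"
  have q: "q > 0" "q \<ge> M0" "q \<ge> n0" by (auto simp: q_def)
  define w0 where "w0 = of_nat (r * q) + z0"
  have "real n0 \<le> real (r * q)"
  proof -
    have "n0 * 1 \<le> q * r" using q r by (intro mult_le_mono) auto
    then show ?thesis by (simp only: of_nat_le_iff mult_1_right mult.commute)
  qed
  then have w0: "Re w0 \<ge> 3" using n0 by (simp add: w0_def)
  define V where "V m = (\<Sum>l\<le>L. complex_of_real (1 / real (m + q) ^ l) *\<^sub>C A' l) + \<epsilon> (m + q)" for m
  define a where "a b m = co b (V m)" for b m
  have a: "a b m = (\<Sum>l\<le>L. co b (A' l) / of_nat (m + q) ^ l) + co b (\<epsilon> (m + q))" for b m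
    by (simp add: a_def V_def co_add co_scale co_lsum)
  have \<eta>: "(\<lambda>m. cmod (co b (\<epsilon> (m + q))) * (real m + 1) ^ L) \<longlonglongrightarrow> 0" if b: "b \<in> Bs" for b
  proof -
    have "(\<lambda>m. N (\<epsilon> m) / (1 / real m ^ L)) \<longlonglongrightarrow> 0" by (rule smalloD_tendsto [OF \<epsilon>])
    then have "(\<lambda>m. N (\<epsilon> m) * real m ^ L) \<longlonglongrightarrow> 0" by simp
    then have "(\<lambda>m. C * (N (\<epsilon> (m + q)) * real (m + q) ^ L)) \<longlonglongrightarrow> C * 0"
      by (intro tendsto_mult tendsto_const LIMSEQ_ignore_initial_segment
          [where f = "\<lambda>m. N (\<epsilon> m) * real m ^ L"])
    then have "(\<lambda>m. C * (N (\<epsilon> (m + q)) * real (m + q) ^ L)) \<longlonglongrightarrow> 0" by simp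
    then show ?thesis
    proof (rule Lim_null_comparison [rotated])
      show "eventually (\<lambda>m. norm (cmod (co b (\<epsilon> (m + q))) * (real m + 1) ^ L)
          \<le> C * (N (\<epsilon> (m + q)) * real (m + q) ^ L)) sequentially"
      proof (intro always_eventually allI)
        fix m
        have "cmod (co b (\<epsilon> (m + q))) * (real m + 1) ^ L \<le> (C * N (\<epsilon> (m + q))) * real (m + q) ^ L"
          using q C(1) nonneg by (intro mult_mono co_le b power_mono) auto
        then show "norm (cmod (co b (\<epsilon> (m + q))) * (real m + 1) ^ L)
            \<le> C * (N (\<epsilon> (m + q)) * real (m + q) ^ L)"
          by (simp add: abs_mult mult.assoc)
      qed
    qed
  qed
  define u where "u m = exp (\<i> * complex_of_real (\<omega> * real (r * m)))" for m
  define \<rho> where "\<rho> = (if exp (\<i> * complex_of_real (\<omega> * real r)) = 1 then 1 / complex_of_nat r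
      else 0)"
  have "\<exists>g H. (\<forall>j. g j holomorphic_on UNIV) \<and> g 0 = (\<lambda>_. co b (A' 0)) \<and>
    (\<forall>k. \<forall>x>0. (\<lambda>m. u m * a b m * (deriv ^^ k) (exp_term x (r * m)) w0) sums H k x) \<and>
    (\<forall>k. ((\<lambda>x. of_real (x ^ L) * (of_real (exp (- x)) * H k x
         - \<rho> * (\<Sum>j\<le>L. (deriv ^^ k) (g j) w0 / of_real x ^ j))) \<longlongrightarrow> 0) at_top)" if "b \<in> Bs" for b
    unfolding u_def \<rho>_def by (rule exp_series_derivative_asymp [OF w0 r q(1) a \<eta> [OF that]])
  then have "\<exists>g. \<forall>b\<in>Bs. \<exists>H. (\<forall>j. g b j holomorphic_on UNIV) \<and> g b 0 = (\<lambda>_. co b (A' 0)) \<and>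
    (\<forall>k. \<forall>x>0. (\<lambda>m. u m * a b m * (deriv ^^ k) (exp_term x (r * m)) w0) sums H k x) \<and>
    (\<forall>k. ((\<lambda>x. of_real (x ^ L) * (of_real (exp (- x)) * H k x
         - \<rho> * (\<Sum>j\<le>L. (deriv ^^ k) (g b j) w0 / of_real x ^ j))) \<longlongrightarrow> 0) at_top)"
    by (intro bchoice) blast
  then obtain g where "\<forall>b\<in>Bs. \<exists>H. (\<forall>j. g b j holomorphic_on UNIV) \<and> g b 0 = (\<lambda>_. co b (A' 0)) \<and>
    (\<forall>k. \<forall>x>0. (\<lambda>m. u m * a b m * (deriv ^^ k) (exp_term x (r * m)) w0) sums H k x) \<and>
    (\<forall>k. ((\<lambda>x. of_real (x ^ L) * (of_real (exp (- x)) * H k x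
         - \<rho> * (\<Sum>j\<le>L. (deriv ^^ k) (g b j) w0 / of_real x ^ j))) \<longlongrightarrow> 0) at_top)"
    by blast
  from bchoice [OF this] obtain H where g0: "\<And>b. b \<in> Bs \<Longrightarrow> g b 0 = (\<lambda>_. co b (A' 0))"
    and H: "\<And>b k x. b \<in> Bs \<Longrightarrow> x > 0 \<Longrightarrow> (\<lambda>m. u m * a b m * (deriv ^^ k) (exp_term x (r * m)) w0)
        sums H b k x"
    and lim: "\<And>b k. b \<in> Bs \<Longrightarrow> ((\<lambda>x. of_real (x ^ L) * (of_real (exp (- x)) * H b k x
         - \<rho> * (\<Sum>j\<le>L. (deriv ^^ k) (g b j) w0 / of_real x ^ j))) \<longlongrightarrow> 0) at_top"
    by blast
  define I where "I = {..<K} \<times> Bs"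
  have finI: "finite I" using fin by (simp add: I_def)
  define v where "v = (\<lambda>(k, b). P * (\<nu> ^ k * b))"
  define c0 where "c0 = exp (\<i> * complex_of_real (\<omega> * real (r * q)))"
  define h where "h = (\<lambda>(k, b) x. H b k x / fact k)"
  define d where "d = (\<lambda>j (k, b). (deriv ^^ k) (g b j) w0 / fact k)"
  define X where "X R = (\<Sum>m<q. coh_series_term r \<alpha> \<beta> R \<phi> m) + (\<Sum>i\<in>I. (c0 * h i (T * R)) *\<^sub>C v i)"
      for R
  define B where "B j = (\<Sum>(k, b)\<in>I. d j (k, b) *\<^sub>C (\<nu> ^ k * b))" for j
  have tail: "coh_series_term r \<alpha> \<beta> R \<phi> (m + q)
      = (\<Sum>i\<in>I. (c0 * (case i of (k, b) \<Rightarrow> u m * a b m * (deriv ^^ k) (exp_term (T * R) (r * m)) w0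
          / fact k)) *\<^sub>C v i)"
    if R: "R > 0" for R m
  proof -
    have "\<alpha> (r * (m + q)) = Mittag_Leffler_coeff T \<theta> (of_nat (r * (m + q)) + \<beta>) * V m"
      unfolding V_def using q by (intro M0) auto
    from coh_series_term_jet [where \<alpha> = \<alpha> and r = r and m = "m + q" and \<phi> = \<phi>, OF T R this]
    have "coh_series_term r \<alpha> \<beta> R \<phi> (m + q)
        = P * (exp (\<i> * of_real (\<omega> * real (r * (m + q))))
            *\<^sub>C (jet K z0 \<nu> (exp_term (T * R) (r * (m + q))) * V m))"
      by (simp only: P_def \<omega>_def)
    also have "exp (\<i> * of_real (\<omega> * real (r * (m + q)))) = c0 * u m"
      unfolding c0_def u_def by (simp flip: exp_add) (simp add: algebra_simps)
    also have "jet K z0 \<nu> (exp_term (T * R) (r * (m + q))) = jet K w0 \<nu> (exp_term (T * R) (r * m))"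
      unfolding distrib_left w0_def by (rule jet_exp_term_add)
    also have "jet K w0 \<nu> (exp_term (T * R) (r * m)) * V m
        = (\<Sum>k<K. \<Sum>b\<in>Bs. ((deriv ^^ k) (exp_term (T * R) (r * m)) w0 / fact k * a b m)
            *\<^sub>C (\<nu> ^ k * b))"
      by (subst co_sum [of "V m"]) (simp add: jet_def sum_product a_def mult.commute)
    also have "\<dots> = (\<Sum>(k, b)\<in>I. ((deriv ^^ k) (exp_term (T * R) (r * m)) w0 / fact k * a b m)
        *\<^sub>C (\<nu> ^ k * b))"
      unfolding I_def by (rule sum.cartesian_product)
    also have "P * ((c0 * u m) *\<^sub>C \<dots>)
        = (\<Sum>i\<in>I. (c0 * (case i of (k, b) \<Rightarrow> u m * a b m * (deriv ^^ k) (exp_term (T * R) (r * m)) w0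
        / fact k)) *\<^sub>C v i)"
      unfolding coh_scale_mult_right coh.scale_sum_right sum_distrib_left
      by (intro sum.cong refl) (auto simp: v_def mult_ac)
    finally show ?thesis .
  qed
  have sums: "coh_sums N (coh_series_term r \<alpha> \<beta> R \<phi>) (X R)" if R: "R > 0" for R
    unfolding X_def
  proof (rule coh_sums_shift)
    have "coh_sums N (\<lambda>m. \<Sum>i\<in>I. (c0
        * (case i of (k, b) \<Rightarrow> u m * a b m * (deriv ^^ k) (exp_term (T * R) (r * m)) w0 / fact k))
        *\<^sub>C v i)
        (\<Sum>i\<in>I. (c0 * h i (T * R)) *\<^sub>C v i)"
    proof (rule coh_sums_combination [OF N])
      fix i assume "i \<in> I"
      then obtain k b where i: "i = (k, b)" "b \<in> Bs" by (auto simp: I_def)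
      show "(\<lambda>m. c0 * (case i of (k, b) \<Rightarrow> u m * a b m * (deriv ^^ k) (exp_term (T * R) (r * m)) w0
          / fact k)) sums (c0 * h i (T * R))"
        unfolding i(1) h_def prod.case using R T by (intro sums_mult sums_divide H i(2)) simp
    qed
    then show "coh_sums N (\<lambda>m. coh_series_term r \<alpha> \<beta> R \<phi> (m + q)) (\<Sum>i\<in>I. (c0 * h i (T * R))
        *\<^sub>C v i)"
      by (simp only: tail [OF R])
  qed
  have B0: "B 0 = A' 0"
  proof -
    have K: "0 < K" using nilpotent by (cases K) auto
    have "B 0 = (\<Sum>k<K. \<Sum>b\<in>Bs. d 0 (k, b) *\<^sub>C (\<nu> ^ k * b))"
      unfolding B_def I_def by (rule sum.cartesian_product [symmetric])
    also have "\<dots> = (\<Sum>k<K. if k = 0 then \<Sum>b\<in>Bs. co b (A' 0) *\<^sub>C b else 0)"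
    proof (rule sum.cong [OF refl])
      fix k
      have "d 0 (k, b) = (if k = 0 then co b (A' 0) else 0)" if "b \<in> Bs" for b
        using g0 [OF that] by (simp add: d_def)
      then show "(\<Sum>b\<in>Bs. d 0 (k, b) *\<^sub>C (\<nu> ^ k * b))
          = (if k = 0 then \<Sum>b\<in>Bs. co b (A' 0) *\<^sub>C b else 0)"
        by simp
    qed
    also have "\<dots> = A' 0" using K by (simp flip: co_sum)
    finally show ?thesis .
  qed
  define err where "err R = complex_of_real (exp (- (T * R))) *\<^sub>C X R -
        (if exp (\<i> * complex_of_real (\<omega> * real r)) = 1
         then ?main B R else 0)" for R
  define e where "e i x = complex_of_real (exp (- x)) * h i x - \<rho> * (\<Sum>j\<le>L. d j i / of_real x ^ j)"
      for i x
  have c0: "cmod c0 = 1" by (simp add: c0_def)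
  have c0_res: "c0 = 1" if "exp (\<i> * complex_of_real (\<omega> * real r)) = 1"
  proof -
    have "c0 = exp (\<i> * complex_of_real (\<omega> * real r)) ^ q"
      unfolding c0_def by (simp add: mult_ac flip: exp_of_nat_mult)
    with that show ?thesis by simp
  qed
  have err: "err R = complex_of_real (exp (- (T * R))) *\<^sub>C (\<Sum>m<q. coh_series_term r \<alpha> \<beta> R \<phi> m)
      + (\<Sum>i\<in>I. (c0 * e i (T * R)) *\<^sub>C v i)" for R
  proof -
    have main: "(if exp (\<i> * complex_of_real (\<omega> * real r)) = 1
         then ?main B R else 0)
       = (\<Sum>i\<in>I. (c0 * (\<rho> * (\<Sum>j\<le>L. d j i / of_real (T * R) ^ j))) *\<^sub>C v i)"
    proof (cases "exp (\<i> * complex_of_real (\<omega> * real r)) = 1")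
      case True
      have PB: "P * B j = (\<Sum>i\<in>I. d j i *\<^sub>C v i)" for j
        by (auto simp: B_def v_def sum_distrib_left intro!: sum.cong)
      have "(?main B R)
          = (\<Sum>l\<le>L. \<Sum>i\<in>I. (\<rho> * (d l i / of_real (T * R) ^ l)) *\<^sub>C v i)"
        using True by (intro sum.cong refl) (simp add: PB coh.scale_sum_right \<rho>_def mult.commute)
      also have "\<dots> = (\<Sum>i\<in>I. (\<rho> * (\<Sum>j\<le>L. d j i / of_real (T * R) ^ j)) *\<^sub>C v i)"
        by (subst sum.swap) (simp add: coh.scale_sum_left sum_distrib_left)
      finally show ?thesis using True by (simp add: c0_res)
    qed (simp add: \<rho>_def)
    show ?thesis
      unfolding err_def main X_def e_def
      by (simp add: coh.scale_right_distrib coh.scale_sum_right coh.scale_left_diff_distrib sum_subtractf right_diff_distrib mult_ac)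
  qed
  have "((\<lambda>R. R ^ L * N (err R)) \<longlongrightarrow> 0) at_top"
  proof (rule Lim_null_comparison)
    have e_lim: "((\<lambda>x. cmod (of_real (x ^ L) * e i x)) \<longlongrightarrow> 0) at_top" if iI: "i \<in> I" for i
    proof -
      obtain k b where i: "i = (k, b)" "b \<in> Bs" using iI by (auto simp: I_def)
      have "((\<lambda>x. of_real (x ^ L) * (of_real (exp (- x)) * H b k x
         - \<rho> * (\<Sum>j\<le>L. (deriv ^^ k) (g b j) w0 / of_real x ^ j)) / fact k) \<longlongrightarrow> 0 / fact k) at_top"
        by (intro tendsto_divide lim i(2) tendsto_const) simp
      moreover have "of_real (x ^ L) * (of_real (exp (- x)) * H b k x
         - \<rho> * (\<Sum>j\<le>L. (deriv ^^ k) (g b j) w0 / of_real x ^ j)) / fact k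
             = of_real (x ^ L) * e i x" for x
      proof -
        have "(\<Sum>j\<le>L. d j i / of_real x ^ j)
            = (\<Sum>j\<le>L. (deriv ^^ k) (g b j) w0 / of_real x ^ j) / fact k"
          by (simp add: d_def i(1) sum_divide_distrib mult.commute)
        then have "e i x = (of_real (exp (- x)) * H b k x
            - \<rho> * (\<Sum>j\<le>L. (deriv ^^ k) (g b j) w0 / of_real x ^ j)) / fact k"
          by (simp add: e_def h_def i(1) diff_divide_distrib)
        then show ?thesis by simp
      qed
      ultimately have "((\<lambda>x. of_real (x ^ L) * e i x) \<longlongrightarrow> 0) at_top"
        by simp
      then show ?thesis by (rule tendsto_norm_zero)
    qed
    have TR: "filterlim (\<lambda>R. T * R) at_top at_top"
      using T by (intro filterlim_tendsto_pos_mult_at_top [OF tendsto_const] filterlim_ident)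
    have "((\<lambda>R. (\<Sum>m<q. exp (- (T * R)) * R ^ L * N (coh_series_term r \<alpha> \<beta> R \<phi> m))
        + (\<Sum>i\<in>I. cmod (of_real ((T * R) ^ L) * e i (T * R)) / T ^ L * N (v i))) \<longlongrightarrow> (\<Sum>m<q. 0)
            + (\<Sum>i\<in>I. 0 / T ^ L * N (v i))) at_top"
      using T by (intro tendsto_add tendsto_sum tendsto_mult tendsto_divide tendsto_const coh_series_term_growth [OF N T]
          filterlim_compose [OF e_lim TR]) auto
    then show "((\<lambda>R. (\<Sum>m<q. exp (- (T * R)) * R ^ L * N (coh_series_term r \<alpha> \<beta> R \<phi> m))
        + (\<Sum>i\<in>I. cmod (of_real ((T * R) ^ L) * e i (T * R)) / T ^ L * N (v i))) \<longlongrightarrow> 0) at_top"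
      by simp
    show "eventually (\<lambda>R. norm (R ^ L * N (err R))
        \<le> (\<Sum>m<q. exp (- (T * R)) * R ^ L * N (coh_series_term r \<alpha> \<beta> R \<phi> m))
        + (\<Sum>i\<in>I. cmod (of_real ((T * R) ^ L) * e i (T * R)) / T ^ L * N (v i))) at_top"
      using eventually_gt_at_top [of 0]
    proof eventually_elim
      case (elim R)
      have "N (err R) \<le> N (complex_of_real (exp (- (T * R)))
          *\<^sub>C (\<Sum>m<q. coh_series_term r \<alpha> \<beta> R \<phi> m)) + N (\<Sum>i\<in>I. (c0 * e i (T * R)) *\<^sub>C v i)"
        unfolding err by (rule triangle)
      also have "\<dots> \<le> exp (- (T * R)) * (\<Sum>m<q. N (coh_series_term r \<alpha> \<beta> R \<phi> m))
          + (\<Sum>i\<in>I. N ((c0 * e i (T * R)) *\<^sub>C v i))"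
        unfolding scale [of "complex_of_real (exp (- (T * R)))"]
        by (intro add_mono N_sum) (simp add: N_sum)
      also have "(\<Sum>i\<in>I. N ((c0 * e i (T * R)) *\<^sub>C v i)) = (\<Sum>i\<in>I. cmod (e i (T * R)) * N (v i))"
        by (simp add: scale norm_mult c0)
      finally have "R ^ L * N (err R)
          \<le> R ^ L * (exp (- (T * R)) * (\<Sum>m<q. N (coh_series_term r \<alpha> \<beta> R \<phi> m))
          + (\<Sum>i\<in>I. cmod (e i (T * R)) * N (v i)))"
        using elim by (intro mult_left_mono) auto
      also have "\<dots> = (\<Sum>m<q. exp (- (T * R)) * R ^ L * N (coh_series_term r \<alpha> \<beta> R \<phi> m))
          + (\<Sum>i\<in>I. cmod (of_real ((T * R) ^ L) * e i (T * R)) / T ^ L * N (v i))"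
        using T elim by (simp add: distrib_left sum_distrib_left norm_mult norm_power power_mult_distrib mult_ac)
      finally show ?case using elim nonneg by (simp add: abs_mult)
    qed
  qed
  then show ?thesis
    unfolding err_def using sums B0 by blast
qed

lemma smooth_atlas_coh_exponent:
  fixes \<A> :: "'x::topological_space chart set" and \<beta> :: "'x cohomology"
  assumes "smooth_atlas n \<A>" "connected (UNIV :: 'x set)" "finite S" "coh.span S
      = (UNIV :: 'x cohomology set)" "even_class \<beta>"
  shows "\<exists>K. coh_exponent \<beta> K"
proof -
  have "path_connected_space (euclidean :: 'x topology)"
    using path_connected_eq_connected_space
        [OF smooth_atlas_locally_path_connected [OF assms(1)]] assms(2)
    using connectedin_topspace [of "euclidean :: 'x topology"]
    by (simp add: connectedin_iff_connected)
  then obtain c where c: "coh_comp 0 \<beta> = c *\<^sub>C 1" by (rule coh_comp_0_scalar)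
  obtain K where "nilpotent_part \<beta> ^ K = 0" using nilpotent_part_power_eq_0 [OF assms(3,4)] by blast
  then have "coh_exponent \<beta> K"
    using c scalar_part_eqI [OF c] nilpotent_part_central [OF assms(5)] by unfold_locales auto
  then show ?thesis by blast
qed

theorem theorem3p3:
  fixes \<A> :: "'x::{t2_space, second_countable_topology} chart set"
    and n r :: nat
    and \<alpha> :: "nat \<Rightarrow> 'x cohomology"
    and \<beta> A :: "'x cohomology"
    and T \<theta> \<phi> :: real
    and N :: "'x cohomology \<Rightarrow> real"
  assumes manifold: "smooth_atlas n \<A>"
    and connected: "connected (UNIV :: 'x set)"
    and finite_dim: "\<exists>S :: 'x cohomology set. finite S \<and> coh.span S = UNIV"
    and norm: "coh_norm N"
    and even: "even_class \<beta>"
    and r: "r > 0"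
    and T: "T > 0"
    and Mittag_Leffler: "asymp_Mittag_Leffler N r \<alpha> \<beta> T \<theta> A"
  shows
    "(\<forall>R>0. \<exists>s. coh_sums N (coh_series_term r \<alpha> \<beta> R \<phi>) s) \<and>
     (\<exists>\<epsilon> :: real \<Rightarrow> 'x cohomology. (\<lambda>R. N (\<epsilon> R)) \<in> o[at_top](\<lambda>R. 1) \<and>
        (\<forall>\<^sub>F R in at_top. coh_series N r \<alpha> \<beta> R \<phi> =
           (if \<exists>k::int. \<theta> + \<phi> = 2 * pi / real r * of_int k
            then complex_of_real (1 / real r) *\<^sub>C coh_exp ((\<i> * of_real (\<theta> + \<phi>)) *\<^sub>C \<beta>) *
                 (complex_of_real (exp (T * R)) *\<^sub>C (A + \<epsilon> R))
            else complex_of_real (exp (T * R)) *\<^sub>C \<epsilon> R))) \<and>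
     (\<forall>L A'. A' 0 = A \<and>
        (\<exists>\<epsilon> :: nat \<Rightarrow> 'x cohomology. (\<lambda>m. N (\<epsilon> m)) \<in> o(\<lambda>m. 1 / real m ^ L) \<and>
           (\<forall>\<^sub>F m in sequentially.
              \<alpha> (r * m) = Mittag_Leffler_coeff T \<theta> (of_nat (r * m) + \<beta>) *
                ((\<Sum>l\<le>L. complex_of_real (1 / real m ^ l) *\<^sub>C A' l) + \<epsilon> m))) \<longrightarrow>
        (\<exists>B. B 0 = A \<and>
          (\<exists>\<epsilon> :: real \<Rightarrow> 'x cohomology. (\<lambda>R. N (\<epsilon> R)) \<in> o[at_top](\<lambda>R. 1 / R ^ L) \<and>
            (\<forall>\<^sub>F R in at_top. coh_series N r \<alpha> \<beta> R \<phi> =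
              (if \<exists>k::int. \<theta> + \<phi> = 2 * pi / real r * of_int k
               then complex_of_real (exp (T * R)) *\<^sub>C
                    ((\<Sum>l\<le>L. complex_of_real (1 / real r) *\<^sub>C
                         coh_exp ((\<i> * of_real (\<theta> + \<phi>)) *\<^sub>C \<beta>) *
                         (complex_of_real (1 / (T * R) ^ l) *\<^sub>C B l)) + \<epsilon> R)
               else complex_of_real (exp (T * R)) *\<^sub>C \<epsilon> R)))))"
proof -
  define \<omega> where "\<omega> = \<theta> + \<phi>"
  define res where "res \<longleftrightarrow> (\<exists>k::int. \<theta> + \<phi> = 2 * pi / real r * of_int k)"
  define P where "P = coh_exp ((\<i> * of_real (\<theta> + \<phi>)) *\<^sub>C \<beta>)"
  let ?main = "\<lambda>L B R. \<Sum>l\<le>L. complex_of_real (1 / real r) *\<^sub>C P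
      * (complex_of_real (1 / (T * R) ^ l) *\<^sub>C B l)"
  obtain S :: "'x cohomology set" where S: "finite S" "coh.span S = UNIV" using finite_dim by blast
  obtain K where "coh_exponent \<beta> K"
    using smooth_atlas_coh_exponent [OF manifold connected S even] by blast
  then interpret coh_exponent \<beta> K .
  have res: "exp (\<i> * complex_of_real ((\<theta> + \<phi>) * real r)) = 1 \<longleftrightarrow> res"
    unfolding res_def using resonance_iff [OF r] by simp
  have scale: "N (c *\<^sub>C x) = cmod c * N x" for c x by (rule coh_norm_scale [OF norm])
  have main: "(\<forall>R>0. \<exists>s. coh_sums N (coh_series_term r \<alpha> \<beta> R \<phi>) s) \<and>
      (\<exists>B. B 0 = A' 0 \<and> (\<exists>\<epsilon> :: real \<Rightarrow> 'x cohomology. (\<lambda>R. N (\<epsilon> R)) \<in> o[at_top](\<lambda>R. 1 / R ^ L) \<and>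
        (\<forall>\<^sub>F R in at_top. coh_series N r \<alpha> \<beta> R \<phi> =
           (if res then complex_of_real (exp (T * R)) *\<^sub>C
                ((?main L B R) + \<epsilon> R)
            else complex_of_real (exp (T * R)) *\<^sub>C \<epsilon> R))))"
    if \<epsilon>: "(\<lambda>m. N (\<epsilon> m)) \<in> o(\<lambda>m. 1 / real m ^ L)"
      and \<alpha>: "\<forall>\<^sub>F m in sequentially. \<alpha> (r * m) = Mittag_Leffler_coeff T \<theta> (of_nat (r * m) + \<beta>) *
                ((\<Sum>l\<le>L. complex_of_real (1 / real m ^ l) *\<^sub>C A' l) + \<epsilon> m)" for L A' \<epsilon>
  proof -
    obtain X B where X: "\<And>R. R > 0 \<Longrightarrow> coh_sums N (coh_series_term r \<alpha> \<beta> R \<phi>) (X R)"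
        and B: "B 0 = A' 0"
      and lim: "((\<lambda>R. R ^ L * N (complex_of_real (exp (- (T * R))) *\<^sub>C X R -
        (if res then ?main L B R
         else 0))) \<longlongrightarrow> 0) at_top"
      using coh_series_asymptotics [OF norm S r T \<epsilon> \<alpha>, of \<phi>] unfolding res P_def by blast
    define err where "err R = complex_of_real (exp (- (T * R))) *\<^sub>C X R -
        (if res then ?main L B R else 0)" for R
    have "(\<lambda>R. N (err R)) \<in> o[at_top](\<lambda>R. 1 / R ^ L)"
    proof (rule smalloI_tendsto)
      show "((\<lambda>R. N (err R) / (1 / R ^ L)) \<longlongrightarrow> 0) at_top"
        using lim by (simp add: err_def mult.commute)
      show "eventually (\<lambda>R. 1 / R ^ L \<noteq> (0::real)) at_top"
        using eventually_gt_at_top [of 0] by eventually_elim simp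
    qed
    moreover have "\<forall>\<^sub>F R in at_top. coh_series N r \<alpha> \<beta> R \<phi> =
           (if res then complex_of_real (exp (T * R)) *\<^sub>C
                ((?main L B R) + err R)
            else complex_of_real (exp (T * R)) *\<^sub>C err R)"
      using eventually_gt_at_top [of 0]
    proof eventually_elim
      case (elim R)
      have "complex_of_real (exp (T * R)) * complex_of_real (exp (- (T * R))) = 1"
        by (simp flip: of_real_mult exp_add)
      then have "complex_of_real (exp (T * R)) *\<^sub>C complex_of_real (exp (- (T * R))) *\<^sub>C X R = X R"
        by simp
      moreover have "coh_series N r \<alpha> \<beta> R \<phi> = X R"
        by (rule coh_series_eqI [OF norm X [OF elim]])
      ultimately show ?case by (simp add: err_def)
    qed
    ultimately show ?thesis using X B by blast
  qed
  obtain \<epsilon> where \<epsilon>: "(\<lambda>m. N (\<epsilon> m)) \<in> o(\<lambda>m. 1)"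
    and \<alpha>: "\<forall>\<^sub>F m in sequentially. \<alpha> (r * m)
        = Mittag_Leffler_coeff T \<theta> (of_nat (r * m) + \<beta>) * (A + \<epsilon> m)"
    using Mittag_Leffler unfolding asymp_Mittag_Leffler_def by blast
  have main0: "(\<forall>R>0. \<exists>s. coh_sums N (coh_series_term r \<alpha> \<beta> R \<phi>) s) \<and>
      (\<exists>B. B 0 = A \<and> (\<exists>\<epsilon> :: real \<Rightarrow> 'x cohomology. (\<lambda>R. N (\<epsilon> R)) \<in> o[at_top](\<lambda>R. 1) \<and>
        (\<forall>\<^sub>F R in at_top. coh_series N r \<alpha> \<beta> R \<phi> =
           (if res then complex_of_real (exp (T * R))
               *\<^sub>C (complex_of_real (1 / real r) *\<^sub>C P * B (0::nat) + \<epsilon> R)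
            else complex_of_real (exp (T * R)) *\<^sub>C \<epsilon> R))))"
  proof -
    have at_0: "(\<Sum>l\<le>0. f l) = f 0" for f :: "nat \<Rightarrow> 'x cohomology" by simp
    show ?thesis
      using main [of \<epsilon> 0 "\<lambda>_. A", unfolded at_0 power_0 div_by_1 of_real_1 coh.scale_one, OF \<epsilon> \<alpha>] .
  qed
  then obtain \<epsilon>' :: "real \<Rightarrow> 'x cohomology" where \<epsilon>': "(\<lambda>R. N (\<epsilon>' R)) \<in> o[at_top](\<lambda>R. 1)"
    and series: "\<forall>\<^sub>F R in at_top. coh_series N r \<alpha> \<beta> R \<phi> =
           (if res then complex_of_real (exp (T * R))
               *\<^sub>C (complex_of_real (1 / real r) *\<^sub>C P * A + \<epsilon>' R)
            else complex_of_real (exp (T * R)) *\<^sub>C \<epsilon>' R)"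
    by auto
  \<comment> \<open>The leading statement carries its error term inside the factor \<open>P\<close>, so \<open>P\<close> is cancelled.\<close>
  define Q where "Q = coh_exp ((- (\<i> * of_real (\<theta> + \<phi>))) *\<^sub>C \<beta>)"
  have PQ: "P * Q = 1"
  proof -
    have "P * Q = jet K z0 \<nu> (\<lambda>w. exp (\<i> * of_real (\<theta> + \<phi>) * w)
        * exp (- (\<i> * of_real (\<theta> + \<phi>)) * w))"
      unfolding P_def Q_def coh_exp_jet_0
      by (intro jet_mult [symmetric] nilpotent) (auto intro!: holomorphic_intros simp
          del: of_real_add)
    also have "\<dots> = jet K z0 \<nu> (\<lambda>w. exp (0 * w))"
      by (simp flip: exp_add)
    also have "\<dots> = coh_exp (0 *\<^sub>C \<beta>)" by (rule coh_exp_jet_0 [symmetric])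
    also have "\<dots> = 1"
    proof -
      have K: "0 < K" using nilpotent by (cases K) auto
      have "coh_exp (0 *\<^sub>C \<beta>) = (\<Sum>k<K. if k = 0 then 1 else 0)"
        unfolding coh_exp_jet_0 jet_def by (intro sum.cong refl) simp
      with K show ?thesis by simp
    qed
    finally show ?thesis .
  qed
  obtain C where C: "C \<ge> 0" "\<And>x. N (Q * x) \<le> C * N x"
    using coh_linear_bounded [OF norm S, of "\<lambda>x. Q * x"] by (auto simp: distrib_left)
  define \<epsilon>'' where "\<epsilon>'' R = (if res then complex_of_real (real r) *\<^sub>C (Q * \<epsilon>' R) else \<epsilon>' R)" for R
  have lead: "(\<lambda>R. N (\<epsilon>'' R)) \<in> o[at_top](\<lambda>R. 1)"
  proof (cases res)
    case True
    have "(\<lambda>R. N (\<epsilon>'' R)) \<in> O[at_top](\<lambda>R. N (\<epsilon>' R))"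
    proof (rule bigoI [of _ "real r * C"], intro always_eventually allI)
      fix R
      have "N (\<epsilon>'' R) \<le> real r * (C * N (\<epsilon>' R))"
        using True C by (simp add: \<epsilon>''_def scale mult_left_mono)
      then show "norm (N (\<epsilon>'' R)) \<le> real r * C * norm (N (\<epsilon>' R))"
        using coh_norm_nonneg [OF norm] by simp
    qed
    then show ?thesis using \<epsilon>' by (rule landau_o.big_small_trans)
  qed (use \<epsilon>' in \<open>simp add: \<epsilon>''_def\<close>)
  have lead_eq: "\<forall>\<^sub>F R in at_top. coh_series N r \<alpha> \<beta> R \<phi> =
           (if res then complex_of_real (1 / real r) *\<^sub>C P
               * (complex_of_real (exp (T * R)) *\<^sub>C (A + \<epsilon>'' R))
            else complex_of_real (exp (T * R)) *\<^sub>C \<epsilon>'' R)"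
    using series
  proof eventually_elim
    case (elim R)
    show ?case
    proof (cases res)
      case True
      have "complex_of_real (1 / real r) *\<^sub>C P * \<epsilon>'' R = \<epsilon>' R"
        using True r by (simp add: \<epsilon>''_def PQ flip: mult.assoc)
      then have "complex_of_real (1 / real r) *\<^sub>C P
          * (complex_of_real (exp (T * R)) *\<^sub>C (A + \<epsilon>'' R))
          = complex_of_real (exp (T * R)) *\<^sub>C (complex_of_real (1 / real r) *\<^sub>C P * A + \<epsilon>' R)"
        by (simp only: coh_scale_mult_right distrib_left)
      then show ?thesis using True elim by simp
    qed (use elim in \<open>simp add: \<epsilon>''_def\<close>)
  qed
  show ?thesis
    unfolding res_def [symmetric] P_def [symmetric]
  proof (intro conjI allI impI)
    show "\<exists>s. coh_sums N (coh_series_term r \<alpha> \<beta> R \<phi>) s" if "R > 0" for R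
      using main0 that by blast
    show "\<exists>\<epsilon> :: real \<Rightarrow> 'x cohomology. (\<lambda>R. N (\<epsilon> R)) \<in> o[at_top](\<lambda>R. 1) \<and>
        (\<forall>\<^sub>F R in at_top. coh_series N r \<alpha> \<beta> R \<phi> =
           (if res then complex_of_real (1 / real r) *\<^sub>C P
               * (complex_of_real (exp (T * R)) *\<^sub>C (A + \<epsilon> R))
            else complex_of_real (exp (T * R)) *\<^sub>C \<epsilon> R))"
      using lead lead_eq by blast
    fix L A'
    assume "A' 0 = A \<and> (\<exists>\<epsilon> :: nat \<Rightarrow> 'x cohomology. (\<lambda>m. N (\<epsilon> m)) \<in> o(\<lambda>m. 1 / real m ^ L) \<and>
           (\<forall>\<^sub>F m in sequentially.
              \<alpha> (r * m) = Mittag_Leffler_coeff T \<theta> (of_nat (r * m) + \<beta>) *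
                ((\<Sum>l\<le>L. complex_of_real (1 / real m ^ l) *\<^sub>C A' l) + \<epsilon> m)))"
    then obtain \<epsilon> :: "nat \<Rightarrow> 'x cohomology" where A': "A' 0 = A"
      and "(\<lambda>m. N (\<epsilon> m)) \<in> o(\<lambda>m. 1 / real m ^ L)"
        "\<forall>\<^sub>F m in sequentially. \<alpha> (r * m) = Mittag_Leffler_coeff T \<theta> (of_nat (r * m) + \<beta>) *
                ((\<Sum>l\<le>L. complex_of_real (1 / real m ^ l) *\<^sub>C A' l) + \<epsilon> m)"
      by blast
    from main [OF this(2,3)] show "\<exists>B. B 0 = A
        \<and> (\<exists>\<epsilon> :: real \<Rightarrow> 'x cohomology. (\<lambda>R. N (\<epsilon> R)) \<in> o[at_top](\<lambda>R. 1 / R ^ L) \<and>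
        (\<forall>\<^sub>F R in at_top. coh_series N r \<alpha> \<beta> R \<phi> =
           (if res then complex_of_real (exp (T * R)) *\<^sub>C
                ((?main L B R) + \<epsilon> R)
            else complex_of_real (exp (T * R)) *\<^sub>C \<epsilon> R)))"
      unfolding A' by blast
  qed
qed

end
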